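(* Consider the outer approximation algorithm described in the context (Algorithm 1) applied to problem (PC), with Tikhonov parameter $\alpha>0$. Assume that the algorithm does not stop after a finite number of iterations, and that the partitions $I_1^k,\dots,I_{N_k}^k$ of $(0,T)$ determined in Step 6 satisfy, for all $k\in\mathbb{N}$: (i) $I_1^k,\dots,I_{N_k}^k$ are disjoint open intervals with $\bigcup_{i=1}^{N_k}\overline{I_i^k}=[0,T]$; (ii) $\max_{i=1,\dots,N_k}\lambda(I_i^k)\to 0$ as $k\to\infty$; (iii) for each $r\in\{1,\dots,N_{k+1}\}$ there exists $i\in\{1,\dots,N_k\}$ with $I_r^{k+1}\subseteq I_i^k$; and moreover there exists $\kappa>0$ with $h_k\le \kappa\,\tau_k$ for every $k\in\mathbb{N}$, where $\tau_k:=\min_{1\le i\le N_k}\lambda(I_i^k)$ and $h_k:=\max_{1\le i\le N_k}\lambda(I_i^k)$. Then the sequence of iterates $\{u^k\}_{k\in\mathbb{N}}$ converges strongly in $L^2(0,T;\mathbb{R}^n)$ to the unique global minimizer of (PC).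
   Context: Let $T>0$, $n,d\in\mathbb{N}$, and let $\Omega\subset\mathbb{R}^d$ be a bounded domain with Lipschitz boundary; $Q:=\Omega\times(0,T)$, $\lambda$ denotes Lebesgue measure. Let $\psi_1,\dots,\psi_n\in H^{-1}(\Omega)$, $y_0\in L^2(\Omega)$, $y_{\mathrm d}\in L^2(Q)$, $\alpha\ge 0$. Let $W(0,T):=H^1(0,T;H^{-1}(\Omega))\cap L^2(0,T;H_0^1(\Omega))$ and let $S:L^2(0,T;\mathbb{R}^n)\to W(0,T)$ map $u$ to the unique weak solution $y$ of $\partial_t y-\Delta y=\sum_{j=1}^n u_j(t)\psi_j$ in $Q$, $y=0$ on $\partial\Omega\times(0,T)$, $y(0)=y_0$. Define $f(u):=\tfrac12\|Su-y_{\mathrm d}\|_{L^2(Q)}^2+\tfrac{\alpha}{2}\|u-\tfrac12\|_{L^2(0,T;\mathbb{R}^n)}^2$. Fix $p\in[1,\infty)$. Let $D\subset\{u\in BV(0,T;\mathbb{R}^n): u(t)\in\{0,1\}^n \text{ for a.a. } t\}$ be bounded in $BV(0,T;\mathbb{R}^n)$ (norm $\|u\|_{L^1}+\sum_j|u_j|_{BV(0,T)}$) and closed in $L^p(0,T;\mathbb{R}^n)$. Problem (PC) is: minimize $f(u)$ subject to $u\in\overline{\operatorname{conv}D}$, closure in $L^p(0,T;\mathbb{R}^n)$. For a linear map $\Pi:BV(0,T;\mathbb{R}^n)\to\mathbb{R}^M$, $\Pi(u)=(\langle\Phi_i,u\rangle)_{i=1}^M$ with $\Phi_i\in L^p(0,T;\mathbb{R}^n)^*$,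 set $C_{D,\Pi}:=\operatorname{conv}\{\Pi(u):u\in D\}\subset\mathbb{R}^M$ and $H_{D,\Pi}:=\{(a,b)\in[-1,1]^M\times\mathbb{R}: a^\top w\le b\ \forall w\in C_{D,\Pi}\}$. Given a partition $I_1^k,\dots,I_{N_k}^k$ of $(0,T)$ into intervals, $\Pi_k:BV(0,T;\mathbb{R}^n)\to\mathbb{R}^{nN_k}$ is defined by $(\Pi_k u)_{(j-1)N_k+i}:=\frac{1}{\lambda(I_i^k)}\int_{I_i^k}u_j(t)\,dt$, $j=1,\dots,n$, $i=1,\dots,N_k$. Algorithm 1: Set $k=0$, $T_0=\emptyset$, $I_1^0=(0,T)$, $N_0=1$. Step 2: let $u^k$ be the optimal solution of (PC$_k$): minimize $f(u)$ subject to $u\in[0,1]^n$ a.e. in $(0,T)$ and $a^\top\Pi(u)\le b$ for all $(\Pi,a,b)\in T_k$. Step 3: if $u^k\in\overline{\operatorname{conv}D}$ (closure in $L^p$), stop and return $u^k$. Otherwise, Step 6: determine intervals $I_i^{k+1}$, $1\le i\le N_{k+1}$, such that $\Pi_{k+1}(u^k)\notin C_{D,\Pi_{k+1}}$; Step 7: choose $(a_{k+1},b_{k+1})\in\arg\max_{(a,b)\in H_{D,\Pi_{k+1}}}(a^\top\Pi_{k+1}(u^k)-b)$ (a most violated inequality); set $T_{k+1}=T_k\cup\{(\Pi_{k+1},a_{k+1},b_{k+1})\}$, $k:=k+1$, and return to Step 2. *)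

theory Defs
  imports "HOL-Analysis.Analysis"
begin

(* bounded domain (open, connected, bounded) with Lipschitz boundary: near every boundary
   point, after choosing a direction e (rotation of coordinates), Omega is the subgraph of a
   Lipschitz function g defined on the hyperplane orthogonal to e *)
definition lipschitz_boundary :: "'d::euclidean_space set \<Rightarrow> bool" where
  "lipschitz_boundary \<Omega> \<longleftrightarrow>
     (\<forall>x\<in>frontier \<Omega>. \<exists>r>0. \<exists>e g L. norm e = 1 \<and>
        (\<forall>y z. y \<bullet> e = 0 \<longrightarrow> z \<bullet> e = 0 \<longrightarrow> \<bar>g y - g z\<bar> \<le> L * norm (y - z)) \<and>
        \<Omega> \<inter> ball x r = {y \<in> ball x r. y \<bullet> e < g (y - (y \<bullet> e) *\<^sub>R e)})"

definition lipschitz_domain :: "'d::euclidean_space set \<Rightarrow> bool" where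
  "lipschitz_domain \<Omega> \<longleftrightarrow> open \<Omega> \<and> connected \<Omega> \<and> \<Omega> \<noteq> {} \<and> bounded \<Omega> \<and> lipschitz_boundary \<Omega>"

fun smooth_k :: "nat \<Rightarrow> ('d::euclidean_space \<Rightarrow> real) \<Rightarrow> bool" where
  "smooth_k 0 f = continuous_on UNIV f"
| "smooth_k (Suc k) f = ((\<forall>x. f differentiable (at x)) \<and> continuous_on UNIV f \<and>
      (\<forall>e. smooth_k k (\<lambda>x. frechet_derivative f (at x) e)))"

definition smooth :: "('d::euclidean_space \<Rightarrow> real) \<Rightarrow> bool" where
  "smooth f \<longleftrightarrow> (\<forall>k. smooth_k k f)"

definition test_fun :: "'d::euclidean_space set \<Rightarrow> ('d \<Rightarrow> real) \<Rightarrow> bool" where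
  "test_fun \<Omega> \<phi> \<longleftrightarrow> smooth \<phi> \<and> compact (closure {x. \<phi> x \<noteq> 0}) \<and> closure {x. \<phi> x \<noteq> 0} \<subseteq> \<Omega>"

definition grad :: "('d::euclidean_space \<Rightarrow> real) \<Rightarrow> 'd \<Rightarrow> 'd" where
  "grad \<phi> x = (\<Sum>b\<in>Basis. frechet_derivative \<phi> (at x) b *\<^sub>R b)"

definition L2_on :: "'a::euclidean_space set \<Rightarrow> ('a \<Rightarrow> 'b::euclidean_space) \<Rightarrow> bool" where
  "L2_on A v \<longleftrightarrow> v \<in> borel_measurable (lebesgue_on A) \<and>
      integrable (lebesgue_on A) (\<lambda>x. (norm (v x))\<^sup>2)"

definition weak_grad :: "'d::euclidean_space set \<Rightarrow> ('d \<Rightarrow> real) \<Rightarrow> ('d \<Rightarrow> 'd) \<Rightarrow> bool" where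
  "weak_grad \<Omega> v G \<longleftrightarrow>
     (\<forall>\<phi> e. test_fun \<Omega> \<phi> \<longrightarrow>
        integrable (lebesgue_on \<Omega>) (\<lambda>x. v x * frechet_derivative \<phi> (at x) e) \<and>
        integrable (lebesgue_on \<Omega>) (\<lambda>x. (G x \<bullet> e) * \<phi> x) \<and>
        (\<integral>x. v x * frechet_derivative \<phi> (at x) e \<partial>lebesgue_on \<Omega>) =
          - (\<integral>x. (G x \<bullet> e) * \<phi> x \<partial>lebesgue_on \<Omega>))"

definition H10 :: "'d::euclidean_space set \<Rightarrow> ('d \<Rightarrow> real) \<Rightarrow> ('d \<Rightarrow> 'd) \<Rightarrow> bool" where
  "H10 \<Omega> v G \<longleftrightarrow> L2_on \<Omega> v \<and> L2_on \<Omega> G \<and> weak_grad \<Omega> v G \<and>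
     (\<exists>\<phi>. (\<forall>m. test_fun \<Omega> (\<phi> m)) \<and>
        (\<forall>m. integrable (lebesgue_on \<Omega>) (\<lambda>x. (\<phi> m x - v x)\<^sup>2) \<and>
             integrable (lebesgue_on \<Omega>) (\<lambda>x. (norm (grad (\<phi> m) x - G x))\<^sup>2)) \<and>
        (\<lambda>m. (\<integral>x. (\<phi> m x - v x)\<^sup>2 \<partial>lebesgue_on \<Omega>) +
              (\<integral>x. (norm (grad (\<phi> m) x - G x))\<^sup>2 \<partial>lebesgue_on \<Omega>)) \<longlonglongrightarrow> 0)"

definition H1_norm :: "'d::euclidean_space set \<Rightarrow> ('d \<Rightarrow> real) \<Rightarrow> ('d \<Rightarrow> 'd) \<Rightarrow> real" where
  "H1_norm \<Omega> v G = sqrt ((\<integral>x. (v x)\<^sup>2 \<partial>lebesgue_on \<Omega>) + (\<integral>x. (norm (G x))\<^sup>2 \<partial>lebesgue_on \<Omega>))"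

definition Hm1 :: "'d::euclidean_space set \<Rightarrow> (('d \<Rightarrow> real) \<Rightarrow> real) \<Rightarrow> bool" where
  "Hm1 \<Omega> \<psi> \<longleftrightarrow>
     (\<forall>v Gv w Gw c. H10 \<Omega> v Gv \<longrightarrow> H10 \<Omega> w Gw \<longrightarrow>
        \<psi> (\<lambda>x. v x + w x) = \<psi> v + \<psi> w \<and> \<psi> (\<lambda>x. c * v x) = c * \<psi> v) \<and>
     (\<exists>C. \<forall>v G. H10 \<Omega> v G \<longrightarrow> \<bar>\<psi> v\<bar> \<le> C * H1_norm \<Omega> v G)"

(* y is a weak solution in W(0,T) of  y_t - \<Delta>y = \<Sum>_j u_j(t) \<psi>_j,  y = 0 on the boundary,
   y(0) = y0, written as: y \<in> L^2(0,T;H^1_0(\<Omega>)) with spatial weak gradient G, and the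
   variational identity holds for all v \<in> H^1_0(\<Omega>) and all C^1 functions \<phi> with \<phi>(T) = 0. *)
definition heat_weak_sol ::
  "'d::euclidean_space set \<Rightarrow> real \<Rightarrow> ('n::finite \<Rightarrow> (('d \<Rightarrow> real) \<Rightarrow> real)) \<Rightarrow> ('d \<Rightarrow> real)
    \<Rightarrow> (real \<Rightarrow> real^'n) \<Rightarrow> (real \<Rightarrow> 'd \<Rightarrow> real) \<Rightarrow> bool" where
  "heat_weak_sol \<Omega> T \<psi> y0 u y \<longleftrightarrow>
    (\<exists>G :: real \<Rightarrow> 'd \<Rightarrow> 'd.
      L2_on ({0<..<T} \<times> \<Omega>) (\<lambda>(t,x). y t x) \<and>
      L2_on ({0<..<T} \<times> \<Omega>) (\<lambda>(t,x). G t x) \<and>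
      (AE t in lebesgue_on {0<..<T}. H10 \<Omega> (y t) (G t)) \<and>
      (\<forall>v Gv \<phi> \<phi>'. H10 \<Omega> v Gv \<longrightarrow> (\<forall>t. (\<phi> has_real_derivative \<phi>' t) (at t)) \<longrightarrow>
          continuous_on UNIV \<phi>' \<longrightarrow> \<phi> T = 0 \<longrightarrow>
          - (\<integral>t. \<phi>' t * (\<integral>x. y t x * v x \<partial>lebesgue_on \<Omega>) \<partial>lebesgue_on {0<..<T})
          + (\<integral>t. \<phi> t * (\<integral>x. G t x \<bullet> Gv x \<partial>lebesgue_on \<Omega>) \<partial>lebesgue_on {0<..<T})
          = (\<integral>t. \<phi> t * (\<Sum>j\<in>UNIV. u t $ j * \<psi> j v) \<partial>lebesgue_on {0<..<T})
            + \<phi> 0 * (\<integral>x. y0 x * v x \<partial>lebesgue_on \<Omega>)))"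

definition obj :: "'d::euclidean_space set \<Rightarrow> real \<Rightarrow> real \<Rightarrow> ((real \<Rightarrow> real^'n::finite) \<Rightarrow> (real \<Rightarrow> 'd \<Rightarrow> real))
    \<Rightarrow> (real \<Rightarrow> 'd \<Rightarrow> real) \<Rightarrow> (real \<Rightarrow> real^'n) \<Rightarrow> real" where
  "obj \<Omega> T \<alpha> S yd u =
     1/2 * (\<integral>p. (S u (fst p) (snd p) - yd (fst p) (snd p))\<^sup>2 \<partial>lebesgue_on ({0<..<T} \<times> \<Omega>))
     + \<alpha>/2 * (\<integral>t. (norm (u t - (\<chi> j. 1/2)))\<^sup>2 \<partial>lebesgue_on {0<..<T})"

definition conv_fun :: "('a \<Rightarrow> 'b::real_vector) set \<Rightarrow> ('a \<Rightarrow> 'b) set" where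
  "conv_fun S = {f. \<exists>(m::nat) c v. (\<forall>i<m. 0 \<le> c i \<and> v i \<in> S) \<and> (\<Sum>i<m. c i) = 1 \<and>
                              f = (\<lambda>x. \<Sum>i<m. c i *\<^sub>R v i x)}"

definition bv_var :: "real \<Rightarrow> (real \<Rightarrow> real) \<Rightarrow> ereal" where
  "bv_var T g = (SUP \<phi>\<phi>' \<in> {(\<phi>, \<phi>'). (\<forall>t. (\<phi> has_real_derivative \<phi>' t) (at t)) \<and>
                     continuous_on UNIV \<phi>' \<and> closure {t. \<phi> t \<noteq> 0} \<subseteq> {0<..<T} \<and>
                     (\<forall>t. \<bar>\<phi> t\<bar> \<le> 1)}.
                  ereal (\<integral>t. g t * snd \<phi>\<phi>' t \<partial>lebesgue_on {0<..<T}))"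

definition BV :: "real \<Rightarrow> (real \<Rightarrow> real^'n::finite) \<Rightarrow> bool" where
  "BV T u \<longleftrightarrow> u \<in> borel_measurable (lebesgue_on {0<..<T}) \<and>
      integrable (lebesgue_on {0<..<T}) (\<lambda>t. norm (u t)) \<and>
      (\<forall>j. bv_var T (\<lambda>t. u t $ j) < \<infinity>)"

definition BV_norm :: "real \<Rightarrow> (real \<Rightarrow> real^'n::finite) \<Rightarrow> ereal" where
  "BV_norm T u = ereal (\<integral>t. norm (u t) \<partial>lebesgue_on {0<..<T}) + (\<Sum>j\<in>UNIV. bv_var T (\<lambda>t. u t $ j))"

definition Lp_lim :: "real \<Rightarrow> real \<Rightarrow> (nat \<Rightarrow> real \<Rightarrow> real^'n::finite) \<Rightarrow> (real \<Rightarrow> real^'n) \<Rightarrow> bool" where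
  "Lp_lim p T w v \<longleftrightarrow> v \<in> borel_measurable (lebesgue_on {0<..<T}) \<and>
     (\<forall>m. w m \<in> borel_measurable (lebesgue_on {0<..<T}) \<and>
          integrable (lebesgue_on {0<..<T}) (\<lambda>t. norm (w m t - v t) powr p)) \<and>
     (\<lambda>m. \<integral>t. norm (w m t - v t) powr p \<partial>lebesgue_on {0<..<T}) \<longlonglongrightarrow> 0"

definition Lp_closure :: "real \<Rightarrow> real \<Rightarrow> (real \<Rightarrow> real^'n::finite) set \<Rightarrow> (real \<Rightarrow> real^'n) set" where
  "Lp_closure p T A = {v. \<exists>w. (\<forall>m. w m \<in> A) \<and> Lp_lim p T w v}"

definition admissible_D :: "real \<Rightarrow> real \<Rightarrow> (real \<Rightarrow> real^'n::finite) set \<Rightarrow> bool" where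
  "admissible_D p T D \<longleftrightarrow>
     (\<forall>u\<in>D. BV T u \<and> (AE t in lebesgue_on {0<..<T}. \<forall>j. u t $ j \<in> {0,1})) \<and>
     (\<exists>C. \<forall>u\<in>D. BV_norm T u \<le> ereal C) \<and>
     Lp_closure p T D \<subseteq> D"

definition Pi_avg :: "nat \<Rightarrow> (nat \<Rightarrow> real set) \<Rightarrow> (real \<Rightarrow> real^'n::finite) \<Rightarrow> ('n \<times> nat \<Rightarrow> real)" where
  "Pi_avg N I u = (\<lambda>(j,i). if i < N then
       (1 / measure lebesgue (I i)) * (\<integral>t. u t $ j \<partial>lebesgue_on (I i)) else 0)"

definition dotN :: "nat \<Rightarrow> ('n::finite \<times> nat \<Rightarrow> real) \<Rightarrow> ('n \<times> nat \<Rightarrow> real) \<Rightarrow> real" where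
  "dotN N a w = (\<Sum>ji\<in>UNIV \<times> {..<N}. a ji * w ji)"

definition C_set :: "nat \<Rightarrow> (nat \<Rightarrow> real set) \<Rightarrow> (real \<Rightarrow> real^'n::finite) set \<Rightarrow> ('n \<times> nat \<Rightarrow> real) set" where
  "C_set N I D = conv_fun (Pi_avg N I ` D)"

definition H_set :: "nat \<Rightarrow> (nat \<Rightarrow> real set) \<Rightarrow> (real \<Rightarrow> real^'n::finite) set \<Rightarrow> (('n \<times> nat \<Rightarrow> real) \<times> real) set" where
  "H_set N I D = {(a,b). (\<forall>j i. (i < N \<longrightarrow> -1 \<le> a (j,i) \<and> a (j,i) \<le> 1) \<and> (N \<le> i \<longrightarrow> a (j,i) = 0)) \<and>
                        (\<forall>w\<in>C_set N I D. dotN N a w \<le> b)}"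

definition box01 :: "real \<Rightarrow> (real \<Rightarrow> real^'n::finite) \<Rightarrow> bool" where
  "box01 T v \<longleftrightarrow> v \<in> borel_measurable (lebesgue_on {0<..<T}) \<and>
     (AE t in lebesgue_on {0<..<T}. \<forall>j. 0 \<le> v t $ j \<and> v t $ j \<le> 1)"

definition feas_k :: "real \<Rightarrow> (nat \<Rightarrow> nat) \<Rightarrow> (nat \<Rightarrow> nat \<Rightarrow> real set) \<Rightarrow> (nat \<Rightarrow> 'n::finite \<times> nat \<Rightarrow> real)
     \<Rightarrow> (nat \<Rightarrow> real) \<Rightarrow> nat \<Rightarrow> (real \<Rightarrow> real^'n) \<Rightarrow> bool" where
  "feas_k T N I a b k v \<longleftrightarrow> box01 T v \<and>
     (\<forall>m\<in>{1..k}. dotN (N m) (a m) (Pi_avg (N m) (I m) v) \<le> b m)"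

end

theory Submission
  imports Defs
begin

text \<open>
  The feasible sets of the relaxed problems decrease and contain the feasible set of (PC), and the objective is
  strongly convex. Hence the optimal values increase to a limit, and testing the optimality of \<open>u k\<close> with the midpoint of
  \<open>u k\<close> and \<open>u m\<close> shows that the controls and the states form Cauchy sequences. The limit of the states is
  the state of the limit control \<open>ubar\<close>: the difference of two solutions, integrated twice in time, is bounded by the
  difference of the controls, because the weak formulation with a quadratic spline in time and the solution itself in
  space yields an energy identity after integration. Finally \<open>ubar\<close> is feasible for (PC): a strict separation of
  \<open>ubar\<close> from \<open>D\<close> would, after discretization on a fine quasi-uniform partition, violate the most violated
  inequality by more than the convergence \<open>u k \<longlonglongrightarrow> ubar\<close> allows.
\<close>

section \<open>Square integrable functions\<close>

text \<open>All that is known of \<open>S\<close> is that \<open>S v\<close> is some weak solution.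
  Uniqueness, affinity and closedness of \<open>S\<close> must be extracted from a formulation whose
  only test functions are products of a \<open>C^1\<close> function of time vanishing at
  \<open>T\<close> and one fixed element of \<open>H10\<close>; the solution, which varies in both
  variables, is not of this form. Freezing a second time \<open>s\<close> and testing with the slice
  at \<open>s\<close> gets around this. The quadratic spline is the lowest one that is still
  \<open>C^1\<close>, and it and its derivative are consecutive antiderivatives with respect to the
  upper limit \<open>q\<close>. Hence the gradient term becomes an exact derivative in
  \<open>q\<close>, and the right-hand side can be integrated by parts in \<open>q\<close>, although
  nothing is known about derivatives of the solution in time. The resulting estimate controls only
  repeated time integrals of the state. That is weaker than continuity of \<open>S\<close> into
  \<open>L2\<close>, but enough to identify the limit of states that are already known to
  converge.\<close>

definition L2 :: "'a measure \<Rightarrow> ('a \<Rightarrow> 'e::euclidean_space) \<Rightarrow> bool" where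
  "L2 M f \<longleftrightarrow> f \<in> borel_measurable M \<and> integrable M (\<lambda>x. (norm (f x))\<^sup>2)"

text \<open>Functions are not identified almost everywhere, so \<open>nsq M f = 0\<close> does not
  give \<open>f = 0\<close>; changes on null sets go through \<open>ip_cong_AE\<close>.\<close>

definition ip :: "'a measure \<Rightarrow> ('a \<Rightarrow> 'e::euclidean_space) \<Rightarrow> ('a \<Rightarrow> 'e) \<Rightarrow> real" where
  "ip M f g = (\<integral>x. f x \<bullet> g x \<partial>M)"

lemma L2_measurable [measurable_dest]: "L2 M f \<Longrightarrow> f \<in> borel_measurable M"
  by (simp add: L2_def)

lemma L2_zero [simp, intro]: "L2 M (\<lambda>x. 0)"
  by (simp add: L2_def)

lemma norm_add_sq_le: "(norm (x + y))\<^sup>2 \<le> 2 * (norm x)\<^sup>2 + 2 * (norm y)\<^sup>2"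
  for x y :: "'a::real_inner"
proof -
  have "(norm (x + y))\<^sup>2 + (norm (x - y))\<^sup>2 = 2 * (norm x)\<^sup>2 + 2 * (norm y)\<^sup>2"
    by (simp add: power2_norm_eq_inner algebra_simps inner_commute)
  then show ?thesis by (smt (verit) zero_le_power2)
qed

lemma L2_add [intro]:
  assumes "L2 M f" "L2 M g" shows "L2 M (\<lambda>x. f x + g x)"
proof -
  have [measurable]: "f \<in> borel_measurable M" "g \<in> borel_measurable M"
    using assms by (auto simp: L2_def)
  have "integrable M (\<lambda>x. (norm (f x + g x))\<^sup>2)"
  proof (rule Bochner_Integration.integrable_bound)
    show "integrable M (\<lambda>x. 2 * (norm (f x))\<^sup>2 + 2 * (norm (g x))\<^sup>2)"
      using assms by (auto simp: L2_def)
  qed (auto simp: norm_add_sq_le)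
  then show ?thesis by (simp add: L2_def)
qed

lemma L2_scaleR [intro]: "L2 M f \<Longrightarrow> L2 M (\<lambda>x. c *\<^sub>R f x)"
  by (auto simp: L2_def power_mult_distrib)

lemma L2_diff [intro]: "L2 M f \<Longrightarrow> L2 M g \<Longrightarrow> L2 M (\<lambda>x. f x - g x)"
  using L2_add[of M f "\<lambda>x. (-1) *\<^sub>R g x"] L2_scaleR[of M g "-1"] by simp

lemma L2_inner_integrable:
  assumes "L2 M f" "L2 M g" shows "integrable M (\<lambda>x. f x \<bullet> g x)"
proof -
  have [measurable]: "f \<in> borel_measurable M" "g \<in> borel_measurable M"
    using assms by (auto simp: L2_def)
  show ?thesis
  proof (rule Bochner_Integration.integrable_bound)
    show "integrable M (\<lambda>x. (norm (f x))\<^sup>2 + (norm (g x))\<^sup>2)"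
      using assms by (auto simp: L2_def)
    have "norm (a \<bullet> b) \<le> norm ((norm a)\<^sup>2 + (norm b)\<^sup>2)" for a b :: 'b
    proof -
      have "\<bar>a \<bullet> b\<bar> \<le> norm a * norm b" by (rule Cauchy_Schwarz_ineq2)
      also have "\<dots> \<le> (norm a)\<^sup>2 + (norm b)\<^sup>2"
        using sum_squares_bound[of "norm a" "norm b"] mult_nonneg_nonneg[OF norm_ge_zero[of a] norm_ge_zero[of b]]
        by linarith
      finally show ?thesis by simp
    qed
    then show "AE x in M. norm (f x \<bullet> g x) \<le> norm ((norm (f x))\<^sup>2 + (norm (g x))\<^sup>2)" by simp
  qed auto
qed

abbreviation nsq :: "'a measure \<Rightarrow> ('a \<Rightarrow> 'e::euclidean_space) \<Rightarrow> real" where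
  "nsq M f \<equiv> ip M f f"

lemma ip_commute: "ip M f g = ip M g f"
  by (simp add: ip_def inner_commute)

lemma ip_self: "nsq M f = (\<integral>x. (norm (f x))\<^sup>2 \<partial>M)"
  by (simp add: ip_def power2_norm_eq_inner)

lemma ip_nonneg [simp]: "0 \<le> nsq M f"
  by (simp add: ip_self)

lemma ip_zero [simp]: "ip M (\<lambda>x. 0) f = 0" "ip M f (\<lambda>x. 0) = 0"
  by (simp_all add: ip_def)

lemma ip_add_left: "L2 M f \<Longrightarrow> L2 M g \<Longrightarrow> L2 M h \<Longrightarrow> ip M (\<lambda>x. f x + g x) h = ip M f h + ip M g h"
  by (simp add: ip_def inner_add_left L2_inner_integrable)

lemma ip_diff_left: "L2 M f \<Longrightarrow> L2 M g \<Longrightarrow> L2 M h \<Longrightarrow> ip M (\<lambda>x. f x - g x) h = ip M f h - ip M g h"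
  by (simp add: ip_def inner_diff_left L2_inner_integrable)

lemma ip_scaleR_left: "ip M (\<lambda>x. c *\<^sub>R f x) h = c * ip M f h"
  by (simp add: ip_def)

lemma ip_add_right: "L2 M f \<Longrightarrow> L2 M g \<Longrightarrow> L2 M h \<Longrightarrow> ip M h (\<lambda>x. f x + g x) = ip M h f + ip M h g"
  by (simp add: ip_def inner_add_right L2_inner_integrable)

lemma ip_diff_right: "L2 M f \<Longrightarrow> L2 M g \<Longrightarrow> L2 M h \<Longrightarrow> ip M h (\<lambda>x. f x - g x) = ip M h f - ip M h g"
  by (simp add: ip_def inner_diff_right L2_inner_integrable)

lemma ip_scaleR_right: "ip M h (\<lambda>x. c *\<^sub>R f x) = c * ip M h f"
  by (simp add: ip_def)

lemmas ip_linear = ip_add_left ip_diff_left ip_scaleR_left ip_add_right ip_diff_right ip_scaleR_right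

lemma ip_cong_AE:
  assumes "AE x in M. f x = f' x" "AE x in M. g x = g' x"
    and "L2 M f" "L2 M f'" "L2 M g" "L2 M g'"
  shows "ip M f g = ip M f' g'"
  unfolding ip_def using assms(1,2) by (intro integral_cong_AE) (use assms(3-) in \<open>auto simp: L2_def\<close>)

lemma ip_add_self:
  assumes "L2 M f" "L2 M g"
  shows "nsq M (\<lambda>x. f x + g x) = nsq M f + 2 * ip M f g + nsq M g"
  using assms by (simp add: ip_linear L2_add ip_commute[of M g f])

lemma ip_diff_self:
  assumes "L2 M f" "L2 M g"
  shows "nsq M (\<lambda>x. f x - g x) = nsq M f - 2 * ip M f g + nsq M g"
  using assms by (simp add: ip_linear L2_diff ip_commute[of M g f])

lemma ip_Cauchy_Schwarz:
  assumes f: "L2 M f" and g: "L2 M g"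
  shows "\<bar>ip M f g\<bar> \<le> sqrt (nsq M f) * sqrt (nsq M g)"
proof -
  have *: "0 \<le> nsq M f + 2 * t * ip M f g + t\<^sup>2 * nsq M g" for t
  proof -
    have "0 \<le> nsq M (\<lambda>x. f x + t *\<^sub>R g x)" by simp
    also have "\<dots> = nsq M f + 2 * t * ip M f g + t\<^sup>2 * nsq M g"
      using f g by (subst ip_add_self) (auto simp: ip_linear power2_eq_square)
    finally show ?thesis .
  qed
  have "(ip M f g)\<^sup>2 \<le> nsq M f * nsq M g"
  proof (cases "nsq M g = 0")
    case True
    have "ip M f g = 0"
    proof (rule ccontr)
      assume n: "ip M f g \<noteq> 0"
      \<comment> \<open>This \<open>t\<close> turns the affine expression
        \<open>nsq M f + 2 * t * ip M f g\<close> into \<open>-1\<close>.\<close>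
      from *[of "- (nsq M f + 1) / (2 * ip M f g)"] True n show False
        by (simp add: field_simps)
    qed
    then show ?thesis using True by simp
  next
    case False
    then have pos: "0 < nsq M g" using ip_nonneg[of M g] by linarith
    from *[of "- ip M f g / nsq M g"] pos show ?thesis
      by (simp add: field_simps power2_eq_square)
  qed
  then have "sqrt ((ip M f g)\<^sup>2) \<le> sqrt (nsq M f * nsq M g)" by (rule real_sqrt_le_mono)
  then show ?thesis by (simp add: real_sqrt_mult)
qed

lemma ip_add_self_le:
  assumes f: "L2 M f" and g: "L2 M g"
  shows "nsq M (\<lambda>x. f x + g x) \<le> 2 * nsq M f + 2 * nsq M g"
proof -
  have "0 \<le> nsq M (\<lambda>x. f x - g x)" by simp
  then show ?thesis using assms by (simp add: ip_add_self ip_diff_self)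
qed

text \<open>Inner products converge by Cauchy-Schwarz. Norms then follow by writing
  \<open>nsq M (fs n)\<close> as the squared distance to \<open>f\<close> plus
  \<open>2 * ip M (fs n) f - nsq M f\<close>.\<close>

lemma L2_dist_tendsto_imp:
  fixes fs :: "nat \<Rightarrow> 'a \<Rightarrow> 'e::euclidean_space"
  assumes fn: "\<And>n. L2 M (fs n)" and f: "L2 M f" and g: "L2 M g"
    and lim: "(\<lambda>n. nsq M (\<lambda>x. fs n x - f x)) \<longlonglongrightarrow> 0"
  shows "(\<lambda>n. ip M (fs n) g) \<longlonglongrightarrow> ip M f g"
    and "(\<lambda>n. nsq M (fs n)) \<longlonglongrightarrow> nsq M f"
proof -
  define d where "d n = nsq M (\<lambda>x. fs n x - f x)" for n
  have L: "L2 M (\<lambda>x. fs n x - f x)" for n using fn f by auto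
  have sq: "(\<lambda>n. sqrt (d n) * c) \<longlonglongrightarrow> 0" for c
    using tendsto_mult_right[OF tendsto_real_sqrt[OF lim], of c] by (simp add: d_def)
  have tend: "(\<lambda>n. ip M (fs n) h) \<longlonglongrightarrow> ip M f h" if h: "L2 M h" for h
  proof (rule Lim_transform2)
    show "(\<lambda>n. ip M f h) \<longlonglongrightarrow> ip M f h" by simp
    show "(\<lambda>n. ip M f h - ip M (fs n) h) \<longlonglongrightarrow> 0"
    proof (rule Lim_null_comparison[OF _ sq[of "sqrt (nsq M h)"]], rule eventuallyI)
      fix n
      have "ip M f h - ip M (fs n) h = - ip M (\<lambda>x. fs n x - f x) h"
        using fn f h by (simp add: ip_linear)
      then show "norm (ip M f h - ip M (fs n) h) \<le> sqrt (d n) * sqrt (nsq M h)"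
        using ip_Cauchy_Schwarz[OF L[of n] h] by (simp add: d_def)
    qed
  qed
  from tend[OF g] show "(\<lambda>n. ip M (fs n) g) \<longlonglongrightarrow> ip M f g" .
  have "nsq M (fs n) = d n + 2 * ip M (fs n) f - nsq M f" for n
    using fn f by (simp add: d_def ip_diff_self)
  moreover have "(\<lambda>n. d n + 2 * ip M (fs n) f - nsq M f) \<longlonglongrightarrow> 0 + 2 * nsq M f - nsq M f"
    using lim unfolding d_def by (intro tendsto_intros tend f)
  ultimately show "(\<lambda>n. nsq M (fs n)) \<longlonglongrightarrow> nsq M f" by simp
qed


text \<open>Riesz-Fischer without finiteness of \<open>M\<close>: a subsequence with rapidly
  decreasing distances converges almost everywhere, and Fatou's lemma turns the pointwise limit into
  a limit of the whole sequence in \<open>L2\<close>.\<close>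

lemma L2_complete:
  fixes f :: "nat \<Rightarrow> 'a \<Rightarrow> 'e::euclidean_space"
  assumes f: "\<And>n. L2 M (f n)"
    and Cau: "\<And>e. 0 < e \<Longrightarrow> \<exists>N. \<forall>m\<ge>N. \<forall>n\<ge>N. nsq M (\<lambda>x. f m x - f n x) < e"
  obtains g where "L2 M g" "(\<lambda>n. nsq M (\<lambda>x. f n x - g x)) \<longlonglongrightarrow> 0"
proof -
  have [measurable]: "f n \<in> borel_measurable M" for n using f by (auto simp: L2_def)
  define P where "P N j \<longleftrightarrow> (\<forall>m\<ge>N. \<forall>n\<ge>N. nsq M (\<lambda>x. f m x - f n x) < (1/8)^j)" for N j :: nat
  have "\<exists>r. \<forall>j. P (r j) j \<and> r j < r (Suc j)"
  proof (rule dependent_nat_choice)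
    show "\<exists>x. P x 0" using Cau[of "(1/8)^0"] by (auto simp: P_def)
  next
    fix x j assume "P x j"
    obtain N where "P N (Suc j)" using Cau[of "(1/8)^Suc j"] by (auto simp: P_def)
    then have "P (max N (Suc x)) (Suc j)" by (auto simp: P_def)
    then show "\<exists>y. P y (Suc j) \<and> x < y" by (intro exI[of _ "max N (Suc x)"]) auto
  qed
  then obtain r where r: "\<And>j. P (r j) j" "\<And>j. r j < r (Suc j)" by blast
  have r_mono: "strict_mono r" using r(2) by (simp add: strict_mono_Suc_iff)
  \<comment> \<open>The weight \<open>2^j\<close> uses up part of the rate \<open>(1/8)^j\<close>.
    The integrals still decay like \<open>(1/4)^j\<close>, and at a point where \<open>h j x\<close>
    stays bounded the increments decay geometrically, like \<open>sqrt (1/2) ^ j\<close>.\<close>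
  define h where "h j x = 2^j * (norm (f (r (Suc j)) x - f (r j) x))\<^sup>2" for j x
  have h_int: "integrable M (h j)" for j
    using L2_diff[OF f f, of "r (Suc j)" "r j"] by (auto simp: L2_def h_def[abs_def])
  have h_bd: "(\<integral>x. h j x \<partial>M) \<le> (1/4)^j" for j
  proof -
    have "(\<integral>x. h j x \<partial>M) = 2^j * nsq M (\<lambda>x. f (r (Suc j)) x - f (r j) x)"
      by (simp add: h_def ip_self)
    also have "\<dots> \<le> 2^j * (1/8)^j"
      using r(1)[of j] r(2)[of j] by (intro mult_left_mono less_imp_le) (auto simp: P_def)
    also have "\<dots> = (1/4)^j" by (simp flip: power_mult_distrib)
    finally show ?thesis .
  qed
  have h_sum: "AE x in M. summable (\<lambda>j. h j x)"
  proof -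
    have "(\<integral>\<^sup>+x. (\<Sum>j. ennreal (h j x)) \<partial>M) = (\<Sum>j. \<integral>\<^sup>+x. ennreal (h j x) \<partial>M)"
      by (rule nn_integral_suminf) (simp add: h_def)
    also have "\<dots> = (\<Sum>j. ennreal (\<integral>x. h j x \<partial>M))"
      by (intro suminf_cong nn_integral_eq_integral h_int) (auto simp: h_def)
    also have "\<dots> \<le> (\<Sum>j. ennreal ((1/4)^j))"
      by (intro suminf_le ennreal_leI h_bd) auto
    also have "\<dots> = ennreal (\<Sum>j. (1/4::real)^j)"
      by (rule suminf_ennreal2) (auto simp: summable_geometric)
    also have "\<dots> < \<infinity>" by simp
    finally have "(\<integral>\<^sup>+x. (\<Sum>j. ennreal (h j x)) \<partial>M) \<noteq> \<infinity>" by simp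
    then have "AE x in M. (\<Sum>j. ennreal (h j x)) \<noteq> \<infinity>"
      by (intro nn_integral_PInf_AE) (auto simp: h_def)
    then show ?thesis
      by eventually_elim (rule summable_suminf_not_top, auto simp: h_def)
  qed
  have conv: "AE x in M. convergent (\<lambda>j. f (r j) x)"
    using h_sum
  proof eventually_elim
    case (elim x)
    have "(\<lambda>j. h j x) \<longlonglongrightarrow> 0" using elim by (rule summable_LIMSEQ_zero)
    then have "Bseq (\<lambda>j. h j x)" by (intro convergent_imp_Bseq) (auto simp: convergent_def)
    then obtain K where K: "0 < K" "\<And>j. norm (h j x) \<le> K" by (auto elim: BseqE)
    have b: "norm (f (r (Suc j)) x - f (r j) x) \<le> sqrt K * (sqrt (1/2))^j" for j
    proof -
      have "(norm (f (r (Suc j)) x - f (r j) x))\<^sup>2 \<le> K * (1/2)^j"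
        using K(2)[of j] by (simp add: h_def field_simps)
      then have "sqrt ((norm (f (r (Suc j)) x - f (r j) x))\<^sup>2) \<le> sqrt (K * (1/2)^j)"
        by (rule real_sqrt_le_mono)
      then show ?thesis by (simp add: real_sqrt_mult real_sqrt_power)
    qed
    have "sqrt (1/2) < sqrt (1::real)" by (intro real_sqrt_less_mono) simp
    then have "summable (\<lambda>j. sqrt K * (sqrt (1/2))^j)"
      by (intro summable_mult summable_geometric) simp
    then have "summable (\<lambda>j. f (r (Suc j)) x - f (r j) x)"
      by (rule summable_comparison_test'[where N=0]) (use b in auto)
    then have "convergent (\<lambda>n. \<Sum>j<n. f (r (Suc j)) x - f (r j) x)"
      by (simp add: summable_iff_convergent)
    then have "convergent (\<lambda>n. f (r n) x - f (r 0) x)"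
      using sum_lessThan_telescope[of "\<lambda>j. f (r j) x"] by simp
    then have "convergent (\<lambda>n. (f (r n) x - f (r 0) x) + f (r 0) x)"
      by (intro convergent_add convergent_const)
    then show ?case by simp
  qed
  define g where "g x = lim (\<lambda>j. f (r j) x)" for x
  have g_meas [measurable]: "g \<in> borel_measurable M"
    unfolding g_def by measurable
  have lim_g: "AE x in M. (\<lambda>j. f (r j) x) \<longlonglongrightarrow> g x"
    using conv by eventually_elim (simp add: g_def convergent_LIMSEQ_iff)
  \<comment> \<open>Integrability of \<open>f n - g\<close> is not known yet, so the estimate is
    made for the nonnegative integral; integrability is then read off from it in
    \<open>L2d\<close>.\<close>
  have fatou: "(\<integral>\<^sup>+x. ennreal ((norm (f n x - g x))\<^sup>2) \<partial>M) \<le> ennreal e"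
    if "0 < e" and N: "\<forall>m\<ge>N. \<forall>n\<ge>N. nsq M (\<lambda>x. f m x - f n x) < e" and "N \<le> n" for e N n
  proof -
    have "(\<integral>\<^sup>+x. ennreal ((norm (f n x - g x))\<^sup>2) \<partial>M)
        = (\<integral>\<^sup>+x. liminf (\<lambda>j. ennreal ((norm (f n x - f (r j) x))\<^sup>2)) \<partial>M)"
    proof (rule nn_integral_cong_AE, use lim_g in eventually_elim)
      case (elim x)
      then have "(\<lambda>j. ennreal ((norm (f n x - f (r j) x))\<^sup>2)) \<longlonglongrightarrow> ennreal ((norm (f n x - g x))\<^sup>2)"
        by (intro tendsto_ennrealI tendsto_intros)
      then show ?case by (rule lim_imp_Liminf[OF trivial_limit_sequentially, symmetric])
    qed
    also have "\<dots> \<le> liminf (\<lambda>j. \<integral>\<^sup>+x. ennreal ((norm (f n x - f (r j) x))\<^sup>2) \<partial>M)"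
      by (rule nn_integral_liminf) simp
    also have "\<dots> \<le> liminf (\<lambda>j. ennreal e)"
    proof (rule Liminf_mono, rule eventually_sequentiallyI[of N])
      fix j assume "N \<le> j"
      then have "N \<le> r j" using seq_suble[OF r_mono, of j] by simp
      have "(\<integral>\<^sup>+x. ennreal ((norm (f n x - f (r j) x))\<^sup>2) \<partial>M)
          = ennreal (nsq M (\<lambda>x. f n x - f (r j) x))"
        unfolding ip_self using L2_diff[OF f f, of n "r j"]
        by (intro nn_integral_eq_integral) (auto simp: L2_def)
      also have "\<dots> \<le> ennreal e"
        using N \<open>N \<le> n\<close> \<open>N \<le> r j\<close> by (intro ennreal_leI less_imp_le) auto
      finally show "(\<integral>\<^sup>+x. ennreal ((norm (f n x - f (r j) x))\<^sup>2) \<partial>M) \<le> ennreal e" .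
    qed
    finally show ?thesis by (simp add: Liminf_const)
  qed
  have L2d: "L2 M (\<lambda>x. f n x - g x)"
    if N: "\<forall>m\<ge>N. \<forall>n\<ge>N. nsq M (\<lambda>x. f m x - f n x) < 1" "N \<le> n" for n N
  proof -
    have "(\<integral>\<^sup>+x. ennreal ((norm (f n x - g x))\<^sup>2) \<partial>M) \<le> ennreal 1"
      by (rule fatou[OF _ N]) simp
    also have "\<dots> < \<infinity>" by simp
    finally have "(\<integral>\<^sup>+x. norm ((norm (f n x - g x))\<^sup>2) \<partial>M) < \<infinity>" by simp
    then have "integrable M (\<lambda>x. (norm (f n x - g x))\<^sup>2)" by (intro integrableI_bounded) measurable
    then show ?thesis by (simp add: L2_def)
  qed
  obtain N0 where N0: "\<forall>m\<ge>N0. \<forall>n\<ge>N0. nsq M (\<lambda>x. f m x - f n x) < 1"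
    using Cau[of 1] by auto
  have "L2 M (\<lambda>x. f N0 x - (f N0 x - g x))" by (rule L2_diff[OF f L2d[OF N0 order_refl]])
  then have g: "L2 M g" by simp
  have "(\<lambda>n. nsq M (\<lambda>x. f n x - g x)) \<longlonglongrightarrow> 0"
  proof (rule LIMSEQ_I)
    fix e :: real assume "0 < e"
    then obtain N where N: "\<forall>m\<ge>N. \<forall>n\<ge>N. nsq M (\<lambda>x. f m x - f n x) < e / 2"
      using Cau[of "e/2"] by auto
    have "nsq M (\<lambda>x. f n x - g x) < e" if "N \<le> n" for n
    proof -
      have "ennreal (nsq M (\<lambda>x. f n x - g x)) = (\<integral>\<^sup>+x. ennreal ((norm (f n x - g x))\<^sup>2) \<partial>M)"
        unfolding ip_self using L2_diff[OF f g, of n]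
        by (intro nn_integral_eq_integral[symmetric]) (auto simp: L2_def)
      also have "\<dots> \<le> ennreal (e/2)" using fatou[OF _ N that] \<open>0 < e\<close> by simp
      finally show ?thesis using \<open>0 < e\<close> by (simp add: ennreal_le_iff)
    qed
    then show "\<exists>no. \<forall>n\<ge>no. norm (nsq M (\<lambda>x. f n x - g x) - 0) < e" by auto
  qed
  with g that show ?thesis by blast
qed

text \<open>The representer is the limit of a sequence minimizing \<open>nsq M f - 2 * \<psi> f\<close> over \<open>V\<close>, which is Cauchy by
  the parallelogram law; \<open>V\<close> need not be closed, and then the representer need not lie in \<open>V\<close>.\<close>

lemma L2_Riesz:
  fixes V :: "('a \<Rightarrow> 'e::euclidean_space) set" and \<psi> :: "('a \<Rightarrow> 'e) \<Rightarrow> real"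
  assumes V: "\<And>f. f \<in> V \<Longrightarrow> L2 M f"
    and V_add: "\<And>f g. f \<in> V \<Longrightarrow> g \<in> V \<Longrightarrow> (\<lambda>x. f x + g x) \<in> V"
    and V_scale: "\<And>f c. f \<in> V \<Longrightarrow> (\<lambda>x. c *\<^sub>R f x) \<in> V"
    and psi_add: "\<And>f g. f \<in> V \<Longrightarrow> g \<in> V \<Longrightarrow> \<psi> (\<lambda>x. f x + g x) = \<psi> f + \<psi> g"
    and psi_scale: "\<And>f c. f \<in> V \<Longrightarrow> \<psi> (\<lambda>x. c *\<^sub>R f x) = c * \<psi> f"
    and bd: "\<And>f. f \<in> V \<Longrightarrow> \<bar>\<psi> f\<bar> \<le> C * sqrt (nsq M f)"
  obtains r where "L2 M r" "\<And>f. f \<in> V \<Longrightarrow> \<psi> f = ip M r f"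
proof (cases "V = {}")
  case True then show ?thesis using that[of "\<lambda>x. 0"] by simp
next
  case False
  define J where "J f = nsq M f - 2 * \<psi> f" for f
  have J_lb: "- C\<^sup>2 \<le> J f" if "f \<in> V" for f
  proof -
    have "0 \<le> (sqrt (nsq M f) - C)\<^sup>2" by simp
    also have "\<dots> = nsq M f - 2 * (C * sqrt (nsq M f)) + C\<^sup>2"
      by (simp add: power2_diff)
    finally show ?thesis using bd[OF that] unfolding J_def by linarith
  qed
  define m where "m = Inf (J ` V)"
  have bb: "bdd_below (J ` V)" using J_lb by (intro bdd_belowI2) auto
  have m_le: "m \<le> J f" if "f \<in> V" for f
    unfolding m_def using that by (intro cInf_lower bb) auto
  have "\<exists>f\<in>V. J f < m + 1 / Suc n" for n
  proof -
    have "\<exists>x\<in>J ` V. x < m + 1 / Suc n"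
      unfolding m_def using False bb by (subst cInf_less_iff[symmetric]) auto
    then show ?thesis by auto
  qed
  then obtain f where f: "\<And>n::nat. f n \<in> V" "\<And>n. J (f n) < m + 1 / Suc n" by metis
  have fL: "L2 M (f n)" for n using V f by auto
  \<comment> \<open>Near-minimality of \<open>f n\<close> on the line in direction \<open>g\<close>:
    the defect \<open>1 / Suc n\<close> remains as the constant term and disappears in the
    limit.\<close>
  have quad: "0 \<le> 1 / Suc n + 2 * t * (ip M (f n) g - \<psi> g) + t\<^sup>2 * nsq M g" if g: "g \<in> V" for n t g
  proof -
    have "m \<le> J (\<lambda>x. f n x + t *\<^sub>R g x)" using f g V_add V_scale by (intro m_le) auto
    also have "\<dots> = J (f n) + 2 * t * (ip M (f n) g - \<psi> g) + t\<^sup>2 * nsq M g"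
      unfolding J_def using f(1)[of n] g V_scale[OF g, of t] V
      by (subst ip_add_self) (auto simp: ip_linear psi_add psi_scale power2_eq_square algebra_simps)
    finally show ?thesis using f(2)[of n] by linarith
  qed
  have par: "nsq M (\<lambda>x. f i x - f j x) \<le> 2 * (1 / Suc i) + 2 * (1 / Suc j)" for i j
  proof -
    define g where "g = (\<lambda>x. (1/2) *\<^sub>R (f i x + f j x))"
    have "m \<le> J g" unfolding g_def using f V_add V_scale by (intro m_le) auto
    also have "J g = J (f i) / 2 + J (f j) / 2 - nsq M (\<lambda>x. f i x - f j x) / 4"
    proof -
      have "nsq M g = (nsq M (f i) + 2 * ip M (f i) (f j) + nsq M (f j)) / 4"
        unfolding g_def ip_scaleR_left ip_scaleR_right ip_add_self[OF fL fL] by simp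
      moreover have "\<psi> g = (\<psi> (f i) + \<psi> (f j)) / 2"
        unfolding g_def psi_scale[OF V_add[OF f(1) f(1)]] psi_add[OF f(1) f(1)] by simp
      ultimately show ?thesis
        unfolding J_def ip_diff_self[OF fL fL] by (simp add: field_simps)
    qed
    finally show ?thesis using f(2)[of i] f(2)[of j] by linarith
  qed
  have "\<exists>N. \<forall>i\<ge>N. \<forall>j\<ge>N. nsq M (\<lambda>x. f i x - f j x) < e" if "0 < e" for e
  proof -
    obtain N where N: "1 / real (Suc N) < e / 4" using \<open>0 < e\<close> by (meson nat_approx_posE zero_less_divide_iff zero_less_numeral)
    have "nsq M (\<lambda>x. f i x - f j x) < e" if "N \<le> i" "N \<le> j" for i j
    proof -
      have "1 / real (Suc i) \<le> 1 / real (Suc N)" "1 / real (Suc j) \<le> 1 / real (Suc N)"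
        using that by (auto intro!: divide_left_mono)
      then show ?thesis using par[of i j] N by linarith
    qed
    then show ?thesis by blast
  qed
  from L2_complete[of M f, OF fL this] obtain r
    where r: "L2 M r" "(\<lambda>n. nsq M (\<lambda>x. f n x - r x)) \<longlonglongrightarrow> 0" by blast
  have "\<psi> g = ip M r g" if g: "g \<in> V" for g
  proof -
    have q: "0 \<le> 2 * t * (ip M r g - \<psi> g) + t\<^sup>2 * nsq M g" for t
    proof (rule LIMSEQ_le[OF tendsto_const])
      have "(\<lambda>n. 1 / real (Suc n)) \<longlonglongrightarrow> 0" by (rule LIMSEQ_Suc[OF lim_1_over_n])
      then have "(\<lambda>n. 1 / Suc n + 2 * t * (ip M (f n) g - \<psi> g) + t\<^sup>2 * nsq M g)
        \<longlonglongrightarrow> 0 + 2 * t * (ip M r g - \<psi> g) + t\<^sup>2 * nsq M g"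
        by (intro tendsto_intros L2_dist_tendsto_imp(1)[OF fL r(1) V[OF g] r(2)])
      then show "(\<lambda>n. 1 / Suc n + 2 * t * (ip M (f n) g - \<psi> g) + t\<^sup>2 * nsq M g)
        \<longlonglongrightarrow> 2 * t * (ip M r g - \<psi> g) + t\<^sup>2 * nsq M g" by simp
      show "\<exists>N. \<forall>n\<ge>N. 0 \<le> 1 / Suc n + 2 * t * (ip M (f n) g - \<psi> g) + t\<^sup>2 * nsq M g"
        using quad[OF g] by blast
    qed
    define c where "c = ip M r g - \<psi> g"
    \<comment> \<open>The \<open>+ 1\<close> avoids division by zero. At \<open>t = - c / w\<close>
      the quadratic \<open>q\<close> is at most \<open>- c\<^sup>2 / w\<close>, which forces
      \<open>c = 0\<close>.\<close>
    define w where "w = nsq M g + 1"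
    have w: "1 \<le> w" by (simp add: w_def)
    have "0 \<le> 2 * (- c / w) * c + (- c / w)\<^sup>2 * w"
      using q[of "- c / w"] unfolding c_def[symmetric]
      by (smt (verit) mult_left_mono w_def zero_le_power2)
    also have "\<dots> = - c\<^sup>2 / w" using w by (simp add: field_simps power2_eq_square)
    finally have "c = 0" using w by (simp add: field_simps)
    then show ?thesis by (simp add: c_def)
  qed
  with r that show ?thesis by blast
qed

section \<open>Kernels in time\<close>

text \<open>Extension by zero in time and Borel measurability put every integral on
  \<open>lborel\<close>, whose products are again \<open>lborel\<close>. Completed Lebesgue measure
  is not a product measure, so Fubini would not apply to it directly.\<close>

definition slab_L2 :: "real \<Rightarrow> (real \<times> 'a::euclidean_space \<Rightarrow> 'e::euclidean_space) \<Rightarrow> bool" where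
  "slab_L2 T F \<longleftrightarrow> L2 lborel F \<and> (\<forall>t x. t \<notin> {0<..<T} \<longrightarrow> F (t, x) = 0)"

text \<open>The integral is taken separately at each point \<open>x\<close> and is zero by default
  where the slice is not integrable. Linearity in \<open>c\<close> or \<open>F\<close> therefore
  holds only for almost every \<open>x\<close>.\<close>

definition tint :: "(real \<Rightarrow> real) \<Rightarrow> (real \<times> 'a::euclidean_space \<Rightarrow> 'e::euclidean_space) \<Rightarrow> 'a \<Rightarrow> 'e" where
  "tint c F x = (\<integral>t. c t *\<^sub>R F (t, x) \<partial>lborel)"

lemma L2_norm: "L2 M f \<Longrightarrow> L2 M (\<lambda>x. norm (f x))"
  by (auto simp: L2_def)

lemma L2_indicator: "A \<in> sets M \<Longrightarrow> emeasure M A < \<infinity> \<Longrightarrow> L2 M (\<lambda>x. indicator A x :: real)"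
proof -
  assume A: "A \<in> sets M" "emeasure M A < \<infinity>"
  have "(\<lambda>x. (norm (indicator A x :: real))\<^sup>2) = (indicator A :: 'a \<Rightarrow> real)"
    by (auto simp: indicator_def fun_eq_iff)
  with A show ?thesis by (simp add: L2_def)
qed

lemma slab_L2_measurable:
  assumes "slab_L2 T F" shows "F \<in> borel_measurable borel" "F \<in> borel_measurable (lborel \<Otimes>\<^sub>M lborel)"
  using assms by (auto simp: slab_L2_def L2_def lborel_prod)

lemma slab_L2_combine:
  assumes "slab_L2 T F" "slab_L2 T G"
  shows "slab_L2 T (\<lambda>p. a *\<^sub>R F p + b *\<^sub>R G p)"
  using assms by (auto simp: slab_L2_def intro!: L2_add L2_scaleR)

lemma slab_L2_fst: "slab_L2 T F \<Longrightarrow> slab_L2 T (\<lambda>p. fst (F p))"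
  and slab_L2_snd: "slab_L2 T F \<Longrightarrow> slab_L2 T (\<lambda>p. snd (F p))"
  for F :: "real \<times> 'a::euclidean_space \<Rightarrow> 'b::euclidean_space \<times> 'c::euclidean_space"
proof -
  assume F: "slab_L2 T F"
  then have [measurable]: "F \<in> borel_measurable borel" by (rule slab_L2_measurable)
  have "F \<in> lborel \<rightarrow>\<^sub>M borel \<Otimes>\<^sub>M borel" by (simp add: borel_prod)
  then have m: "(\<lambda>p. fst (F p)) \<in> borel_measurable lborel" "(\<lambda>p. snd (F p)) \<in> borel_measurable lborel"
    by (auto intro: measurable_compose[OF _ measurable_fst] measurable_compose[OF _ measurable_snd])
  have i: "integrable lborel (\<lambda>p. (norm (F p))\<^sup>2)" using F by (simp add: slab_L2_def L2_def)
  have le: "norm (fst p) \<le> norm p" "norm (snd p) \<le> norm p" for p :: "'b \<times> 'c"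
    by (metis norm_fst_le prod.collapse, metis norm_snd_le prod.collapse)
  have "integrable lborel (\<lambda>p. (norm (fst (F p)))\<^sup>2)"
    by (rule Bochner_Integration.integrable_bound[OF i])
       (use m in \<open>auto intro!: AE_I2 power_mono le\<close>)
  with m F show "slab_L2 T (\<lambda>p. fst (F p))" by (auto simp: slab_L2_def L2_def)
  have "integrable lborel (\<lambda>p. (norm (snd (F p)))\<^sup>2)"
    by (rule Bochner_Integration.integrable_bound[OF i])
       (use m in \<open>auto intro!: AE_I2 power_mono le\<close>)
  with m F show "slab_L2 T (\<lambda>p. snd (F p))" by (auto simp: slab_L2_def L2_def)
qed

lemma slab_L2_sq_integrable:
  assumes "slab_L2 T F"
  shows "integrable (lborel \<Otimes>\<^sub>M lborel) (\<lambda>(t, x). (norm (F (t, x)))\<^sup>2)"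
  using assms by (simp add: slab_L2_def L2_def lborel_prod case_prod_beta')

lemma slab_L2_slice_space:
  assumes "slab_L2 T F" shows "AE x in lborel. L2 lborel (\<lambda>t. F (t, x))"
proof -
  note [measurable] = slab_L2_measurable(2)[OF assms]
  have "AE x in lborel. integrable lborel (\<lambda>t. (norm (F (t, x)))\<^sup>2)"
    using lborel_pair.AE_integrable_snd[of "\<lambda>t x. (norm (F (t, x)))\<^sup>2"] slab_L2_sq_integrable[OF assms] by simp
  moreover have "(\<lambda>t. F (t, x)) \<in> borel_measurable lborel" for x by measurable
  ultimately show ?thesis by (auto simp: L2_def)
qed

text \<open>Cauchy-Schwarz in time against the indicator of \<open>{0<..<T}\<close>, whose squared
  norm is \<open>T\<close>.\<close>

lemma slab_slice_bound:
  fixes F :: "real \<times> 'a::euclidean_space \<Rightarrow> 'e::euclidean_space"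
  assumes F: "slab_L2 T F" and x: "L2 lborel (\<lambda>t. F (t, x))" and "0 \<le> T"
    and c: "c \<in> borel_measurable borel" "\<And>t. t \<in> {0<..<T} \<Longrightarrow> \<bar>c t\<bar> \<le> K" and K: "0 \<le> K"
  shows "integrable lborel (\<lambda>t. c t *\<^sub>R F (t, x))"
    and "(norm (tint c F x))\<^sup>2 \<le> T * K\<^sup>2 * (\<integral>t. (norm (F (t, x)))\<^sup>2 \<partial>lborel)"
proof -
  note [measurable] = slab_L2_measurable(2)[OF F] c(1)
  define e :: "real \<Rightarrow> real" where "e t = indicator {0<..<T} t" for t
  have e: "L2 lborel e" unfolding e_def by (rule L2_indicator) (use \<open>0 \<le> T\<close> in auto)
  have n: "L2 lborel (\<lambda>t. norm (F (t, x)))" using x by (rule L2_norm)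
  have en: "integrable lborel (\<lambda>t. K * (e t * norm (F (t, x))))"
    using L2_inner_integrable[OF e n] by simp
  have b: "norm (c t *\<^sub>R F (t, x)) \<le> K * (e t * norm (F (t, x)))" for t
    using c(2)[of t] F by (cases "t \<in> {0<..<T}") (auto simp: e_def slab_L2_def intro: mult_right_mono)
  show i: "integrable lborel (\<lambda>t. c t *\<^sub>R F (t, x))"
  proof (rule Bochner_Integration.integrable_bound[OF en])
    show "(\<lambda>t. c t *\<^sub>R F (t, x)) \<in> borel_measurable lborel" by measurable
    show "AE t in lborel. norm (c t *\<^sub>R F (t, x)) \<le> norm (K * (e t * norm (F (t, x))))"
      using order_trans[OF b abs_ge_self] by simp
  qed
  have "norm (tint c F x) \<le> (\<integral>t. norm (c t *\<^sub>R F (t, x)) \<partial>lborel)"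
    unfolding tint_def by (rule integral_norm_bound)
  also have "\<dots> \<le> (\<integral>t. K * (e t * norm (F (t, x))) \<partial>lborel)"
    by (intro integral_mono integrable_norm i en b)
  also have "\<dots> = K * ip lborel e (\<lambda>t. norm (F (t, x)))" by (simp add: ip_def)
  also have "\<dots> \<le> K * (sqrt (nsq lborel e) * sqrt (nsq lborel (\<lambda>t. norm (F (t, x)))))"
    using ip_Cauchy_Schwarz[OF e n] K by (intro mult_left_mono) auto
  also have "nsq lborel e = T"
  proof -
    have "nsq lborel e = (\<integral>t. indicator {0<..<T} t \<partial>lborel)"
      unfolding ip_def e_def by (intro Bochner_Integration.integral_cong) (auto simp: indicator_def)
    then show ?thesis using \<open>0 \<le> T\<close> by simp
  qed
  finally have "(norm (tint c F x))\<^sup>2 \<le> (K * (sqrt T * sqrt (nsq lborel (\<lambda>t. norm (F (t, x))))))\<^sup>2"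
    by (intro power_mono) auto
  then show "(norm (tint c F x))\<^sup>2 \<le> T * K\<^sup>2 * (\<integral>t. (norm (F (t, x)))\<^sup>2 \<partial>lborel)"
    using \<open>0 \<le> T\<close> by (simp add: power_mult_distrib ip_self mult_ac)
qed

lemma tint_measurable:
  assumes F: "slab_L2 T F" and [measurable]: "c \<in> borel_measurable borel"
  shows "tint c F \<in> borel_measurable borel"
proof -
  note [measurable] = slab_L2_measurable(2)[OF F]
  have "(\<lambda>x. \<integral>t. c t *\<^sub>R F (t, x) \<partial>lborel) \<in> borel_measurable lborel"
    by (rule lborel.borel_measurable_lebesgue_integral) measurable
  then show ?thesis by (simp add: tint_def[abs_def])
qed

lemma tint_L2:
  assumes F: "slab_L2 T F" and "0 \<le> T"
    and c: "c \<in> borel_measurable borel" "\<And>t. t \<in> {0<..<T} \<Longrightarrow> \<bar>c t\<bar> \<le> K" and K: "0 \<le> K"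
  shows "L2 lborel (tint c F)" and "nsq lborel (tint c F) \<le> T * K\<^sup>2 * nsq lborel F"
proof -
  note [measurable] = tint_measurable[OF F c(1)]
  have i: "integrable lborel (\<lambda>x. T * K\<^sup>2 * (\<integral>t. (norm (F (t, x)))\<^sup>2 \<partial>lborel))"
    using lborel_pair.integrable_snd[of "\<lambda>t x. (norm (F (t, x)))\<^sup>2"] slab_L2_sq_integrable[OF F] by simp
  have ae: "AE x in lborel. (norm (tint c F x))\<^sup>2 \<le> T * K\<^sup>2 * (\<integral>t. (norm (F (t, x)))\<^sup>2 \<partial>lborel)"
    using slab_L2_slice_space[OF F] by eventually_elim (rule slab_slice_bound[OF F _ \<open>0 \<le> T\<close> c K])
  have i2: "integrable lborel (\<lambda>x. (norm (tint c F x))\<^sup>2)"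
    by (rule Bochner_Integration.integrable_bound[OF i]) (use ae in \<open>auto intro: order_trans[OF _ abs_ge_self]\<close>)
  then show "L2 lborel (tint c F)" by (simp add: L2_def)
  have "nsq lborel (tint c F) \<le> (\<integral>x. T * K\<^sup>2 * (\<integral>t. (norm (F (t, x)))\<^sup>2 \<partial>lborel) \<partial>lborel)"
    unfolding ip_self by (rule integral_mono_AE[OF i2 i ae])
  also have "\<dots> = T * K\<^sup>2 * nsq lborel F"
    using lborel_pair.integral_snd[of "\<lambda>t x. (norm (F (t, x)))\<^sup>2"] slab_L2_sq_integrable[OF F]
    by (simp add: ip_self lborel_prod case_prod_beta')
  finally show "nsq lborel (tint c F) \<le> T * K\<^sup>2 * nsq lborel F" .
qed

text \<open>Fubini carries the time kernel into the spatial inner product. The integrand is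
  dominated by \<open>K\<close> times the sum of the two squared norms, where \<open>w\<close> has
  to be cut off in time by \<open>e\<close>, since it does not depend on \<open>t\<close> and would
  not be integrable over all times.\<close>

lemma tint_ip:
  fixes F :: "real \<times> 'a::euclidean_space \<Rightarrow> 'e::euclidean_space"
  assumes F: "slab_L2 T F" and "0 \<le> T"
    and c: "c \<in> borel_measurable borel" "\<And>t. t \<in> {0<..<T} \<Longrightarrow> \<bar>c t\<bar> \<le> K" and K: "0 \<le> K"
    and w: "L2 lborel w"
  shows "integrable lborel (\<lambda>t. c t * ip lborel (\<lambda>x. F (t, x)) w)"
    and "(\<integral>t. c t * ip lborel (\<lambda>x. F (t, x)) w \<partial>lborel) = ip lborel (tint c F) w"
proof -
  note [measurable] = slab_L2_measurable(2)[OF F] c(1)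
  have wm[measurable]: "w \<in> borel_measurable borel" using w by (simp add: L2_def)
  define e :: "real \<Rightarrow> real" where "e t = indicator {0<..<T} t" for t
  have [measurable]: "e \<in> borel_measurable borel" unfolding e_def by measurable
  have wi: "integrable lborel (\<lambda>x. (norm (w x))\<^sup>2)" using w by (simp add: L2_def)
  have ew: "integrable (lborel \<Otimes>\<^sub>M lborel) (\<lambda>p. e (fst p) * (norm (w (snd p)))\<^sup>2)"
  proof (rule lborel_pair.Fubini_integrable)
    show "(\<lambda>p. e (fst p) * (norm (w (snd p)))\<^sup>2) \<in> borel_measurable (lborel \<Otimes>\<^sub>M lborel)" by measurable
    have "integrable lborel (\<lambda>t. e t * (\<integral>x. (norm (w x))\<^sup>2 \<partial>lborel))"
      unfolding e_def using \<open>0 \<le> T\<close> by (intro integrable_mult_left) auto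
    then show "integrable lborel (\<lambda>t. \<integral>x. norm (e (fst (t, x)) * (norm (w (snd (t, x))))\<^sup>2) \<partial>lborel)"
      by (simp add: abs_mult e_def)
    show "AE t in lborel. integrable lborel (\<lambda>x. e (fst (t, x)) * (norm (w (snd (t, x))))\<^sup>2)"
      using wi by simp
  qed
  have dom: "integrable (lborel \<Otimes>\<^sub>M lborel) (\<lambda>p. K * ((norm (F p))\<^sup>2 + e (fst p) * (norm (w (snd p)))\<^sup>2))"
    using slab_L2_sq_integrable[OF F] ew by (simp add: case_prod_beta')
  have int: "integrable (lborel \<Otimes>\<^sub>M lborel) (\<lambda>(t, x). c t * (F (t, x) \<bullet> w x))"
  proof (rule Bochner_Integration.integrable_bound[OF dom])
    show "(\<lambda>(t, x). c t * (F (t, x) \<bullet> w x)) \<in> borel_measurable (lborel \<Otimes>\<^sub>M lborel)" by measurable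
    have "norm (c t * (F (t, x) \<bullet> w x)) \<le> norm (K * ((norm (F (t,x)))\<^sup>2 + e t * (norm (w x))\<^sup>2))" for t x
    proof (cases "t \<in> {0<..<T}")
      case True
      have "\<bar>F (t, x) \<bullet> w x\<bar> \<le> norm (F (t,x)) * norm (w x)" by (rule Cauchy_Schwarz_ineq2)
      also have "\<dots> \<le> (norm (F (t,x)))\<^sup>2 + (norm (w x))\<^sup>2"
        using sum_squares_bound[of "norm (F (t,x))" "norm (w x)"]
          mult_nonneg_nonneg[OF norm_ge_zero[of "F (t,x)"] norm_ge_zero[of "w x"]] by linarith
      finally have "\<bar>c t\<bar> * \<bar>F (t, x) \<bullet> w x\<bar> \<le> K * ((norm (F (t,x)))\<^sup>2 + (norm (w x))\<^sup>2)"
        using c(2)[OF True] K by (intro mult_mono) auto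
      then show ?thesis using True K by (simp add: e_def abs_mult)
    next
      case False
      then have "F (t, x) = 0" using F by (simp add: slab_L2_def)
      then show ?thesis by simp
    qed
    then show "AE p in lborel \<Otimes>\<^sub>M lborel. norm (case p of (t, x) \<Rightarrow> c t * (F (t, x) \<bullet> w x))
        \<le> norm (K * ((norm (F p))\<^sup>2 + e (fst p) * (norm (w (snd p)))\<^sup>2))" by (auto simp: case_prod_beta')
  qed
  have eq: "(\<integral>x. c t * (F (t, x) \<bullet> w x) \<partial>lborel) = c t * ip lborel (\<lambda>x. F (t, x)) w" for t
    by (simp add: ip_def)
  show "integrable lborel (\<lambda>t. c t * ip lborel (\<lambda>x. F (t, x)) w)"
    using lborel_pair.integrable_fst[OF int] unfolding eq .
  have "(\<integral>t. c t * ip lborel (\<lambda>x. F (t, x)) w \<partial>lborel) = (\<integral>x. (\<integral>t. c t * (F (t, x) \<bullet> w x) \<partial>lborel) \<partial>lborel)"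
    using lborel_pair.Fubini_integral[OF int] unfolding eq by simp
  also have "\<dots> = (\<integral>x. tint c F x \<bullet> w x \<partial>lborel)"
  proof (rule integral_cong_AE)
    show "(\<lambda>x. \<integral>t. c t * (F (t, x) \<bullet> w x) \<partial>lborel) \<in> borel_measurable lborel"
      using lborel_pair.integrable_snd[OF int] by auto
    show "(\<lambda>x. tint c F x \<bullet> w x) \<in> borel_measurable lborel"
      using tint_measurable[OF F c(1)] by measurable
    show "AE x in lborel. (\<integral>t. c t * (F (t, x) \<bullet> w x) \<partial>lborel) = tint c F x \<bullet> w x"
      using slab_L2_slice_space[OF F]
    proof eventually_elim
      case (elim x)
      show ?case using integral_inner_left[OF slab_slice_bound(1)[OF F elim \<open>0 \<le> T\<close> c K], of "w x"]
        by (simp add: tint_def)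
    qed
  qed
  finally show "(\<integral>t. c t * ip lborel (\<lambda>x. F (t, x)) w \<partial>lborel) = ip lborel (tint c F) w"
    by (simp add: ip_def)
qed

lemma tint_combine:
  assumes F: "slab_L2 T F" and "0 \<le> T"
    and c: "c \<in> borel_measurable borel" "\<And>t. t \<in> {0<..<T} \<Longrightarrow> \<bar>c t\<bar> \<le> K" and K: "0 \<le> K"
    and d: "d \<in> borel_measurable borel" "\<And>t. t \<in> {0<..<T} \<Longrightarrow> \<bar>d t\<bar> \<le> K'" and K': "0 \<le> K'"
  shows "AE x in lborel. tint (\<lambda>t. c t + a * d t) F x = tint c F x + a *\<^sub>R tint d F x"
  using slab_L2_slice_space[OF F]
proof eventually_elim
  case (elim x)
  show ?case
    using slab_slice_bound(1)[OF F elim \<open>0 \<le> T\<close> c K] slab_slice_bound(1)[OF F elim \<open>0 \<le> T\<close> d K']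
    by (simp add: tint_def scaleR_add_left flip: scaleR_scaleR)
qed

lemma tint_diff_fun:
  assumes F: "slab_L2 T F" and G: "slab_L2 T G" and "0 \<le> T"
    and c: "c \<in> borel_measurable borel" "\<And>t. t \<in> {0<..<T} \<Longrightarrow> \<bar>c t\<bar> \<le> K" and K: "0 \<le> K"
  shows "AE x in lborel. tint c (\<lambda>p. F p - G p) x = tint c F x - tint c G x"
  using slab_L2_slice_space[OF F] slab_L2_slice_space[OF G]
proof eventually_elim
  case (elim x)
  show ?case
    using slab_slice_bound(1)[OF F elim(1) \<open>0 \<le> T\<close> c K] slab_slice_bound(1)[OF G elim(2) \<open>0 \<le> T\<close> c K]
    by (simp add: tint_def scaleR_diff_right)
qed

text \<open>The test functions in time. In the variable \<open>t\<close>, \<open>qramp q\<close> is \<open>C\<^sup>1\<close> with derivative \<open>- ramp q\<close> and vanishes at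
  \<open>T\<close> for \<open>q \<le> T\<close>; in the variable \<open>q\<close>, its derivative is \<open>ramp q\<close>. Hence \<open>tint (ramp q)\<close> and \<open>tint (qramp q)\<close>
  are the twofold and threefold time integrals up to \<open>q\<close>.\<close>

definition ramp :: "real \<Rightarrow> real \<Rightarrow> real" where "ramp q t = max 0 (q - t)"
definition qramp :: "real \<Rightarrow> real \<Rightarrow> real" where "qramp q t = (max 0 (q - t))\<^sup>2 / 2"

section \<open>Dependence of the time kernels on the upper limit \<open>q\<close>\<close>

lemma ramp_measurable [measurable]: "ramp q \<in> borel_measurable borel"
  and qramp_measurable [measurable]: "qramp q \<in> borel_measurable borel"
  by (auto simp: ramp_def[abs_def] qramp_def[abs_def])

lemma ramp_bound: "0 < t \<Longrightarrow> \<bar>ramp q t\<bar> \<le> \<bar>q\<bar>"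
  by (auto simp: ramp_def)

lemma qramp_bound: assumes "0 < t" shows "\<bar>qramp q t\<bar> \<le> q\<^sup>2 / 2"
proof -
  have "(max 0 (q - t))\<^sup>2 \<le> \<bar>q\<bar>\<^sup>2" using assms by (intro power_mono) auto
  then show ?thesis by (simp add: qramp_def)
qed

lemma ramp_Lipschitz: "\<bar>ramp (q + h) t - ramp q t\<bar> \<le> \<bar>h\<bar>"
  by (auto simp: ramp_def)

text \<open>Taylor's formula for half the square of the positive part, whose derivative is Lipschitz
  with constant 1. In the case where \<open>r + h\<close> is negative, completing the square gives
  \<open>r\<^sup>2 / 2 + h * r = ((r + h)\<^sup>2 - h\<^sup>2) / 2\<close> with
  \<open>(r + h)\<^sup>2 \<le> h\<^sup>2\<close>.\<close>

lemma qramp_remainder: "\<bar>qramp (q + h) t - qramp q t - h * ramp q t\<bar> \<le> h\<^sup>2 / 2"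
proof -
  define r where "r = q - t"
  have "\<bar>(max 0 (r + h))\<^sup>2 / 2 - (max 0 r)\<^sup>2 / 2 - h * max 0 r\<bar> \<le> h\<^sup>2 / 2"
  proof (cases "0 \<le> r"; cases "0 \<le> r + h")
    assume "0 \<le> r" "0 \<le> r + h"
    then show ?thesis by (simp add: max_def power2_eq_square field_simps)
  next
    assume *: "0 \<le> r" "\<not> 0 \<le> r + h"
    then have "\<bar>r + h\<bar> \<le> \<bar>h\<bar>" by simp
    then have sq: "(r + h)\<^sup>2 \<le> h\<^sup>2" by (simp add: abs_le_square_iff)
    define A where "A = (r + h)\<^sup>2"
    have "0 \<le> A" "A \<le> h\<^sup>2" using sq by (auto simp: A_def)
    moreover have "r\<^sup>2 / 2 + h * r = (A - h\<^sup>2) / 2" by (simp add: A_def power2_eq_square field_simps)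
    ultimately have "\<bar>- (r\<^sup>2 / 2 + h * r)\<bar> \<le> h\<^sup>2 / 2" by simp
    moreover have "(max 0 (r + h))\<^sup>2 / 2 - (max 0 r)\<^sup>2 / 2 - h * max 0 r = - (r\<^sup>2 / 2 + h * r)"
      using * by simp
    ultimately show ?thesis by simp
  next
    assume *: "\<not> 0 \<le> r" "0 \<le> r + h"
    then have "(r + h)\<^sup>2 \<le> h\<^sup>2" by (intro power_mono) auto
    then show ?thesis using * by (simp add: max_def)
  next
    assume "\<not> 0 \<le> r" "\<not> 0 \<le> r + h"
    then show ?thesis by (simp add: max_def)
  qed
  then show ?thesis by (simp add: ramp_def qramp_def r_def algebra_simps)
qed

text \<open>A substitute for differentiation under the integral sign: every derivative of an
  integral in \<open>q\<close> below is obtained from an explicit remainder. The restriction to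
  \<open>\<bar>h\<bar> \<le> 1\<close> allows terms of higher order in \<open>h\<close> to be
  absorbed into the constant.\<close>

lemma DERIV_quadratic_remainder:
  fixes f :: "real \<Rightarrow> real"
  assumes "\<And>h. \<bar>h\<bar> \<le> 1 \<Longrightarrow> \<bar>f (q + h) - f q - h * D\<bar> \<le> C * h\<^sup>2"
  shows "(f has_real_derivative D) (at q)"
  unfolding DERIV_def
proof (rule LIM_zero_cancel, rule Lim_null_comparison)
  show "\<forall>\<^sub>F h in at 0. norm ((f (q + h) - f q) / h - D) \<le> C * \<bar>h\<bar>"
    unfolding eventually_at
  proof (intro exI[of _ 1] conjI ballI impI)
    fix h :: real assume h: "h \<noteq> 0 \<and> dist h 0 < 1"
    then have "\<bar>f (q + h) - f q - h * D\<bar> / \<bar>h\<bar> \<le> C * h\<^sup>2 / \<bar>h\<bar>"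
      by (intro divide_right_mono assms) auto
    also have "C * h\<^sup>2 / \<bar>h\<bar> = C * \<bar>h\<bar>"
      using h by (simp add: power2_eq_square field_simps abs_if)
    also have "\<bar>f (q + h) - f q - h * D\<bar> / \<bar>h\<bar> = norm ((f (q + h) - f q) / h - D)"
      using h by (simp add: field_simps flip: abs_divide)
    finally show "norm ((f (q + h) - f q) / h - D) \<le> C * \<bar>h\<bar>" .
  qed simp
  show "((\<lambda>h. C * \<bar>h\<bar>) \<longlongrightarrow> 0) (at 0)" by (intro tendsto_mult_right_zero tendsto_rabs_zero) simp
qed

text \<open>Differentiability of \<open>q \<mapsto> tint (qramp q) F\<close> as a map into
  \<open>L2\<close>: the remainder kernel is bounded by \<open>h\<^sup>2\<close> uniformly in time,
  so \<open>tint_L2\<close> bounds the remainder in norm.\<close>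

lemma tint_qramp_remainder:
  fixes F :: "real \<times> 'a::euclidean_space \<Rightarrow> 'e::euclidean_space"
  assumes F: "slab_L2 T F" and T: "0 \<le> T"
  obtains \<rho> where "L2 lborel \<rho>"
    "AE x in lborel. tint (qramp (q + h)) F x = tint (qramp q) F x + h *\<^sub>R tint (ramp q) F x + \<rho> x"
    "sqrt (nsq lborel \<rho>) \<le> sqrt (T * nsq lborel F) * h\<^sup>2"
proof
  define r where "r t = qramp (q + h) t - qramp q t - h * ramp q t" for t
  have rm [measurable]: "r \<in> borel_measurable borel" unfolding r_def by measurable
  have rb: "\<bar>r t\<bar> \<le> h\<^sup>2" for t unfolding r_def using qramp_remainder[of q h t] zero_le_power2[of h] by linarith
  note b = tint_L2[OF F T rm rb, simplified]
  show "L2 lborel (tint r F)" by (rule b)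
  have "nsq lborel (tint r F) \<le> T * nsq lborel F * (h\<^sup>2)\<^sup>2" using b by (simp add: mult_ac)
  from real_sqrt_le_mono[OF this]
  show "sqrt (nsq lborel (tint r F)) \<le> sqrt (T * nsq lborel F) * h\<^sup>2"
    unfolding real_sqrt_mult[of "T * nsq lborel F"] real_sqrt_abs by simp
  show "AE x in lborel. tint (qramp (q + h)) F x = tint (qramp q) F x + h *\<^sub>R tint (ramp q) F x + tint r F x"
    using slab_L2_slice_space[OF F]
  proof eventually_elim
    case (elim x)
    have i: "integrable lborel (\<lambda>t. qramp q t *\<^sub>R F (t, x))" "integrable lborel (\<lambda>t. ramp q t *\<^sub>R F (t, x))"
      "integrable lborel (\<lambda>t. r t *\<^sub>R F (t, x))"
      using slab_slice_bound(1)[OF F elim T, of "qramp q" "q\<^sup>2/2"] slab_slice_bound(1)[OF F elim T, of "ramp q" "\<bar>q\<bar>"]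
        slab_slice_bound(1)[OF F elim T, of r "h\<^sup>2"] ramp_bound qramp_bound rb by auto
    have "tint (qramp (q + h)) F x = (\<integral>t. qramp q t *\<^sub>R F (t, x) + h *\<^sub>R (ramp q t *\<^sub>R F (t, x)) + r t *\<^sub>R F (t, x) \<partial>lborel)"
      unfolding tint_def by (intro Bochner_Integration.integral_cong) (auto simp: r_def algebra_simps)
    also have "\<dots> = tint (qramp q) F x + h *\<^sub>R tint (ramp q) F x + tint r F x"
      unfolding tint_def using i by (simp del: scaleR_scaleR)
    finally show ?case .
  qed
qed

lemma tint_ramp_L2:
  assumes F: "slab_L2 T F" and T: "0 \<le> T"
  shows "L2 lborel (tint (ramp q) F)" and "nsq lborel (tint (ramp q) F) \<le> T * q\<^sup>2 * nsq lborel F"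
  using tint_L2[OF F T, of "ramp q" "\<bar>q\<bar>"] ramp_bound by auto

lemma tint_qramp_L2:
  assumes F: "slab_L2 T F" and T: "0 \<le> T"
  shows "L2 lborel (tint (qramp q) F)"
  using tint_L2[OF F T, of "qramp q" "q\<^sup>2/2"] qramp_bound by auto

lemma DERIV_tint_qramp_ip:
  fixes F :: "real \<times> 'a::euclidean_space \<Rightarrow> 'e::euclidean_space"
  assumes F: "slab_L2 T F" and T: "0 \<le> T" and w: "L2 lborel w"
  shows "((\<lambda>q. ip lborel (tint (qramp q) F) w) has_real_derivative ip lborel (tint (ramp q) F) w) (at q)"
proof (rule DERIV_quadratic_remainder)
  fix h :: real
  obtain \<rho> where r: "L2 lborel \<rho>"
    "AE x in lborel. tint (qramp (q + h)) F x = tint (qramp q) F x + h *\<^sub>R tint (ramp q) F x + \<rho> x"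
    "sqrt (nsq lborel \<rho>) \<le> sqrt (T * nsq lborel F) * h\<^sup>2"
    by (rule tint_qramp_remainder[OF F T, of q h])
  note L = tint_ramp_L2(1)[OF F T, of q] tint_qramp_L2[OF F T] r(1) w
  have "ip lborel (tint (qramp (q + h)) F) w = ip lborel (\<lambda>x. tint (qramp q) F x + h *\<^sub>R tint (ramp q) F x + \<rho> x) w"
    by (rule ip_cong_AE[OF r(2)]) (use L in \<open>auto intro!: L2_add L2_scaleR\<close>)
  also have "\<dots> = ip lborel (tint (qramp q) F) w + h * ip lborel (tint (ramp q) F) w + ip lborel \<rho> w"
    using L by (simp add: ip_linear L2_add L2_scaleR)
  finally have "\<bar>ip lborel (tint (qramp (q + h)) F) w - ip lborel (tint (qramp q) F) w - h * ip lborel (tint (ramp q) F) w\<bar>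
      = \<bar>ip lborel \<rho> w\<bar>" by simp
  also have "\<dots> \<le> sqrt (nsq lborel \<rho>) * sqrt (nsq lborel w)" by (rule ip_Cauchy_Schwarz[OF r(1) w])
  also have "\<dots> \<le> (sqrt (T * nsq lborel F) * h\<^sup>2) * sqrt (nsq lborel w)"
    by (intro mult_right_mono r) auto
  finally show "\<bar>ip lborel (tint (qramp (q + h)) F) w - ip lborel (tint (qramp q) F) w - h * ip lborel (tint (ramp q) F) w\<bar>
      \<le> (sqrt (T * nsq lborel F) * sqrt (nsq lborel w)) * h\<^sup>2" by (simp add: mult_ac)
qed

text \<open>Product rule for the squared norm. After expansion only the mixed term of
  \<open>a\<close> and \<open>b\<close> is linear in \<open>h\<close>; all other terms are of order
  at least two and are reduced to multiples of \<open>h\<^sup>2\<close> by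
  \<open>\<bar>h\<bar> \<le> 1\<close>.\<close>

lemma DERIV_tint_qramp_sq:
  fixes F :: "real \<times> 'a::euclidean_space \<Rightarrow> 'e::euclidean_space"
  assumes F: "slab_L2 T F" and T: "0 \<le> T"
  shows "((\<lambda>q. nsq lborel (tint (qramp q) F)) has_real_derivative
           2 * ip lborel (tint (qramp q) F) (tint (ramp q) F)) (at q)"
proof (rule DERIV_quadratic_remainder)
  fix h :: real assume h: "\<bar>h\<bar> \<le> 1"
  obtain \<rho> where r: "L2 lborel \<rho>"
    "AE x in lborel. tint (qramp (q + h)) F x = tint (qramp q) F x + h *\<^sub>R tint (ramp q) F x + \<rho> x"
    "sqrt (nsq lborel \<rho>) \<le> sqrt (T * nsq lborel F) * h\<^sup>2"
    by (rule tint_qramp_remainder[OF F T, of q h])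
  define a where "a = tint (qramp q) F"
  define b where "b = tint (ramp q) F"
  define R where "R = sqrt (T * nsq lborel F)"
  note L = tint_ramp_L2(1)[OF F T, of q, folded b_def] tint_qramp_L2[OF F T, of q, folded a_def] r(1)
  note L' = tint_qramp_L2[OF F T, of "q+h"]
  have "nsq lborel (tint (qramp (q + h)) F)
      = nsq lborel (\<lambda>x. a x + (h *\<^sub>R b x + \<rho> x))"
    by (rule ip_cong_AE) (use L L' r(2) in \<open>auto simp: a_def b_def add.assoc intro!: L2_add L2_scaleR\<close>)
  also have "\<dots> = nsq lborel a + 2 * h * ip lborel a b + (2 * ip lborel a \<rho> + h\<^sup>2 * nsq lborel b
      + 2 * h * ip lborel b \<rho> + nsq lborel \<rho>)"
    using L by (simp add: ip_add_self L2_add L2_scaleR ip_scaleR_left ip_scaleR_right ip_add_right power2_eq_square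
        ip_commute[of lborel \<rho> a] ip_commute[of lborel \<rho> b] algebra_simps)
  finally have eq: "nsq lborel (tint (qramp (q + h)) F) - nsq lborel a - h * (2 * ip lborel a b)
      = 2 * ip lborel a \<rho> + h\<^sup>2 * nsq lborel b + 2 * h * ip lborel b \<rho> + nsq lborel \<rho>" by simp
  have rr: "sqrt (nsq lborel \<rho>) \<le> R * h\<^sup>2" using r(3) by (simp add: R_def)
  have R0: "0 \<le> R" using T by (simp add: R_def)
  have h1: "h\<^sup>2 \<le> 1" using h by (simp add: abs_square_le_1)
  have Rh: "R * h\<^sup>2 \<le> R" using mult_left_mono[OF h1 R0] by simp
  have A: "\<bar>ip lborel a \<rho>\<bar> \<le> sqrt (nsq lborel a) * R * h\<^sup>2"
    using order_trans[OF ip_Cauchy_Schwarz[OF L(2,3)] mult_left_mono[OF rr]] by (simp add: mult_ac)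
  have B: "\<bar>ip lborel b \<rho>\<bar> \<le> sqrt (nsq lborel b) * R * h\<^sup>2"
    using order_trans[OF ip_Cauchy_Schwarz[OF L(1,3)] mult_left_mono[OF rr]] by (simp add: mult_ac)
  have C: "\<bar>2 * h * ip lborel b \<rho>\<bar> \<le> 2 * (sqrt (nsq lborel b) * R * h\<^sup>2)"
  proof -
    have "\<bar>h\<bar> * \<bar>ip lborel b \<rho>\<bar> \<le> 1 * (sqrt (nsq lborel b) * R * h\<^sup>2)" by (intro mult_mono h B) auto
    then show ?thesis by (simp add: abs_mult)
  qed
  have D: "nsq lborel \<rho> \<le> R * R * h\<^sup>2"
  proof -
    have "nsq lborel \<rho> = sqrt (nsq lborel \<rho>) * sqrt (nsq lborel \<rho>)" by simp
    also have "\<dots> \<le> R * (R * h\<^sup>2)" by (intro mult_mono rr order_trans[OF rr Rh]) (use R0 in auto)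
    finally show ?thesis by simp
  qed
  have "\<bar>nsq lborel (tint (qramp (q + h)) F) - nsq lborel a - h * (2 * ip lborel a b)\<bar>
      \<le> 2 * (sqrt (nsq lborel a) * R * h\<^sup>2) + h\<^sup>2 * nsq lborel b + 2 * (sqrt (nsq lborel b) * R * h\<^sup>2) + R * R * h\<^sup>2"
    unfolding eq using A C D ip_nonneg[of lborel \<rho>] mult_nonneg_nonneg[OF zero_le_power2[of h] ip_nonneg[of lborel b]] by linarith
  also have "\<dots> = (2 * sqrt (nsq lborel a) * R + nsq lborel b + 2 * sqrt (nsq lborel b) * R + R * R) * h\<^sup>2"
    by (simp add: algebra_simps)
  finally show "\<bar>nsq lborel (tint (qramp (q + h)) F) - nsq lborel (tint (qramp q) F)
     - h * (2 * ip lborel (tint (qramp q) F) (tint (ramp q) F))\<bar>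
      \<le> (2 * sqrt (nsq lborel a) * R + nsq lborel b + 2 * sqrt (nsq lborel b) * R + R * R) * h\<^sup>2"
    by (simp add: a_def b_def)
qed

text \<open>\<open>ramp\<close> is Lipschitz in \<open>q\<close> with constant 1. Continuity is
  wanted twice: to differentiate the integral of this function in the energy estimate, and to
  conclude that it vanishes everywhere once its integral is zero.\<close>

lemma isCont_tint_ramp_sq:
  fixes F :: "real \<times> 'a::euclidean_space \<Rightarrow> 'e::euclidean_space"
  assumes F: "slab_L2 T F" and T: "0 \<le> T"
  shows "isCont (\<lambda>q. nsq lborel (tint (ramp q) F)) q"
proof -
  define a where "a = tint (ramp q) F"
  define R where "R = sqrt (T * nsq lborel F)"
  have R0: "0 \<le> R" using T by (simp add: R_def)
  have b: "\<bar>nsq lborel (tint (ramp (q + h)) F) - ip lborel a a\<bar>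
      \<le> 2 * sqrt (nsq lborel a) * R * \<bar>h\<bar> + R\<^sup>2 * h\<^sup>2" for h
  proof -
    define r where "r t = ramp (q + h) t - ramp q t" for t
    have rm [measurable]: "r \<in> borel_measurable borel" unfolding r_def by measurable
    have rb: "\<bar>r t\<bar> \<le> \<bar>h\<bar>" for t unfolding r_def by (rule ramp_Lipschitz)
    note b = tint_L2[OF F T rm rb, simplified]
    note L = tint_ramp_L2(1)[OF F T, of q, folded a_def] b(1) tint_ramp_L2(1)[OF F T, of "q+h"]
    have ae: "AE x in lborel. tint (ramp (q + h)) F x = a x + tint r F x"
      using tint_combine[OF F T, of "ramp q" "\<bar>q\<bar>" r "\<bar>h\<bar>" 1] rb ramp_bound
      by (simp add: a_def r_def)
    have rs: "sqrt (nsq lborel (tint r F)) \<le> R * \<bar>h\<bar>"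
      using real_sqrt_le_mono[OF b(2)] by (simp add: R_def real_sqrt_mult mult_ac)
    have rr: "nsq lborel (tint r F) \<le> R\<^sup>2 * h\<^sup>2"
      using b(2) T by (simp add: R_def mult_ac)
    have "nsq lborel (tint (ramp (q + h)) F) = nsq lborel (\<lambda>x. a x + tint r F x)"
      by (rule ip_cong_AE[OF ae ae]) (use L in auto)
    also have "\<dots> = nsq lborel a + 2 * ip lborel a (tint r F) + nsq lborel (tint r F)"
      using L by (simp add: ip_add_self)
    finally have eq: "nsq lborel (tint (ramp (q + h)) F)
      = nsq lborel a + 2 * ip lborel a (tint r F) + nsq lborel (tint r F)" .
    show ?thesis
    proof -
      have "\<bar>ip lborel a (tint r F)\<bar> \<le> sqrt (nsq lborel a) * (R * \<bar>h\<bar>)"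
        using order_trans[OF ip_Cauchy_Schwarz[OF L(1,2)] mult_left_mono[OF rs]] by simp
      moreover have "2 * sqrt (nsq lborel a) * R * \<bar>h\<bar> = 2 * (sqrt (nsq lborel a) * (R * \<bar>h\<bar>))" by simp
      ultimately show ?thesis
        using eq rr ip_nonneg[of lborel "tint r F"] by linarith
    qed
  qed
  have "((\<lambda>h. nsq lborel (tint (ramp (q + h)) F) - nsq lborel a) \<longlongrightarrow> 0) (at 0)"
  proof (rule Lim_null_comparison[OF eventuallyI])
    show "norm (nsq lborel (tint (ramp (q + h)) F) - nsq lborel a)
        \<le> 2 * sqrt (nsq lborel a) * R * \<bar>h\<bar> + R\<^sup>2 * h\<^sup>2" for h using b by simp
    have "((\<lambda>h. 2 * sqrt (nsq lborel a) * R * \<bar>h\<bar> + R\<^sup>2 * h\<^sup>2) \<longlongrightarrow>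
       2 * sqrt (nsq lborel a) * R * \<bar>0\<bar> + R\<^sup>2 * 0\<^sup>2) (at (0::real))" by (intro tendsto_intros)
    then show "((\<lambda>h. 2 * sqrt (nsq lborel a) * R * \<bar>h\<bar> + R\<^sup>2 * h\<^sup>2) \<longlongrightarrow> 0) (at (0::real))" by simp
  qed
  then show ?thesis by (simp add: isCont_iff LIM_zero_iff a_def)
qed

text \<open>The scalar version, for controls. As \<open>ramp q\<close> and \<open>qramp q\<close>
  grow without bound for \<open>t\<close> towards minus infinity, the support condition is what
  keeps the integrals finite.\<close>

lemma DERIV_qramp_integral:
  fixes g :: "real \<Rightarrow> real"
  assumes g: "integrable lborel g" "\<And>t. t \<le> 0 \<Longrightarrow> g t = 0"
  shows "((\<lambda>q. \<integral>t. qramp q t * g t \<partial>lborel) has_real_derivative (\<integral>t. ramp q t * g t \<partial>lborel)) (at q)"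
proof (rule DERIV_quadratic_remainder)
  fix h :: real
  have [measurable]: "g \<in> borel_measurable lborel" using g by auto
  have i: "integrable lborel (\<lambda>t. c t * g t)"
    if [measurable]: "c \<in> borel_measurable borel" and "\<And>t. 0 < t \<Longrightarrow> \<bar>c t\<bar> \<le> K" for c :: "real \<Rightarrow> real" and K
  proof (rule Bochner_Integration.integrable_bound[of _ "\<lambda>t. K * g t"])
    have "\<bar>c t * g t\<bar> \<le> \<bar>K * g t\<bar>" for t
      using that(2)[of t] g(2)[of t] by (cases "0 < t") (auto simp: abs_mult intro!: mult_right_mono)
    then show "AE t in lborel. norm (c t * g t) \<le> norm (K * g t)" by simp
  qed (use g in auto)
  define r where "r t = qramp (q + h) t - qramp q t - h * ramp q t" for t
  have rm [measurable]: "r \<in> borel_measurable borel" unfolding r_def by measurable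
  have rb: "\<bar>r t\<bar> \<le> h\<^sup>2" for t unfolding r_def using qramp_remainder[of q h t] zero_le_power2[of h] by linarith
  have "(\<integral>t. qramp (q + h) t * g t \<partial>lborel) - (\<integral>t. qramp q t * g t \<partial>lborel) - h * (\<integral>t. ramp q t * g t \<partial>lborel)
     = (\<integral>t. qramp (q + h) t * g t - qramp q t * g t - h * (ramp q t * g t) \<partial>lborel)"
    using i[of "qramp q" "q\<^sup>2/2"] i[of "qramp (q+h)" "(q+h)\<^sup>2/2"] i[of "ramp q" "\<bar>q\<bar>"] ramp_bound qramp_bound by simp
  also have "\<dots> = (\<integral>t. r t * g t \<partial>lborel)"
    by (intro Bochner_Integration.integral_cong) (auto simp: r_def algebra_simps)
  also have "\<bar>\<dots>\<bar> \<le> (\<integral>t. norm (r t * g t) \<partial>lborel)" using integral_norm_bound[of lborel "\<lambda>t. r t * g t"] by simp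
  also have "\<dots> \<le> (\<integral>t. h\<^sup>2 * \<bar>g t\<bar> \<partial>lborel)"
  proof (rule integral_mono)
    show "integrable lborel (\<lambda>t. norm (r t * g t))" using i[of r "h\<^sup>2"] rb by (intro integrable_norm) auto
    show "integrable lborel (\<lambda>t. h\<^sup>2 * \<bar>g t\<bar>)" using g by auto
    show "norm (r t * g t) \<le> h\<^sup>2 * \<bar>g t\<bar>" for t
      using mult_right_mono[OF rb, of "\<bar>g t\<bar>" t] by (simp add: abs_mult)
  qed
  finally show "\<bar>(\<integral>t. qramp (q + h) t * g t \<partial>lborel) - (\<integral>t. qramp q t * g t \<partial>lborel) - h * (\<integral>t. ramp q t * g t \<partial>lborel)\<bar>
      \<le> (\<integral>t. \<bar>g t\<bar> \<partial>lborel) * h\<^sup>2" by (simp add: mult_ac)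
qed

section \<open>The energy estimate\<close>

lemma tint_zero_kernel:
  assumes F: "slab_L2 T F" and c: "\<And>t. 0 < t \<Longrightarrow> c t = 0"
  shows "tint c F = (\<lambda>x. 0)"
proof
  fix x
  have "c t *\<^sub>R F (t, x) = 0" for t
    using F c[of t] by (cases "0 < t") (auto simp: slab_L2_def)
  then show "tint c F x = 0" unfolding tint_def by (simp only: integral_zero)
qed

lemma tint_Pair_ip:
  fixes F :: "real \<times> 'a::euclidean_space \<Rightarrow> 'b::euclidean_space \<times> 'c::euclidean_space"
  assumes F: "slab_L2 T F" and T: "0 \<le> T"
    and c: "c \<in> borel_measurable borel" "\<And>t. t \<in> {0<..<T} \<Longrightarrow> \<bar>c t\<bar> \<le> K" and K: "0 \<le> K"
  shows "nsq lborel (tint c F)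
    = nsq lborel (tint c (\<lambda>p. fst (F p)))
    + nsq lborel (tint c (\<lambda>p. snd (F p)))"
proof -
  note F1 = slab_L2_fst[OF F] and F2 = slab_L2_snd[OF F]
  have L: "L2 lborel (tint c F)" "L2 lborel (tint c (\<lambda>p. fst (F p)))" "L2 lborel (tint c (\<lambda>p. snd (F p)))"
    using tint_L2(1)[OF _ T c K] F F1 F2 by auto
  have "nsq lborel (tint c F) = (\<integral>x. tint c (\<lambda>p. fst (F p)) x \<bullet> tint c (\<lambda>p. fst (F p)) x
     + tint c (\<lambda>p. snd (F p)) x \<bullet> tint c (\<lambda>p. snd (F p)) x \<partial>lborel)"
    unfolding ip_def
  proof (rule integral_cong_AE)
    show "AE x in lborel. tint c F x \<bullet> tint c F x = tint c (\<lambda>p. fst (F p)) x \<bullet> tint c (\<lambda>p. fst (F p)) x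
     + tint c (\<lambda>p. snd (F p)) x \<bullet> tint c (\<lambda>p. snd (F p)) x"
      using slab_L2_slice_space[OF F]
    proof eventually_elim
      case (elim x)
      note i = slab_slice_bound(1)[OF F elim T c K]
      have "fst (tint c F x) = tint c (\<lambda>p. fst (F p)) x" "snd (tint c F x) = tint c (\<lambda>p. snd (F p)) x"
        using integral_bounded_linear[OF bounded_linear_fst i] integral_bounded_linear[OF bounded_linear_snd i]
        by (simp_all add: tint_def)
      then show ?case by (simp add: inner_prod_def)
    qed
  qed (use L in \<open>auto simp: L2_def\<close>)
  also have "\<dots> = nsq lborel (tint c (\<lambda>p. fst (F p)))
    + nsq lborel (tint c (\<lambda>p. snd (F p)))"
    unfolding ip_def using L by (intro Bochner_Integration.integral_add L2_inner_integrable)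
  finally show ?thesis .
qed

text \<open>With \<open>F = (y, \<nabla>y)\<close>, the hypothesis \<open>weak\<close> is the weak form for the test function \<open>qramp q\<close> in time and
  \<open>y s\<close> in space, the functionals \<open>\<psi> j\<close> being represented by \<open>r j\<close>. Integrating it against \<open>ramp q s\<close> gives
  \<open>|tint (ramp q) y|\<^sup>2 + (tint (qramp q) \<nabla>y, tint (ramp q) \<nabla>y) = \<Sum>j. \<beta> j q * (\<theta> j)' q\<close>, and the second term is half
  the derivative of \<open>|tint (qramp q) \<nabla>y|\<^sup>2\<close>. No regularity of \<open>y\<close> in time is used.\<close>

lemma energy_bound:
  fixes F :: "real \<times> 'a::euclidean_space \<Rightarrow> 'b::euclidean_space \<times> 'c::euclidean_space"
    and r :: "'n::finite \<Rightarrow> 'a \<Rightarrow> 'b \<times> 'c"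
  assumes F: "slab_L2 T F" and T: "0 \<le> T" and r: "\<And>j. L2 lborel (r j)"
    and dbeta: "\<And>j q. (\<beta> j has_real_derivative \<beta>' j q) (at q)"
    and beta0: "0 \<le> b" "\<And>j q. q \<in> {0..T} \<Longrightarrow> \<bar>\<beta> j q\<bar> \<le> b" "\<And>j q. q \<in> {0..T} \<Longrightarrow> \<bar>\<beta>' j q\<bar> \<le> b"
    and weak: "AE s in lborel. \<forall>q\<in>{0..T}.
        ip lborel (\<lambda>x. fst (F (s, x))) (tint (ramp q) (\<lambda>p. fst (F p)))
      + ip lborel (\<lambda>x. snd (F (s, x))) (tint (qramp q) (\<lambda>p. snd (F p)))
      = (\<Sum>j\<in>UNIV. \<beta> j q * ip lborel (\<lambda>x. F (s, x)) (r j))"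
  shows "integral {0..T} (\<lambda>q. nsq lborel (tint (ramp q) (\<lambda>p. fst (F p))))
     \<le> ((1 + T) * (\<Sum>j\<in>UNIV. sqrt (nsq lborel (r j))))\<^sup>2 * (2 + exp T) * b\<^sup>2"
proof -
  define Y where "Y = (\<lambda>p. fst (F p))"
  define G where "G = (\<lambda>p. snd (F p))"
  have Y: "slab_L2 T Y" and G: "slab_L2 T G"
    using slab_L2_fst[OF F] slab_L2_snd[OF F] by (auto simp: Y_def G_def)
  define \<alpha> where "\<alpha> q = nsq lborel (tint (ramp q) Y)" for q
  define N where "N q = nsq lborel (tint (qramp q) Y)" for q
  define B where "B q = nsq lborel (tint (qramp q) G)" for q
  define \<theta> where "\<theta> j q = ip lborel (tint (qramp q) F) (r j)" for j q
  define \<eta> where "\<eta> j q = ip lborel (tint (ramp q) F) (r j)" for j q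
  have ramp_b: "\<bar>ramp q t\<bar> \<le> \<bar>q\<bar>" if "t \<in> {0<..<T}" for q t using that by (intro ramp_bound) auto
  have qramp_b: "\<bar>qramp q t\<bar> \<le> q\<^sup>2 / 2" if "t \<in> {0<..<T}" for q t using that by (intro qramp_bound) auto

  \<comment> \<open>The weak form at time \<open>s\<close> is multiplied by \<open>ramp q s\<close>
    and integrated over \<open>s\<close>; \<open>tint_ip\<close> then replaces the slice at
    \<open>s\<close> by \<open>tint (ramp q)\<close> in each of the three inner products.\<close>
  have id1: "\<alpha> q + ip lborel (tint (qramp q) G) (tint (ramp q) G) = (\<Sum>j\<in>UNIV. \<beta> j q * \<eta> j q)"
    if q: "q \<in> {0..T}" for q
  proof -
    note t1 = tint_ip[OF Y T ramp_measurable ramp_b abs_ge_zero tint_ramp_L2(1)[OF Y T], of q q]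
    note t2 = tint_ip[OF G T ramp_measurable ramp_b abs_ge_zero tint_qramp_L2[OF G T], of q q]
    note t3 = tint_ip[OF F T ramp_measurable ramp_b abs_ge_zero r, of q]
    have "\<alpha> q + ip lborel (tint (qramp q) G) (tint (ramp q) G)
       = (\<integral>s. ramp q s * ip lborel (\<lambda>x. Y (s, x)) (tint (ramp q) Y)
           + ramp q s * ip lborel (\<lambda>x. G (s, x)) (tint (qramp q) G) \<partial>lborel)"
      using t1 t2 by (simp add: \<alpha>_def ip_commute[of lborel "tint (qramp q) G"])
    also have "\<dots> = (\<integral>s. (\<Sum>j\<in>UNIV. \<beta> j q * (ramp q s * ip lborel (\<lambda>x. F (s, x)) (r j))) \<partial>lborel)"
    proof (rule integral_cong_AE)
      show "AE s in lborel. ramp q s * ip lborel (\<lambda>x. Y (s, x)) (tint (ramp q) Y)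
           + ramp q s * ip lborel (\<lambda>x. G (s, x)) (tint (qramp q) G)
           = (\<Sum>j\<in>UNIV. \<beta> j q * (ramp q s * ip lborel (\<lambda>x. F (s, x)) (r j)))"
        using weak
      proof eventually_elim
        case (elim s)
        then have "ramp q s * (ip lborel (\<lambda>x. Y (s, x)) (tint (ramp q) Y) + ip lborel (\<lambda>x. G (s, x)) (tint (qramp q) G))
          = ramp q s * (\<Sum>j\<in>UNIV. \<beta> j q * ip lborel (\<lambda>x. F (s, x)) (r j))"
          using q by (simp add: Y_def G_def)
        then show ?case by (simp add: distrib_left sum_distrib_left mult_ac)
      qed
    qed (use t1(1) t2(1) t3(1) in \<open>auto intro!: borel_measurable_add borel_measurable_sum borel_measurable_times[OF borel_measurable_const]\<close>)
    also have "\<dots> = (\<Sum>j\<in>UNIV. \<beta> j q * \<eta> j q)"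
      using t3 by (simp add: \<eta>_def)
    finally show ?thesis .
  qed

  have cont_a: "continuous_on A \<alpha>" for A
    using isCont_tint_ramp_sq[OF Y T] by (auto simp: \<alpha>_def[abs_def] intro: continuous_at_imp_continuous_on)
  \<comment> \<open>On \<open>{0..T}\<close> this is the integral of \<open>\<alpha>\<close> from
    \<open>0\<close>. Starting at \<open>-1\<close> gives a two-sided derivative at \<open>0\<close>
    as well, as the monotonicity arguments below require.\<close>
  define J where "J t = integral {-1..t} \<alpha> - integral {-1..0} \<alpha>" for t
  have dJ: "(J has_real_derivative \<alpha> t) (at t)" if "t \<in> {0..T}" for t
  proof -
    have "((\<lambda>t. integral {-1..t} \<alpha>) has_real_derivative \<alpha> t) (at t within {-1..T+1})"
      using that by (intro integral_has_real_derivative cont_a) auto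
    then have "((\<lambda>t. integral {-1..t} \<alpha>) has_real_derivative \<alpha> t) (at t)"
      using that by (simp add: at_within_interior[of t "{-1..T+1}"])
    then show ?thesis unfolding J_def[abs_def] by (auto intro!: derivative_eq_intros)
  qed
  have J0: "J 0 = 0" by (simp add: J_def)
  have JT: "J T = integral {0..T} \<alpha>"
    using Henstock_Kurzweil_Integration.integral_combine[of "-1" 0 T \<alpha>] T integrable_continuous_real[OF cont_a] by (simp add: J_def)
  have a0: "0 \<le> \<alpha> t" for t by (simp add: \<alpha>_def)
  have dN: "(N has_real_derivative 2 * ip lborel (tint (qramp t) Y) (tint (ramp t) Y)) (at t)" for t
    unfolding N_def[abs_def] by (rule DERIV_tint_qramp_sq[OF Y T])
  have dN_le: "2 * ip lborel (tint (qramp t) Y) (tint (ramp t) Y) \<le> N t + \<alpha> t" for t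
  proof -
    have "0 \<le> nsq lborel (\<lambda>x. tint (qramp t) Y x - tint (ramp t) Y x)" by simp
    then show ?thesis using tint_ramp_L2(1)[OF Y T] tint_qramp_L2[OF Y T] by (simp add: ip_diff_self N_def \<alpha>_def)
  qed
  have qramp0: "tint (qramp 0) Z = (\<lambda>x. 0)" if "slab_L2 T Z" for Z :: "real \<times> 'a \<Rightarrow> 'z::euclidean_space"
    by (rule tint_zero_kernel[OF that]) (simp add: qramp_def)
  \<comment> \<open>Gronwall's argument: the derivative of \<open>N\<close> is at most
    \<open>N + \<alpha>\<close> by \<open>dN_le\<close>, and \<open>N 0 = 0\<close>, so
    \<open>J t - exp (- t) * N t\<close> is nondecreasing from zero. This controls the state part of
    \<open>tint (qramp t) F\<close>, which \<open>A\<close> does not contain.\<close>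
  have N_le: "N t \<le> exp T * J t" if t: "t \<in> {0..T}" for t
  proof -
    have "J 0 - exp (- 0) * N 0 \<le> J t - exp (- t) * N t"
    proof (rule DERIV_nonneg_imp_nondecreasing[where f = "\<lambda>t. J t - exp (- t) * N t"])
      fix x assume x: "0 \<le> x" "x \<le> t"
      have "((\<lambda>t. J t - exp (- t) * N t) has_real_derivative
        \<alpha> x - (exp (- x) * (2 * ip lborel (tint (qramp x) Y) (tint (ramp x) Y)) - exp (- x) * N x)) (at x)"
        using x t by (auto intro!: derivative_eq_intros dJ dN)
      moreover have "exp (- x) * (2 * ip lborel (tint (qramp x) Y) (tint (ramp x) Y)) \<le> exp (- x) * (N x + \<alpha> x)"
        using dN_le by (intro mult_left_mono) auto
      moreover have "exp (- x) * \<alpha> x \<le> 1 * \<alpha> x" using x a0 by (intro mult_right_mono) auto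
      ultimately show "\<exists>y. ((\<lambda>t. J t - exp (- t) * N t) has_real_derivative y) (at x) \<and> 0 \<le> y"
        by (intro exI conjI) (assumption, simp add: algebra_simps)
    qed (use t in auto)
    then have "exp (- t) * N t \<le> J t" using J0 qramp0[OF Y] by (simp add: N_def)
    then have Nt: "N t \<le> exp t * J t" by (simp add: exp_minus field_simps)
    have "0 \<le> exp (- t) * N t" by (simp add: N_def)
    then have "0 \<le> J t" using \<open>exp (- t) * N t \<le> J t\<close> by linarith
    then have "exp t * J t \<le> exp T * J t" using t by (intro mult_right_mono) auto
    then show ?thesis using Nt by linarith
  qed
  have J_pos: "0 \<le> J t" if "t \<in> {0..T}" for t
  proof -
    have "0 \<le> N t" by (simp add: N_def)
    then have "0 \<le> exp T * J t" using N_le[OF that] by linarith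
    then show ?thesis by (simp add: zero_le_mult_iff)
  qed
  \<comment> \<open>The energy: its derivative is exactly the left side of \<open>id1\<close>. The
    argument is run at the maximum point \<open>ts\<close> of \<open>A\<close>, so that
    \<open>m\<close> bounds \<open>A\<close> on the whole interval.\<close>
  define A where "A t = B t / 2 + J t" for t
  have dA: "(A has_real_derivative ip lborel (tint (qramp t) G) (tint (ramp t) G) + \<alpha> t) (at t)" if "t \<in> {0..T}" for t
    unfolding A_def[abs_def] B_def using that
    by (auto intro!: derivative_eq_intros dJ DERIV_tint_qramp_sq[OF G T])
  have "continuous_on {0..T} A"
    by (intro continuous_at_imp_continuous_on ballI DERIV_isCont[OF dA])
  then obtain ts where ts: "ts \<in> {0..T}" "\<And>t. t \<in> {0..T} \<Longrightarrow> A t \<le> A ts"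
    using continuous_attains_sup[of "{0..T}" A] T by (auto simp: Ball_def)
  define m where "m = A ts"
  have BA: "0 \<le> B t" for t by (simp add: B_def)
  have m0: "0 \<le> m" unfolding m_def A_def using J_pos[OF ts(1)] BA by simp
  define \<kappa> where "\<kappa> = (\<Sum>j\<in>UNIV. sqrt (nsq lborel (r j)))"
  have k0: "0 \<le> \<kappa>" by (auto simp: \<kappa>_def intro!: sum_nonneg)
  \<comment> \<open>Bound for the sum of all \<open>\<bar>\<theta> j t\<bar>\<close>. The squared
    norm of \<open>tint (qramp t) F\<close> is \<open>N t + B t\<close>; here
    \<open>N t \<le> exp T * J t\<close>, while \<open>J t\<close> and \<open>B t / 2\<close> are
    both at most \<open>m\<close>. This is the origin of \<open>2 + exp T\<close>.\<close>
  define L where "L = \<kappa> * sqrt ((2 + exp T) * m)"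
  have theta: "(\<Sum>j\<in>UNIV. \<bar>\<theta> j t\<bar>) \<le> L" if t: "t \<in> {0..T}" for t
  proof -
    have "nsq lborel (tint (qramp t) F) = N t + B t"
      unfolding N_def B_def Y_def G_def by (rule tint_Pair_ip[OF F T qramp_measurable qramp_b]) auto
    also have "\<dots> \<le> exp T * J t + B t" using N_le[OF t] by simp
    also have "\<dots> \<le> exp T * A t + 2 * A t"
      unfolding A_def using BA[of t] J_pos[OF t] by (intro add_mono mult_left_mono) auto
    also have "\<dots> \<le> exp T * m + 2 * m"
      unfolding m_def using ts(2)[OF t] by (intro add_mono mult_left_mono) auto
    finally have le: "nsq lborel (tint (qramp t) F) \<le> (2 + exp T) * m" by (simp add: algebra_simps)
    have "\<bar>\<theta> j t\<bar> \<le> sqrt ((2 + exp T) * m) * sqrt (nsq lborel (r j))" for j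
      unfolding \<theta>_def
      by (rule order_trans[OF ip_Cauchy_Schwarz[OF tint_qramp_L2[OF F T] r]])
         (intro mult_right_mono real_sqrt_le_mono le; simp)
    then have "(\<Sum>j\<in>UNIV. \<bar>\<theta> j t\<bar>) \<le> (\<Sum>j\<in>UNIV. sqrt ((2 + exp T) * m) * sqrt (nsq lborel (r j)))"
      by (rule sum_mono)
    then show ?thesis by (simp add: L_def \<kappa>_def sum_distrib_left mult.commute)
  qed
  have sum_le: "\<bar>\<Sum>j\<in>UNIV. c j * \<theta> j t\<bar> \<le> b * L" if "t \<in> {0..T}" "\<And>j. \<bar>c j\<bar> \<le> b" for c t
  proof -
    have "\<bar>\<Sum>j\<in>UNIV. c j * \<theta> j t\<bar> \<le> (\<Sum>j\<in>UNIV. b * \<bar>\<theta> j t\<bar>)"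
      by (rule order_trans[OF sum_abs]) (use that(2) in \<open>auto simp: abs_mult intro!: sum_mono mult_right_mono\<close>)
    also have "\<dots> \<le> b * L" unfolding sum_distrib_left[symmetric] using theta[OF that(1)] beta0(1) by (rule mult_left_mono)
    finally show ?thesis .
  qed
  \<comment> \<open>Integration by parts in \<open>q\<close>. The derivative of \<open>A\<close> is
    the sum of \<open>\<beta> j t * \<eta> j t\<close>, but the energy controls only
    \<open>\<theta> j\<close>, not its derivative \<open>\<eta> j\<close>. Subtracting the products
    \<open>\<beta> j t * \<theta> j t\<close> moves the derivative onto \<open>\<beta> j\<close>,
    for which a bound is assumed.\<close>
  define \<Phi> where "\<Phi> t = A t - (\<Sum>j\<in>UNIV. \<beta> j t * \<theta> j t)" for t
  have dPhi: "(\<Phi> has_real_derivative - (\<Sum>j\<in>UNIV. \<beta>' j t * \<theta> j t)) (at t)" if t: "t \<in> {0..T}" for t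
  proof -
    have dth: "(\<theta> j has_real_derivative \<eta> j t) (at t)" for j
      unfolding \<theta>_def[abs_def] \<eta>_def by (rule DERIV_tint_qramp_ip[OF F T r])
    have "(\<Phi> has_real_derivative (ip lborel (tint (qramp t) G) (tint (ramp t) G) + \<alpha> t)
       - (\<Sum>j\<in>UNIV. \<beta>' j t * \<theta> j t + \<eta> j t * \<beta> j t)) (at t)"
      unfolding \<Phi>_def[abs_def] by (intro DERIV_diff dA[OF t] DERIV_sum DERIV_mult dbeta dth)
    then show ?thesis using id1[OF t] by (simp add: sum.distrib mult.commute add.commute)
  qed
  have "ts * (b * L) - \<Phi> ts \<ge> 0 * (b * L) - \<Phi> 0"
  proof (rule DERIV_nonneg_imp_nondecreasing[where f = "\<lambda>t. t * (b * L) - \<Phi> t"])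
    fix x assume x: "0 \<le> x" "x \<le> ts"
    then have x': "x \<in> {0..T}" using ts by auto
    have "((\<lambda>t. t * (b * L) - \<Phi> t) has_real_derivative (b * L - - (\<Sum>j\<in>UNIV. \<beta>' j x * \<theta> j x))) (at x)"
      by (auto intro!: derivative_eq_intros dPhi[OF x'])
    moreover have "0 \<le> b * L - - (\<Sum>j\<in>UNIV. \<beta>' j x * \<theta> j x)"
      using sum_le[OF x', of "\<lambda>j. \<beta>' j x"] beta0(3)[OF x'] by (simp add: abs_le_iff)
    ultimately show "\<exists>y. ((\<lambda>t. t * (b * L) - \<Phi> t) has_real_derivative y) (at x) \<and> 0 \<le> y" by blast
  qed (use ts in auto)
  moreover have "\<Phi> 0 = 0"
    using J0 qramp0[OF G] qramp0[OF F] by (simp add: \<Phi>_def A_def B_def \<theta>_def)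
  ultimately have "\<Phi> ts \<le> ts * (b * L)" by simp
  then have "m \<le> ts * (b * L) + (\<Sum>j\<in>UNIV. \<beta> j ts * \<theta> j ts)" by (simp add: \<Phi>_def m_def)
  moreover have "(\<Sum>j\<in>UNIV. \<beta> j ts * \<theta> j ts) \<le> b * L"
    using sum_le[OF ts(1), of "\<lambda>j. \<beta> j ts"] beta0(2)[OF ts(1)] by (simp add: abs_le_iff)
  moreover have "ts * (b * L) \<le> T * (b * L)"
    using ts beta0(1) k0 m0 by (intro mult_right_mono) (auto simp: L_def intro!: mult_nonneg_nonneg add_nonneg_nonneg)
  ultimately have mL: "m \<le> (1 + T) * (b * L)" by (simp add: algebra_simps)
  \<comment> \<open>\<open>mL\<close> bounds \<open>m\<close> by a multiple of
    \<open>b * sqrt m\<close>; cancelling one factor \<open>sqrt m\<close> and squaring gives a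
    bound quadratic in \<open>b\<close>.\<close>
  have "m \<le> ((1 + T) * \<kappa>)\<^sup>2 * (2 + exp T) * b\<^sup>2"
  proof (cases "m = 0")
    case True then show ?thesis using T by (auto intro!: mult_nonneg_nonneg add_nonneg_nonneg)
  next
    case False
    then have mp: "0 < m" using m0 by simp
    define z where "z = (1 + T) * \<kappa> * sqrt (2 + exp T) * b"
    have z0: "0 \<le> z" using T k0 beta0(1) by (auto simp: z_def intro!: mult_nonneg_nonneg add_nonneg_nonneg)
    have "sqrt m * sqrt m \<le> z * sqrt m"
      using mL mp by (simp add: L_def z_def real_sqrt_mult mult_ac)
    then have "sqrt m \<le> z" using mp by (intro mult_right_le_imp_le[of "sqrt m" "sqrt m" z]) auto
    then have "(sqrt m)\<^sup>2 \<le> z\<^sup>2" using mp by (intro power_mono) auto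
    moreover have "(sqrt (2 + exp T))\<^sup>2 = 2 + exp T" by (rule real_sqrt_pow2) (simp add: add_nonneg_nonneg)
    ultimately show ?thesis using mp by (simp add: z_def power_mult_distrib)
  qed
  moreover have "J T \<le> m"
  proof -
    have "J T \<le> A T" using BA[of T] by (simp add: A_def)
    also have "\<dots> \<le> m" unfolding m_def using ts(2)[of T] T by simp
    finally show ?thesis .
  qed
  ultimately show ?thesis by (simp add: JT \<kappa>_def \<alpha>_def[abs_def] Y_def)
qed

section \<open>Separation by the ramp kernels\<close>

text \<open>Half-lines form an intersection-stable generator of the Borel sets, so the integral of
  \<open>g\<close> vanishes over every Borel set, and a density with this property is zero almost
  everywhere.\<close>

lemma AE_zero_if_lessThan_integrals_zero:
  fixes g :: "real \<Rightarrow> real"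
  assumes g: "integrable lborel g" and z: "\<And>q. (\<integral>t\<in>{..<q}. g t \<partial>lborel) = 0"
  shows "AE t in lborel. g t = 0"
proof (rule sigma_finite_measure.density_zero[OF sigma_finite_lborel g])
  fix A :: "real set" assume "A \<in> sets lborel"
  then have A: "A \<in> sigma_sets UNIV (range (\<lambda>q::real. {..<q}))"
    by (simp add: borel_Iio)
  have sub: "sigma_sets UNIV (range (\<lambda>q::real. {..<q})) \<subseteq> sets lborel"
    by (simp add: borel_Iio)
  have si: "set_integrable lborel B g" if "B \<in> sets lborel" for B
    using integrable_mult_indicator[OF that g] by (simp add: set_integrable_def)
  \<comment> \<open>The complement step of the induction needs the integral over the whole line,
    which is the limit of those over half-lines.\<close>
  have whole: "(\<integral>t\<in>UNIV. g t \<partial>lborel) = 0"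
  proof -
    have "(\<lambda>n. \<integral>t\<in>{..<real n}. g t \<partial>lborel) \<longlonglongrightarrow> (\<integral>t\<in>UNIV. g t \<partial>lborel)"
      unfolding set_lebesgue_integral_def
    proof (rule integral_dominated_convergence[where w = "\<lambda>t. \<bar>g t\<bar>"])
      show "AE t in lborel. (\<lambda>n. indicator {..<real n} t *\<^sub>R g t) \<longlonglongrightarrow> indicator UNIV t *\<^sub>R g t"
      proof (intro AE_I2 tendsto_eventually)
        fix t :: real
        obtain n0 :: nat where "t < real n0" using reals_Archimedean2 by blast
        then show "\<forall>\<^sub>F n in sequentially. indicator {..<real n} t *\<^sub>R g t = indicator UNIV t *\<^sub>R g t"
          by (intro eventually_sequentiallyI[of n0]) auto
      qed
    qed (use g in \<open>auto simp: indicator_def\<close>)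
    then show ?thesis using z by (simp add: LIMSEQ_const_iff)
  qed
  have Int_st: "Int_stable (range (\<lambda>q::real. {..<q}))"   proof -
    have "{..<a} \<inter> {..<b} = {..<min a b}" for a b :: real by auto
    then show ?thesis by (auto simp: Int_stable_def)
  qed
  have Pow: "range (\<lambda>q::real. {..<q}) \<subseteq> Pow UNIV" by simp
  show "set_lebesgue_integral lborel A g = 0"
    using Int_st Pow A
  proof (induction rule: sigma_sets_induct_disjoint)
    case (basic A) then show ?case using z by auto
  next
    case empty show ?case by (simp add: set_lebesgue_integral_def)
  next
    case (compl A)
    have "A \<in> sets lborel" using compl sub by blast
    then have "(\<integral>t\<in>UNIV. g t \<partial>lborel) = (\<integral>t\<in>A. g t \<partial>lborel) + (\<integral>t\<in>UNIV - A. g t \<partial>lborel)"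
      by (subst set_integral_Un[symmetric]) (auto intro!: si sets.Diff)
    then show ?case using whole compl by simp
  next
    case (union A)
    have "A i \<in> sets lborel" for i using union(2) sub by blast
    then show ?case using union
      by (subst lebesgue_integral_countable_add) (auto simp: disjoint_family_on_def intro!: si)
  qed
qed

text \<open>Differentiating \<open>\<integral>t. ramp q t * g t\<close> once in \<open>q\<close>
  gives the integral of \<open>g\<close> over \<open>{..<q}\<close>. Only rational \<open>q\<close>
  are required, because the application has one exceptional null set for each \<open>q\<close>; the
  integral is Lipschitz in \<open>q\<close>, so the rationals determine it.\<close>

lemma ramp_separates:
  fixes g :: "real \<Rightarrow> real"
  assumes g: "integrable lborel g" and supp: "\<And>t. t \<notin> {0<..<T} \<Longrightarrow> g t = 0"
    and z: "\<And>q. q \<in> \<rat> \<Longrightarrow> 0 \<le> q \<Longrightarrow> q \<le> T \<Longrightarrow> (\<integral>t. ramp q t * g t \<partial>lborel) = 0"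
  shows "AE t in lborel. g t = 0"
proof (rule AE_zero_if_lessThan_integrals_zero[OF g])
  have [measurable]: "g \<in> borel_measurable borel" using g by auto
  define f where "f q = (\<integral>t. ramp q t * g t \<partial>lborel)" for q
  define C where "C = (\<integral>t. \<bar>g t\<bar> \<partial>lborel)"
  have C0: "0 \<le> C" by (simp add: C_def)
  have i: "integrable lborel (\<lambda>t. ramp q t * g t)" for q
  proof (rule Bochner_Integration.integrable_bound[of _ "\<lambda>t. \<bar>q\<bar> * g t"])
    have "norm (ramp q t * g t) \<le> norm (\<bar>q\<bar> * g t)" for t
      using ramp_bound[of t q] supp[of t] by (cases "0 < t") (auto simp: abs_mult intro!: mult_right_mono)
    then show "AE t in lborel. norm (ramp q t * g t) \<le> norm (\<bar>q\<bar> * g t)" by simp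
  qed (use g in auto)
  have f_neg: "f q = 0" if "q \<le> 0" for q
  proof -
    have "ramp q t * g t = 0" for t using supp[of t] that by (cases "0 < t") (auto simp: ramp_def)
    then show ?thesis unfolding f_def by (simp only: integral_zero)
  qed
  have lip: "\<bar>f q - f q'\<bar> \<le> \<bar>q - q'\<bar> * C" for q q'
  proof -
    have "\<bar>f q - f q'\<bar> = \<bar>\<integral>t. (ramp q t - ramp q' t) * g t \<partial>lborel\<bar>"
      using i by (simp add: f_def left_diff_distrib)
    also have "\<dots> \<le> (\<integral>t. norm ((ramp q t - ramp q' t) * g t) \<partial>lborel)"
      using integral_norm_bound[of lborel "\<lambda>t. (ramp q t - ramp q' t) * g t"] by simp
    also have "\<dots> \<le> (\<integral>t. \<bar>q - q'\<bar> * \<bar>g t\<bar> \<partial>lborel)"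
    proof (rule integral_mono)
      show "integrable lborel (\<lambda>t. norm ((ramp q t - ramp q' t) * g t))"
        using i by (intro integrable_norm) (simp add: left_diff_distrib)
      show "norm ((ramp q t - ramp q' t) * g t) \<le> \<bar>q - q'\<bar> * \<bar>g t\<bar>" for t
        using ramp_Lipschitz[of q' "q - q'" t] by (auto simp: abs_mult intro!: mult_right_mono)
    qed (use g in auto)
    finally show ?thesis by (simp add: C_def)
  qed
  have f0: "f q = 0" if "q \<le> T" for q
  proof (cases "q \<le> 0")
    case True then show ?thesis by (rule f_neg)
  next
    case False
    have "\<bar>f q\<bar> \<le> e" if "0 < e" for e
    proof -
      define d where "d = e / (C + 1)"
      have d: "0 < d" using \<open>0 < e\<close> C0 by (simp add: d_def)
      obtain r where r: "r \<in> \<rat>" "max 0 (q - d) < r" "r < q"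
        using Rats_dense_in_real[of "max 0 (q - d)" q] False d by auto
      have "f r = 0" using z[of r] r \<open>q \<le> T\<close> by (simp add: f_def)
      then have "\<bar>f q\<bar> \<le> \<bar>q - r\<bar> * C" using lip[of q r] by simp
      also have "\<dots> \<le> d * (C + 1)" using r C0 by (intro mult_mono) auto
      also have "\<dots> = e" using C0 by (simp add: d_def)
      finally show ?thesis .
    qed
    then show ?thesis using field_le_epsilon[of "\<bar>f q\<bar>" 0] by simp
  qed
  have main: "(\<integral>t\<in>{..<q}. g t \<partial>lborel) = 0" if q: "q \<le> T" for q
  proof -
    \<comment> \<open>The backward difference quotient of \<open>ramp\<close> in \<open>q\<close>:
      it is \<open>0\<close> for \<open>t \<ge> q\<close> and \<open>1\<close> for
      \<open>t \<le> q - 1 / real (Suc n)\<close>. Being backward, it stays in the range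
      \<open>q \<le> T\<close> where \<open>f\<close> is known to vanish.\<close>
    define s where "s n t = real (Suc n) * (ramp q t - ramp (q - 1 / real (Suc n)) t)" for n t
    have sb: "\<bar>s n t\<bar> \<le> 1" for n t
      using ramp_Lipschitz[of "q - 1 / real (Suc n)" "1 / real (Suc n)" t]
        mult_left_mono[of "\<bar>ramp q t - ramp (q - 1 / real (Suc n)) t\<bar>" "1 / real (Suc n)" "real (Suc n)"]
      by (simp add: s_def abs_mult)
    have "(\<lambda>n. \<integral>t. s n t * g t \<partial>lborel) \<longlonglongrightarrow> (\<integral>t\<in>{..<q}. g t \<partial>lborel)"
      unfolding set_lebesgue_integral_def
    proof (rule integral_dominated_convergence[where w = "\<lambda>t. \<bar>g t\<bar>"])
      show "AE t in lborel. (\<lambda>n. s n t * g t) \<longlonglongrightarrow> indicator {..<q} t *\<^sub>R g t"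
      proof (intro AE_I2 tendsto_eventually)
        fix t :: real
        show "\<forall>\<^sub>F n in sequentially. s n t * g t = indicator {..<q} t *\<^sub>R g t"
        proof (cases "t < q")
          case True
          obtain n0 where n0: "1 / real (Suc n0) < q - t" using True by (meson diff_gt_0_iff_gt nat_approx_posE)
          show ?thesis
          proof (rule eventually_sequentiallyI[of n0])
            fix n assume "n0 \<le> n"
            then have "1 / real (Suc n) \<le> 1 / real (Suc n0)" by (intro divide_left_mono) auto
            then have "ramp q t = q - t" "ramp (q - 1 / real (Suc n)) t = q - 1 / real (Suc n) - t"
              using n0 True by (auto simp: ramp_def)
            then have "s n t = 1" by (simp add: s_def)
            then show "s n t * g t = indicator {..<q} t *\<^sub>R g t" using True by simp
          qed
        next
          case False
          then have "ramp q t = 0" "ramp (q - 1 / real (Suc n)) t = 0" for n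
            by (auto simp: ramp_def max_def) (smt (verit) divide_nonneg_nonneg of_nat_0_le_iff)+
          then show ?thesis using False by (simp add: s_def)
        qed
      qed
      show "AE t in lborel. norm (s n t * g t) \<le> \<bar>g t\<bar>" for n
        using sb by (auto simp: abs_mult intro!: AE_I2 mult_left_le_one_le)
      show "(\<lambda>t. s n t * g t) \<in> borel_measurable lborel" for n unfolding s_def by measurable
    qed (use g in auto)
    moreover have "(\<integral>t. s n t * g t \<partial>lborel) = 0" for n
    proof -
      have "(\<integral>t. s n t * g t \<partial>lborel) = (\<integral>t. real (Suc n) * (ramp q t * g t - ramp (q - 1 / real (Suc n)) t * g t) \<partial>lborel)"
        by (intro Bochner_Integration.integral_cong) (auto simp: s_def algebra_simps)
      also have "\<dots> = real (Suc n) * (f q - f (q - 1 / real (Suc n)))"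
        unfolding integral_mult_right_zero f_def using i by simp
      also have "\<dots> = 0"
      proof -
        have "f (q - 1 / real (Suc n)) = 0" using q by (intro f0) (smt (verit) divide_nonneg_nonneg of_nat_0_le_iff zero_le_one)
        then show ?thesis using f0[OF q] by simp
      qed
      finally show ?thesis .
    qed
    ultimately show ?thesis by (simp add: LIMSEQ_const_iff)
  qed
  show "(\<integral>t\<in>{..<q}. g t \<partial>lborel) = 0" for q
  proof -
    have "indicator {..<q} t *\<^sub>R g t = indicator {..<min q T} t *\<^sub>R g t" for t
      using supp[of t] by (auto simp: indicator_def)
    then have "(\<integral>t\<in>{..<q}. g t \<partial>lborel) = (\<integral>t\<in>{..<min q T}. g t \<partial>lborel)"
      by (simp only: set_lebesgue_integral_def)
    then show ?thesis using main[of "min q T"] by simp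
  qed
qed

text \<open>For each \<open>q\<close> the function \<open>tint (ramp q) Y\<close> vanishes off a
  null set of points \<open>x\<close>. Restricting to rational \<open>q\<close> gives a common null
  set, off which \<open>ramp_separates\<close> applies to the slice in time; Fubini then returns to
  the product.\<close>

lemma slab_zero:
  fixes Y :: "real \<times> 'a::euclidean_space \<Rightarrow> real"
  assumes Y: "slab_L2 T Y" and T: "0 \<le> T"
    and z: "\<And>q. q \<in> {0..T} \<Longrightarrow> nsq lborel (tint (ramp q) Y) = 0"
  shows "AE p in lborel. Y p = 0"
proof -
  note [measurable] = slab_L2_measurable(2)[OF Y]
  have S: "{p \<in> space (lborel \<Otimes>\<^sub>M lborel). Y (fst p, snd p) = 0} \<in> sets (lborel \<Otimes>\<^sub>M lborel)"
    by measurable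
  have "AE x in lborel. tint (ramp q) Y x = 0" if "q \<in> {0..T}" for q
  proof -
    have "integrable lborel (\<lambda>x. (norm (tint (ramp q) Y x))\<^sup>2)" using tint_ramp_L2(1)[OF Y T] by (simp add: L2_def)
    then have "AE x in lborel. (norm (tint (ramp q) Y x))\<^sup>2 = 0"
      using z[OF that] by (subst (asm) ip_self) (subst (asm) integral_nonneg_eq_0_iff_AE, auto)
    then show ?thesis by simp
  qed
  then have "AE x in lborel. \<forall>q\<in>\<rat> \<inter> {0..T}. tint (ramp q) Y x = 0"
    by (subst AE_ball_countable) (auto intro: countable_Int1 countable_rat)
  then have "AE x in lborel. AE t in lborel. Y (t, x) = 0"
    using slab_L2_slice_space[OF Y]
  proof eventually_elim
    case (elim x)
    show ?case
    proof (rule ramp_separates[of _ T])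
      show "integrable lborel (\<lambda>t. Y (t, x))"
        using slab_slice_bound(1)[OF Y elim(2) T, of "\<lambda>_. 1" 1] by simp
      show "Y (t, x) = 0" if "t \<notin> {0<..<T}" for t using Y that by (simp add: slab_L2_def)
      show "(\<integral>t. ramp q t * Y (t, x) \<partial>lborel) = 0" if "q \<in> \<rat>" "0 \<le> q" "q \<le> T" for q
        using elim(1) that by (simp add: tint_def)
    qed
  qed
  then have "AE t in lborel. AE x in lborel. Y (t, x) = 0"
    using lborel_pair.AE_commute[of "\<lambda>t x. Y (t, x) = 0"] S by simp
  then have "AE p in lborel \<Otimes>\<^sub>M lborel. Y p = 0"
    by (intro lborel_pair.AE_pair_measure) (use S in simp_all)
  then show ?thesis unfolding lborel_prod .
qed

section \<open>Borel representatives and test functions\<close>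

lemma L2_on_iff_L2: "L2_on A f \<longleftrightarrow> L2 (lebesgue_on A) f"
  by (simp add: L2_on_def L2_def)

text \<open>The bridge between the two measures in play: the problem is stated with
  \<open>lebesgue_on\<close>, while Fubini is used on \<open>lborel\<close>. Measurability of
  \<open>h\<close> is a conclusion, because the completed measure ignores the null set where
  \<open>h\<close> and \<open>h'\<close> differ.\<close>

lemma lebesgue_on_transfer:
  fixes h h' :: "'a::euclidean_space \<Rightarrow> 'e::euclidean_space"
  assumes A: "A \<in> sets borel" and h': "h' \<in> borel_measurable borel" "\<And>x. x \<notin> A \<Longrightarrow> h' x = 0"
    and ae: "AE x in lborel. x \<in> A \<longrightarrow> h' x = h x"
  shows "h \<in> borel_measurable (lebesgue_on A)"
    and "integrable (lebesgue_on A) h \<longleftrightarrow> integrable lborel h'"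
    and "(\<integral>x. h x \<partial>lebesgue_on A) = (\<integral>x. h' x \<partial>lborel)"
proof -
  have A': "A \<in> sets lebesgue" using A by auto
  have eq: "AE x in lebesgue. h' x = (if x \<in> A then h x else 0)"
  proof -
    have "AE x in lborel. h' x = (if x \<in> A then h x else 0)"
      using ae by eventually_elim (use h' in auto)
    then show ?thesis by (rule AE_completion)
  qed
  have m': "h' \<in> borel_measurable lebesgue" using h'(1) by (auto intro: measurable_completion)
  have m: "(\<lambda>x. if x \<in> A then h x else 0) \<in> borel_measurable lebesgue"
    by (rule borel_measurable_AE[OF m' eq])
  then show "h \<in> borel_measurable (lebesgue_on A)"
    using A' by (simp add: borel_measurable_if)
  have ind: "(\<lambda>x. indicator A x *\<^sub>R h x) = (\<lambda>x. if x \<in> A then h x else 0)" by (auto simp: indicator_def)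
  have "integrable (lebesgue_on A) h \<longleftrightarrow> integrable lebesgue (\<lambda>x. if x \<in> A then h x else 0)"
    using A' by (simp add: integrable_restrict_space ind)
  also have "\<dots> \<longleftrightarrow> integrable lebesgue h'"
    by (rule integrable_cong_AE[OF m m']) (use eq in auto)
  also have "\<dots> \<longleftrightarrow> integrable lborel h'"
    using h'(1) by (simp add: integrable_completion)
  finally show "integrable (lebesgue_on A) h \<longleftrightarrow> integrable lborel h'" .
  have "(\<integral>x. h x \<partial>lebesgue_on A) = (\<integral>x. (if x \<in> A then h x else 0) \<partial>lebesgue)"
    using A' by (simp add: integral_restrict_space ind)
  also have "\<dots> = (\<integral>x. h' x \<partial>lebesgue)"
    by (rule integral_cong_AE[OF m m']) (use eq in auto)
  also have "\<dots> = (\<integral>x. h' x \<partial>lborel)"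
    using h'(1) by (simp add: integral_completion)
  finally show "(\<integral>x. h x \<partial>lebesgue_on A) = (\<integral>x. h' x \<partial>lborel)" .
qed

text \<open>Vanishing off \<open>A\<close> is demanded at every point, so that slices at a fixed
  time inherit it and products need no indicator function.\<close>

definition borel_version :: "'a::euclidean_space set \<Rightarrow> ('a \<Rightarrow> 'e::euclidean_space) \<Rightarrow> ('a \<Rightarrow> 'e) \<Rightarrow> bool" where
  "borel_version A f f' \<longleftrightarrow> f' \<in> borel_measurable borel \<and> (\<forall>x. x \<notin> A \<longrightarrow> f' x = 0) \<and>
     (AE x in lborel. x \<in> A \<longrightarrow> f' x = f x)"

text \<open>A real function measurable for the completion agrees almost everywhere with a Borel one;
  the vector case is assembled from the finitely many coordinates in \<open>Basis\<close>.\<close>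

lemma borel_version_exists:
  fixes f :: "'a::euclidean_space \<Rightarrow> 'e::euclidean_space"
  assumes A: "A \<in> sets borel" and f: "f \<in> borel_measurable (lebesgue_on A)"
  obtains f' where "borel_version A f f'"
proof -
  have A': "A \<in> sets lebesgue" using A by auto
  define h where "h x = (if x \<in> A then f x else 0)" for x
  have h: "h \<in> borel_measurable lebesgue" using f A' by (simp add: h_def[abs_def] borel_measurable_if)
  have "\<exists>g\<in>borel_measurable lborel. AE x in lborel. h x \<bullet> b = g x" for b
    by (rule completion_ex_borel_measurable_real) (use h in auto)
  then obtain g where g: "\<And>b. g b \<in> borel_measurable lborel" "\<And>b. AE x in lborel. h x \<bullet> b = g b x" by metis
  have [measurable]: "g b \<in> borel_measurable borel" for b using g(1)[of b] by simp
  define f' where "f' x = indicator A x *\<^sub>R (\<Sum>b\<in>Basis. g b x *\<^sub>R b)" for x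
  have "AE x in lborel. \<forall>b\<in>Basis. h x \<bullet> b = g b x"
    using g(2) by (subst AE_finite_all) auto
  then have "AE x in lborel. x \<in> A \<longrightarrow> f' x = f x"
  proof eventually_elim
    case (elim x)
    then have "(\<Sum>b\<in>Basis. g b x *\<^sub>R b) = (\<Sum>b\<in>Basis. (h x \<bullet> b) *\<^sub>R b)" by (intro sum.cong) auto
    then show ?case by (auto simp: f'_def h_def euclidean_representation)
  qed
  moreover have "f' \<in> borel_measurable borel" unfolding f'_def using A by measurable
  ultimately show ?thesis by (intro that[of f']) (auto simp: borel_version_def f'_def)
qed

lemma borel_version_apply:
  fixes f f' :: "'a::euclidean_space \<Rightarrow> 'e::euclidean_space" and k :: "'e \<Rightarrow> 'b::euclidean_space"
  assumes A: "A \<in> sets borel" and f: "borel_version A f f'" and k: "k \<in> borel_measurable borel" "k 0 = 0"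
  shows "borel_version A (\<lambda>x. k (f x)) (\<lambda>x. k (f' x))"
  using assms by (auto simp: borel_version_def)

lemma borel_version_L2:
  fixes f :: "'a::euclidean_space \<Rightarrow> 'e::euclidean_space"
  assumes A: "A \<in> sets borel" and f: "borel_version A f f'"
  shows "L2_on A f \<longleftrightarrow> L2 lborel f'"
proof -
  have "borel_version A (\<lambda>x. (norm (f x))\<^sup>2) (\<lambda>x. (norm (f' x))\<^sup>2)"
    using borel_version_apply[OF A f, of "\<lambda>y. (norm y)\<^sup>2"] by simp
  then have "integrable (lebesgue_on A) (\<lambda>x. (norm (f x))\<^sup>2) \<longleftrightarrow> integrable lborel (\<lambda>x. (norm (f' x))\<^sup>2)"
    using A by (intro lebesgue_on_transfer(2)) (auto simp: borel_version_def)
  moreover have "f \<in> borel_measurable (lebesgue_on A)"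
    using lebesgue_on_transfer(1)[OF A] f by (auto simp: borel_version_def)
  ultimately show ?thesis using f by (auto simp: L2_on_def L2_def borel_version_def)
qed

lemma borel_version_inner:
  fixes f g :: "'a::euclidean_space \<Rightarrow> 'e::euclidean_space"
  assumes A: "A \<in> sets borel" and f: "borel_version A f f'" and g: "borel_version A g g'"
  shows "(\<integral>x. f x \<bullet> g x \<partial>lebesgue_on A) = ip lborel f' g'"
  unfolding ip_def
proof (rule lebesgue_on_transfer(3)[OF A])
  show "(\<lambda>x. f' x \<bullet> g' x) \<in> borel_measurable borel" using f g by (auto simp: borel_version_def)
  have "AE x in lborel. x \<in> A \<longrightarrow> f' x = f x" "AE x in lborel. x \<in> A \<longrightarrow> g' x = g x"
    using f g by (auto simp: borel_version_def)
  then show "AE x in lborel. x \<in> A \<longrightarrow> f' x \<bullet> g' x = f x \<bullet> g x" by eventually_elim auto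
  show "x \<notin> A \<Longrightarrow> f' x \<bullet> g' x = 0" for x using f by (auto simp: borel_version_def)
qed

section \<open>Linear combinations of test functions and of elements of \<open>H10\<close>\<close>

lemma frechet_derivative_lincomb:
  fixes f g :: "'d::euclidean_space \<Rightarrow> real"
  assumes "f differentiable (at x)" "g differentiable (at x)"
  shows "frechet_derivative (\<lambda>x. a * f x + b * g x) (at x) e
     = a * frechet_derivative f (at x) e + b * frechet_derivative g (at x) e"
proof -
  have "((\<lambda>x. a * f x + b * g x) has_derivative
    (\<lambda>e. a * frechet_derivative f (at x) e + b * frechet_derivative g (at x) e)) (at x)"
    using assms by (intro has_derivative_add has_derivative_mult_right) (auto simp: frechet_derivative_works[symmetric])
  from frechet_derivative_at[OF this] show ?thesis by metis
qed

lemma smooth_k_lincomb: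
  fixes f g :: "'d::euclidean_space \<Rightarrow> real"
  shows "smooth_k k f \<Longrightarrow> smooth_k k g \<Longrightarrow> smooth_k k (\<lambda>x. a * f x + b * g x)"
proof (induction k arbitrary: f g)
  case 0 then show ?case by (auto intro!: continuous_intros)
next
  case (Suc k)
  note F = Suc.prems(1)[unfolded smooth_k.simps] and G = Suc.prems(2)[unfolded smooth_k.simps]
  note f = F[THEN conjunct1, THEN spec] F[THEN conjunct2, THEN conjunct1] F[THEN conjunct2, THEN conjunct2, THEN spec]
  note g = G[THEN conjunct1, THEN spec] G[THEN conjunct2, THEN conjunct1] G[THEN conjunct2, THEN conjunct2, THEN spec]
  show ?case
    unfolding smooth_k.simps frechet_derivative_lincomb[OF f(1) g(1)]
  proof (intro conjI allI Suc.IH f g)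
    show "(\<lambda>x. a * f x + b * g x) differentiable (at x)" for x
      by (intro differentiable_add differentiable_mult differentiable_const f g)
    show "continuous_on UNIV (\<lambda>x. a * f x + b * g x)" by (intro continuous_intros f g)
  qed
qed

lemma test_fun_regular:
  assumes "test_fun \<Omega> \<phi>"
  shows "\<phi> differentiable (at x)" "continuous_on UNIV \<phi>" "continuous_on UNIV (\<lambda>x. frechet_derivative \<phi> (at x) e)"
    and "continuous_on UNIV (grad \<phi>)"
proof -
  have "smooth_k (Suc 0) \<phi>" using assms by (simp only: test_fun_def smooth_def)
  then show *: "\<phi> differentiable (at x)" "continuous_on UNIV \<phi>" "continuous_on UNIV (\<lambda>x. frechet_derivative \<phi> (at x) e)" for e
    by auto
  show "continuous_on UNIV (grad \<phi>)"
    unfolding grad_def[abs_def] by (intro continuous_intros *)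
qed

lemma test_fun_lincomb:
  fixes f g :: "'d::euclidean_space \<Rightarrow> real"
  assumes f: "test_fun \<Omega> f" and g: "test_fun \<Omega> g"
  shows "test_fun \<Omega> (\<lambda>x. a * f x + b * g x)"
proof -
  have "{x. a * f x + b * g x \<noteq> 0} \<subseteq> {x. f x \<noteq> 0} \<union> {x. g x \<noteq> 0}" by auto
  then have c: "closure {x. a * f x + b * g x \<noteq> 0} \<subseteq> closure {x. f x \<noteq> 0} \<union> closure {x. g x \<noteq> 0}"
    unfolding closure_Un[symmetric] by (rule closure_mono)
  have "compact (closure {x. f x \<noteq> 0} \<union> closure {x. g x \<noteq> 0})"
    using f g by (auto simp: test_fun_def)
  from compact_Int_closed[OF this closed_closure, of "{x. a * f x + b * g x \<noteq> 0}"]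
  have "compact (closure {x. a * f x + b * g x \<noteq> 0})"
    unfolding Int_absorb1[OF c] .
  then show ?thesis using f g c by (auto simp: test_fun_def smooth_def intro: smooth_k_lincomb)
qed

lemma grad_lincomb:
  assumes "test_fun \<Omega> f" "test_fun \<Omega> g"
  shows "grad (\<lambda>x. a * f x + b * g x) x = a *\<^sub>R grad f x + b *\<^sub>R grad g x"
  using test_fun_regular(1)[OF assms(1)] test_fun_regular(1)[OF assms(2)]
  by (simp add: grad_def frechet_derivative_lincomb scaleR_add_left sum.distrib scaleR_sum_right)

lemma continuous_measurable_lebesgue_on:
  fixes f :: "'a::euclidean_space \<Rightarrow> 'b::euclidean_space"
  assumes "continuous_on UNIV f" shows "f \<in> borel_measurable (lebesgue_on A)"
proof -
  have "f \<in> borel_measurable borel" using assms by (simp add: borel_measurable_continuous_onI)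
  then have "f \<in> borel_measurable lebesgue" by (auto intro: measurable_completion)
  then show ?thesis by (rule measurable_restrict_space1)
qed

text \<open>The weak gradient and the approximating test functions belong to the predicate and have
  to be combined along with the functions. The result makes the pairs \<open>(v, Gv)\<close> a
  linear space, as needed for the representation of functionals and for differences of
  solutions.\<close>

lemma H10_lincomb:
  assumes v: "H10 \<Omega> v Gv" and w: "H10 \<Omega> w Gw"
  shows "H10 \<Omega> (\<lambda>x. a * v x + b * w x) (\<lambda>x. a *\<^sub>R Gv x + b *\<^sub>R Gw x)"
  unfolding H10_def
proof (intro conjI)
  let ?M = "lebesgue_on \<Omega>"
  have L: "L2 ?M v" "L2 ?M w" "L2 ?M Gv" "L2 ?M Gw" using v w by (auto simp: H10_def L2_on_iff_L2)
  show "L2_on \<Omega> (\<lambda>x. a * v x + b * w x)"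
    using L2_add[OF L2_scaleR[OF L(1)] L2_scaleR[OF L(2)], of a b] by (simp add: L2_on_iff_L2)
  show "L2_on \<Omega> (\<lambda>x. a *\<^sub>R Gv x + b *\<^sub>R Gw x)"
    using L by (auto simp: L2_on_iff_L2)
  show "weak_grad \<Omega> (\<lambda>x. a * v x + b * w x) (\<lambda>x. a *\<^sub>R Gv x + b *\<^sub>R Gw x)"
    unfolding weak_grad_def
  proof (intro allI impI)
    fix \<phi> e assume \<phi>: "test_fun \<Omega> \<phi>"
    have V: "integrable ?M (\<lambda>x. v x * frechet_derivative \<phi> (at x) e)" "integrable ?M (\<lambda>x. (Gv x \<bullet> e) * \<phi> x)"
      "(\<integral>x. v x * frechet_derivative \<phi> (at x) e \<partial>?M) = - (\<integral>x. (Gv x \<bullet> e) * \<phi> x \<partial>?M)"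
      using v \<phi> unfolding H10_def weak_grad_def by blast+
    have W: "integrable ?M (\<lambda>x. w x * frechet_derivative \<phi> (at x) e)" "integrable ?M (\<lambda>x. (Gw x \<bullet> e) * \<phi> x)"
      "(\<integral>x. w x * frechet_derivative \<phi> (at x) e \<partial>?M) = - (\<integral>x. (Gw x \<bullet> e) * \<phi> x \<partial>?M)"
      using w \<phi> unfolding H10_def weak_grad_def by blast+
    have e1: "(\<lambda>x. (a * v x + b * w x) * frechet_derivative \<phi> (at x) e)
      = (\<lambda>x. a * (v x * frechet_derivative \<phi> (at x) e) + b * (w x * frechet_derivative \<phi> (at x) e))"
      by (auto simp: algebra_simps)
    have e2: "(\<lambda>x. ((a *\<^sub>R Gv x + b *\<^sub>R Gw x) \<bullet> e) * \<phi> x)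
      = (\<lambda>x. a * ((Gv x \<bullet> e) * \<phi> x) + b * ((Gw x \<bullet> e) * \<phi> x))"
      by (auto simp: algebra_simps inner_add_left)
    show "integrable ?M (\<lambda>x. (a * v x + b * w x) * frechet_derivative \<phi> (at x) e) \<and>
        integrable ?M (\<lambda>x. ((a *\<^sub>R Gv x + b *\<^sub>R Gw x) \<bullet> e) * \<phi> x) \<and>
        (\<integral>x. (a * v x + b * w x) * frechet_derivative \<phi> (at x) e \<partial>?M) =
        - (\<integral>x. ((a *\<^sub>R Gv x + b *\<^sub>R Gw x) \<bullet> e) * \<phi> x \<partial>?M)"
      unfolding e1 e2 using V W by simp
  qed
  obtain f where f: "\<And>m. test_fun \<Omega> (f m)"
    "\<And>m. integrable ?M (\<lambda>x. (f m x - v x)\<^sup>2)" "\<And>m. integrable ?M (\<lambda>x. (norm (grad (f m) x - Gv x))\<^sup>2)"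
    "(\<lambda>m. (\<integral>x. (f m x - v x)\<^sup>2 \<partial>?M) + (\<integral>x. (norm (grad (f m) x - Gv x))\<^sup>2 \<partial>?M)) \<longlonglongrightarrow> 0"
    using v unfolding H10_def by blast
  obtain g where g: "\<And>m. test_fun \<Omega> (g m)"
    "\<And>m. integrable ?M (\<lambda>x. (g m x - w x)\<^sup>2)" "\<And>m. integrable ?M (\<lambda>x. (norm (grad (g m) x - Gw x))\<^sup>2)"
    "(\<lambda>m. (\<integral>x. (g m x - w x)\<^sup>2 \<partial>?M) + (\<integral>x. (norm (grad (g m) x - Gw x))\<^sup>2 \<partial>?M)) \<longlonglongrightarrow> 0"
    using w unfolding H10_def by blast
  have Lf: "L2 ?M (\<lambda>x. f m x - v x)" "L2 ?M (\<lambda>x. grad (f m) x - Gv x)"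
    and Lg: "L2 ?M (\<lambda>x. g m x - w x)" "L2 ?M (\<lambda>x. grad (g m) x - Gw x)" for m
    using f(2,3)[of m] g(2,3)[of m] L continuous_measurable_lebesgue_on[OF test_fun_regular(2)[OF f(1)]]
      continuous_measurable_lebesgue_on[OF test_fun_regular(2)[OF g(1)]]
      continuous_measurable_lebesgue_on[OF test_fun_regular(4)[OF f(1)]]
      continuous_measurable_lebesgue_on[OF test_fun_regular(4)[OF g(1)]]
    by (auto simp: L2_def)
  define h where "h m x = a * f m x + b * g m x" for m x
  have h: "test_fun \<Omega> (h m)" for m unfolding h_def using f g by (intro test_fun_lincomb)
  have e1: "h m x - (a * v x + b * w x) = a *\<^sub>R (f m x - v x) + b *\<^sub>R (g m x - w x)" for m x
    by (simp add: h_def algebra_simps)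
  have e2: "grad (h m) x - (a *\<^sub>R Gv x + b *\<^sub>R Gw x) = a *\<^sub>R (grad (f m) x - Gv x) + b *\<^sub>R (grad (g m) x - Gw x)" for m x
    unfolding h_def grad_lincomb[OF f(1) g(1)] by (simp add: algebra_simps)
  have H1: "L2 ?M (\<lambda>x. h m x - (a * v x + b * w x))" "L2 ?M (\<lambda>x. grad (h m) x - (a *\<^sub>R Gv x + b *\<^sub>R Gw x))" for m
    unfolding e1 e2 using Lf Lg by (intro L2_add L2_scaleR; simp)+
  have sc: "L2 ?M F \<Longrightarrow> L2 ?M G \<Longrightarrow> nsq ?M (\<lambda>x. a *\<^sub>R F x + b *\<^sub>R G x)
     \<le> 2 * (a\<^sup>2 * nsq ?M F) + 2 * (b\<^sup>2 * nsq ?M G)" for F G :: "'a \<Rightarrow> 'z::euclidean_space"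
    by (rule order_trans[OF ip_add_self_le]) (auto simp: ip_scaleR_left ip_scaleR_right power2_eq_square)
  define S where "S m = (\<integral>x. (h m x - (a * v x + b * w x))\<^sup>2 \<partial>?M) +
     (\<integral>x. (norm (grad (h m) x - (a *\<^sub>R Gv x + b *\<^sub>R Gw x)))\<^sup>2 \<partial>?M)" for m
  have S: "S \<longlonglongrightarrow> 0"
  proof (rule tendsto_sandwich[OF _ _ tendsto_const])
    show "\<forall>\<^sub>F m in sequentially. 0 \<le> S m" by (simp add: S_def)
    have "S m = nsq ?M (\<lambda>x. h m x - (a * v x + b * w x))
      + nsq ?M (\<lambda>x. grad (h m) x - (a *\<^sub>R Gv x + b *\<^sub>R Gw x))" for m
      by (simp add: S_def ip_self)
    then have "S m \<le> (2 * (a\<^sup>2 * nsq ?M (\<lambda>x. f m x - v x)) + 2 * (b\<^sup>2 * nsq ?M (\<lambda>x. g m x - w x)))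
      + (2 * (a\<^sup>2 * nsq ?M (\<lambda>x. grad (f m) x - Gv x)) + 2 * (b\<^sup>2 * nsq ?M (\<lambda>x. grad (g m) x - Gw x)))" for m
      unfolding e1 e2 by (simp only:) (rule add_mono[OF sc[OF Lf(1) Lg(1)] sc[OF Lf(2) Lg(2)]])
    then show "\<forall>\<^sub>F m in sequentially. S m \<le>
        2 * a\<^sup>2 * ((\<integral>x. (f m x - v x)\<^sup>2 \<partial>?M) + (\<integral>x. (norm (grad (f m) x - Gv x))\<^sup>2 \<partial>?M))
      + 2 * b\<^sup>2 * ((\<integral>x. (g m x - w x)\<^sup>2 \<partial>?M) + (\<integral>x. (norm (grad (g m) x - Gw x))\<^sup>2 \<partial>?M))"
      by (simp add: ip_self algebra_simps)
    show "(\<lambda>m. 2 * a\<^sup>2 * ((\<integral>x. (f m x - v x)\<^sup>2 \<partial>?M) + (\<integral>x. (norm (grad (f m) x - Gv x))\<^sup>2 \<partial>?M))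
      + 2 * b\<^sup>2 * ((\<integral>x. (g m x - w x)\<^sup>2 \<partial>?M) + (\<integral>x. (norm (grad (g m) x - Gw x))\<^sup>2 \<partial>?M))) \<longlonglongrightarrow> 0"
      using tendsto_add[OF tendsto_mult[OF tendsto_const f(4)] tendsto_mult[OF tendsto_const g(4)], of "2 * a\<^sup>2" "2 * b\<^sup>2"] by simp
  qed
  show "\<exists>\<phi>. (\<forall>m. test_fun \<Omega> (\<phi> m)) \<and>
        (\<forall>m. integrable ?M (\<lambda>x. (\<phi> m x - (a * v x + b * w x))\<^sup>2) \<and>
             integrable ?M (\<lambda>x. (norm (grad (\<phi> m) x - (a *\<^sub>R Gv x + b *\<^sub>R Gw x)))\<^sup>2)) \<and>
        (\<lambda>m. (\<integral>x. (\<phi> m x - (a * v x + b * w x))\<^sup>2 \<partial>?M) +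
              (\<integral>x. (norm (grad (\<phi> m) x - (a *\<^sub>R Gv x + b *\<^sub>R Gw x)))\<^sup>2 \<partial>?M)) \<longlonglongrightarrow> 0"
    using h H1 S unfolding S_def[abs_def] by (intro exI[of _ h]) (auto simp: L2_def)
qed

section \<open>Weak solutions of the heat equation\<close>

text \<open>\<open>F\<close> is a Borel representative, extended by zero, of \<open>(y, \<nabla>y)\<close>; the functional \<open>m\<close> stands for the initial
  value, so that linear combinations of solutions are again of this form. The last conjunct is the weak form for
  \<open>qramp q\<close> in time, in which \<open>- ramp q\<close> is the derivative of the test function.\<close>

definition wsol :: "'d::euclidean_space set \<Rightarrow> real \<Rightarrow> ('n::finite \<Rightarrow> (('d \<Rightarrow> real) \<Rightarrow> real)) \<Rightarrow>
    (real \<Rightarrow> real^'n) \<Rightarrow> (('d \<Rightarrow> real) \<Rightarrow> real) \<Rightarrow> (real \<times> 'd \<Rightarrow> real \<times> 'd) \<Rightarrow> bool" where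
  "wsol \<Omega> T \<psi> u m F \<longleftrightarrow> slab_L2 T F \<and> (\<forall>t x. x \<notin> \<Omega> \<longrightarrow> F (t, x) = 0) \<and>
     (AE t in lborel. t \<in> {0<..<T} \<longrightarrow>
        (\<exists>v Gv. H10 \<Omega> v Gv \<and> borel_version \<Omega> (\<lambda>x. (v x, Gv x)) (\<lambda>x. F (t, x)))) \<and>
     (\<forall>v Gv f. H10 \<Omega> v Gv \<longrightarrow> borel_version \<Omega> (\<lambda>x. (v x, Gv x)) f \<longrightarrow> (\<forall>q\<in>{0..T}.
        ip lborel (\<lambda>x. fst (f x)) (tint (ramp q) (\<lambda>p. fst (F p)))
      + ip lborel (\<lambda>x. snd (f x)) (tint (qramp q) (\<lambda>p. snd (F p)))
      = (\<Sum>j\<in>UNIV. (\<integral>t. qramp q t * (u t $ j) \<partial>lebesgue_on {0<..<T}) * \<psi> j v) + qramp q 0 * m v))"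

lemma L2_Pair:
  assumes "L2 M f" "L2 M g" shows "L2 M (\<lambda>x. (f x, g x))"
proof -
  have [measurable]: "f \<in> borel_measurable M" "g \<in> borel_measurable M" using assms by (auto simp: L2_def)
  have "(\<lambda>x. (f x, g x)) \<in> M \<rightarrow>\<^sub>M borel \<Otimes>\<^sub>M borel" by measurable
  moreover have "(norm (f x, g x))\<^sup>2 = (norm (f x))\<^sup>2 + (norm (g x))\<^sup>2" for x
    by (simp add: norm_Pair)
  ultimately show ?thesis using assms by (simp add: L2_def borel_prod)
qed

lemma ip_Pair:
  assumes "L2 M f" "L2 M g" "L2 M f'" "L2 M g'"
  shows "ip M (\<lambda>x. (f x, g x)) (\<lambda>x. (f' x, g' x)) = ip M f f' + ip M g g'"
  using assms by (simp add: ip_def L2_inner_integrable)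

lemma tint_lincomb_fun:
  assumes F: "slab_L2 T F" and G: "slab_L2 T G" and "0 \<le> T"
    and c: "c \<in> borel_measurable borel" "\<And>t. t \<in> {0<..<T} \<Longrightarrow> \<bar>c t\<bar> \<le> K" and K: "0 \<le> K"
  shows "AE x in lborel. tint c (\<lambda>p. a *\<^sub>R F p + b *\<^sub>R G p) x = a *\<^sub>R tint c F x + b *\<^sub>R tint c G x"
  using slab_L2_slice_space[OF F] slab_L2_slice_space[OF G]
proof eventually_elim
  case (elim x)
  have "tint c (\<lambda>p. a *\<^sub>R F p + b *\<^sub>R G p) x = (\<integral>t. a *\<^sub>R (c t *\<^sub>R F (t, x)) + b *\<^sub>R (c t *\<^sub>R G (t, x)) \<partial>lborel)"
    unfolding tint_def by (intro Bochner_Integration.integral_cong) (auto simp: algebra_simps)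
  also have "\<dots> = a *\<^sub>R tint c F x + b *\<^sub>R tint c G x"
    unfolding tint_def
    using slab_slice_bound(1)[OF F elim(1) \<open>0 \<le> T\<close> c K] slab_slice_bound(1)[OF G elim(2) \<open>0 \<le> T\<close> c K]
    by (simp del: scaleR_scaleR)
  finally show ?case .
qed

lemma ip_tint_lincomb_fun:
  assumes F: "slab_L2 T F" and G: "slab_L2 T G" and "0 \<le> T" and w: "L2 lborel w"
    and c: "c \<in> borel_measurable borel" "\<And>t. t \<in> {0<..<T} \<Longrightarrow> \<bar>c t\<bar> \<le> K" and K: "0 \<le> K"
  shows "ip lborel w (tint c (\<lambda>p. a *\<^sub>R F p + b *\<^sub>R G p)) = a * ip lborel w (tint c F) + b * ip lborel w (tint c G)"
proof -
  note L = tint_L2(1)[OF F \<open>0 \<le> T\<close> c K] tint_L2(1)[OF G \<open>0 \<le> T\<close> c K]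
    tint_L2(1)[OF slab_L2_combine[OF F G, of a b] \<open>0 \<le> T\<close> c K]
  have "ip lborel w (tint c (\<lambda>p. a *\<^sub>R F p + b *\<^sub>R G p)) = ip lborel w (\<lambda>x. a *\<^sub>R tint c F x + b *\<^sub>R tint c G x)"
    by (rule ip_cong_AE[OF _ tint_lincomb_fun[OF F G \<open>0 \<le> T\<close> c K]]) (use L w in \<open>auto intro!: L2_add L2_scaleR\<close>)
  also have "\<dots> = a * ip lborel w (tint c F) + b * ip lborel w (tint c G)"
    using L w by (simp add: ip_add_right L2_scaleR ip_scaleR_right)
  finally show ?thesis .
qed

text \<open>\<open>g j\<close> is the \<open>j\<close>-th component of a Borel representative of the
  control, the form in which controls are paired with kernels. The last bound, Cauchy-Schwarz on an
  interval of length \<open>T\<close>, makes all pairings with bounded kernels small when the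
  control is small in \<open>L2\<close>.\<close>

lemma L2_on_control:
  fixes u :: "real \<Rightarrow> real^'n::finite"
  assumes u: "L2_on {0<..<T} u" and T: "0 \<le> T"
  obtains g where "\<And>j. integrable lborel (g j)" "\<And>j t. t \<notin> {0<..<T} \<Longrightarrow> g j t = 0"
    "\<And>c j. c \<in> borel_measurable borel \<Longrightarrow> (\<integral>t. c t * (u t $ j) \<partial>lebesgue_on {0<..<T}) = (\<integral>t. c t * g j t \<partial>lborel)"
    "\<And>c j K. c \<in> borel_measurable borel \<Longrightarrow> (\<And>t. t \<in> {0<..<T} \<Longrightarrow> \<bar>c t\<bar> \<le> K) \<Longrightarrow> integrable (lebesgue_on {0<..<T}) (\<lambda>t. c t * (u t $ j))"
    "\<And>j. (\<integral>t. \<bar>g j t\<bar> \<partial>lborel) \<le> sqrt T * sqrt (\<integral>t. (norm (u t))\<^sup>2 \<partial>lebesgue_on {0<..<T})"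
proof -
  let ?A = "{0<..<T}"
  have A: "?A \<in> sets borel" by simp
  obtain u' where u': "borel_version ?A u u'"
    using borel_version_exists[OF A] u by (auto simp: L2_on_def)
  have [measurable]: "u' \<in> borel_measurable borel" using u' by (simp add: borel_version_def)
  have [measurable]: "(\<lambda>t. u' t $ j) \<in> borel_measurable borel" for j
    by (intro measurable_compose[OF \<open>u' \<in> borel_measurable borel\<close>] borel_measurable_continuous_onI continuous_intros)
  have L: "L2 lborel u'" using u borel_version_L2[OF A u'] by simp
  have off: "t \<notin> ?A \<Longrightarrow> u' t = 0" for t using u' by (simp add: borel_version_def)
  define e :: "real \<Rightarrow> real" where "e t = indicator ?A t" for t
  have e: "L2 lborel e" unfolding e_def by (rule L2_indicator) (use T in auto)
  have n: "L2 lborel (\<lambda>t. norm (u' t))" using L by (rule L2_norm)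
  have en: "(\<lambda>t. e t * norm (u' t)) = (\<lambda>t. norm (u' t))" 
  proof
    show "e t * norm (u' t) = norm (u' t)" for t using off[of t] by (cases "t \<in> ?A") (auto simp: e_def)
  qed
  have ni: "integrable lborel (\<lambda>t. norm (u' t))" using L2_inner_integrable[OF e n] by (simp add: en)
  have gi: "integrable lborel (\<lambda>t. u' t $ j)" for j
    by (rule Bochner_Integration.integrable_bound[OF ni]) (auto intro!: AE_I2 component_le_norm_cart)
  have tr: "(\<lambda>t. c t * (u' t $ j)) \<in> borel_measurable borel"
    "AE t in lborel. t \<in> ?A \<longrightarrow> c t * (u' t $ j) = c t * (u t $ j)"
    "\<And>t. t \<notin> ?A \<Longrightarrow> c t * (u' t $ j) = 0" if [measurable]: "c \<in> borel_measurable borel" for c :: "real \<Rightarrow> real" and j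
    using u' off by (auto simp: borel_version_def)
  show ?thesis
  proof (rule that[of "\<lambda>j t. u' t $ j"])
    show "integrable lborel (\<lambda>t. u' t $ j)" for j by (rule gi)
    show "u' t $ j = 0" if "t \<notin> ?A" for t j using off[OF that] by simp
    show "(\<integral>t. c t * (u t $ j) \<partial>lebesgue_on ?A) = (\<integral>t. c t * (u' t $ j) \<partial>lborel)"
      if "c \<in> borel_measurable borel" for c j
      by (rule lebesgue_on_transfer(3)[OF A tr(1)[OF that] tr(3)[OF that] tr(2)[OF that]])
    show "integrable (lebesgue_on ?A) (\<lambda>t. c t * (u t $ j))"
      if c: "c \<in> borel_measurable borel" and K: "\<And>t. t \<in> {0<..<T} \<Longrightarrow> \<bar>c t\<bar> \<le> K" for c j K
    proof -
      have "integrable lborel (\<lambda>t. c t * (u' t $ j))"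
      proof (rule Bochner_Integration.integrable_bound[where f = "\<lambda>t. K * (u' t $ j)"])
        show "(\<lambda>t. c t * (u' t $ j)) \<in> borel_measurable lborel" using tr(1)[OF c] by simp
        have "norm (c t * (u' t $ j)) \<le> norm (K * (u' t $ j))" for t
        proof (cases "t \<in> ?A")
          case True
          then have "\<bar>c t\<bar> \<le> \<bar>K\<bar>" using K[OF True] by linarith
          then show ?thesis by (simp add: abs_mult mult_right_mono)
        qed (use off in simp)
        then show "AE t in lborel. norm (c t * (u' t $ j)) \<le> norm (K * (u' t $ j))" by simp
      qed (use gi in simp)
      then show ?thesis
        using lebesgue_on_transfer(2)[OF A tr(1)[OF c] tr(3)[OF c] tr(2)[OF c]] by simp
    qed
    show "(\<integral>t. \<bar>u' t $ j\<bar> \<partial>lborel) \<le> sqrt T * sqrt (\<integral>t. (norm (u t))\<^sup>2 \<partial>lebesgue_on ?A)" for j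
    proof -
      have "(\<integral>t. \<bar>u' t $ j\<bar> \<partial>lborel) \<le> (\<integral>t. norm (u' t) \<partial>lborel)"
        using gi[of j] ni by (intro integral_mono component_le_norm_cart) auto
      also have "\<dots> = ip lborel e (\<lambda>t. norm (u' t))" by (simp add: ip_def en)
      also have "\<dots> \<le> sqrt (nsq lborel e) * sqrt (nsq lborel (\<lambda>t. norm (u' t)))"
        using ip_Cauchy_Schwarz[OF e n] by simp
      also have "nsq lborel e = T"
      proof -
        have "nsq lborel e = (\<integral>t. indicator {0<..<T} t \<partial>lborel)"
          unfolding ip_def e_def by (intro Bochner_Integration.integral_cong) (auto simp: indicator_def)
        then show ?thesis using T by simp
      qed
      also have "nsq lborel (\<lambda>t. norm (u' t)) = (\<integral>t. (norm (u t))\<^sup>2 \<partial>lebesgue_on ?A)"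
      proof -
        have "(\<integral>t. u t \<bullet> u t \<partial>lebesgue_on ?A) = nsq lborel u'" by (rule borel_version_inner[OF A u' u'])
        then show ?thesis by (simp add: ip_self power2_norm_eq_inner[symmetric])
      qed
      finally show ?thesis .
    qed
  qed
qed

text \<open>\<open>qramp q t\<close> depends only on \<open>q - t\<close>, so moving
  \<open>t\<close> by \<open>h\<close> is the same as moving \<open>q\<close> by
  \<open>- h\<close>.\<close>

lemma qramp_has_derivative: "((\<lambda>t. qramp q t) has_real_derivative - ramp q t) (at t)"
proof (rule DERIV_quadratic_remainder[where C = 1])
  fix h :: real
  have "qramp q (t + h) = qramp (q + - h) t" by (simp add: qramp_def algebra_simps)
  then show "\<bar>qramp q (t + h) - qramp q t - h * - ramp q t\<bar> \<le> 1 * h\<^sup>2"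
    using qramp_remainder[of q "- h" t] zero_le_power2[of h] unfolding power2_minus by linarith
qed

lemma continuous_ramp: "continuous_on A (ramp q)"
  unfolding ramp_def[abs_def] by (intro continuous_intros)

lemma borel_version_fst_snd:
  fixes f :: "'a::euclidean_space \<Rightarrow> 'b::euclidean_space \<times> 'c::euclidean_space"
  assumes "borel_version A f f'" "A \<in> sets borel"
  shows "borel_version A (\<lambda>x. fst (f x)) (\<lambda>x. fst (f' x))" "borel_version A (\<lambda>x. snd (f x)) (\<lambda>x. snd (f' x))"
  by (rule borel_version_apply[OF assms(2,1)]; auto intro!: borel_measurable_continuous_onI continuous_intros)+

text \<open>The representatives are chosen on the whole space-time cylinder. That their slices
  represent \<open>y t\<close> and \<open>G t\<close> is Fubini applied to the exceptional null set,
  hence true for almost every \<open>t\<close>, which suffices under the time integrals.\<close>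

lemma heat_weak_sol_imp_wsol:
  fixes \<Omega> :: "'d::euclidean_space set" and \<psi> :: "'n::finite \<Rightarrow> (('d \<Rightarrow> real) \<Rightarrow> real)"
  assumes sol: "heat_weak_sol \<Omega> T \<psi> y0 u y" and \<Omega>: "open \<Omega>" and T: "0 < T" and u: "L2_on {0<..<T} u"
  obtains F where "wsol \<Omega> T \<psi> u (\<lambda>v. \<integral>x. y0 x * v x \<partial>lebesgue_on \<Omega>) F"
    "borel_version ({0<..<T} \<times> \<Omega>) (\<lambda>(t, x). y t x) (\<lambda>p. fst (F p))"
proof -
  let ?I = "{0<..<T}" and ?Q = "{0<..<T} \<times> \<Omega>"
  have B: "\<Omega> \<in> sets borel" "?Q \<in> sets borel" "?I \<in> sets borel"
    using \<Omega> by (auto intro!: borel_open open_Times)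
  have T': "0 \<le> T" using T by simp
  obtain G where G: "L2_on ?Q (\<lambda>(t,x). y t x)" "L2_on ?Q (\<lambda>(t,x). G t x)"
    "AE t in lebesgue_on ?I. H10 \<Omega> (y t) (G t)"
    and weak: "\<And>v Gv \<phi> \<phi>'. H10 \<Omega> v Gv \<Longrightarrow> (\<forall>t. (\<phi> has_real_derivative \<phi>' t) (at t)) \<Longrightarrow>
          continuous_on UNIV \<phi>' \<Longrightarrow> \<phi> T = 0 \<Longrightarrow>
          - (\<integral>t. \<phi>' t * (\<integral>x. y t x * v x \<partial>lebesgue_on \<Omega>) \<partial>lebesgue_on ?I)
          + (\<integral>t. \<phi> t * (\<integral>x. G t x \<bullet> Gv x \<partial>lebesgue_on \<Omega>) \<partial>lebesgue_on ?I)
          = (\<integral>t. \<phi> t * (\<Sum>j\<in>UNIV. u t $ j * \<psi> j v) \<partial>lebesgue_on ?I)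
            + \<phi> 0 * (\<integral>x. y0 x * v x \<partial>lebesgue_on \<Omega>)"
    using sol unfolding heat_weak_sol_def by blast
  obtain Y' where Y': "borel_version ?Q (\<lambda>(t,x). y t x) Y'"
    using borel_version_exists[OF B(2)] G(1) by (auto simp: L2_on_def)
  obtain G' where G': "borel_version ?Q (\<lambda>(t,x). G t x) G'"
    using borel_version_exists[OF B(2)] G(2) by (auto simp: L2_on_def)
  define F where "F p = (Y' p, G' p)" for p
  have LY: "L2 lborel Y'" and LG: "L2 lborel G'"
    using G(1,2) borel_version_L2[OF B(2) Y'] borel_version_L2[OF B(2) G'] by auto
  have off: "F p = 0" if "p \<notin> ?Q" for p
  proof -
    have "Y' p = 0" "G' p = 0" using Y' G' that unfolding borel_version_def by blast+
    then show ?thesis by (simp add: F_def zero_prod_def)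
  qed
  have slab: "slab_L2 T F"
    unfolding slab_L2_def using L2_Pair[OF LY LG] off by (auto simp: F_def[abs_def])
  have slY: "slab_L2 T (\<lambda>p. fst (F p))" and slG: "slab_L2 T (\<lambda>p. snd (F p))"
    using slab_L2_fst[OF slab] slab_L2_snd[OF slab] by auto
  have bvt: "AE t in lborel. t \<in> ?I \<longrightarrow> borel_version \<Omega> (\<lambda>x. (y t x, G t x)) (\<lambda>x. F (t, x))"
  proof -
    have "AE p in lborel. p \<in> ?Q \<longrightarrow> F p = (case p of (t, x) \<Rightarrow> (y t x, G t x))"
      using Y' G' unfolding borel_version_def F_def by auto
    then have "AE p in lborel \<Otimes>\<^sub>M lborel. p \<in> ?Q \<longrightarrow> F p = (case p of (t, x) \<Rightarrow> (y t x, G t x))"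
      unfolding lborel_prod .
    from lborel_pair.AE_pair[OF this] show ?thesis
    proof eventually_elim
      case (elim t)
      have "(\<lambda>x. F (t, x)) \<in> borel_measurable lborel"
        using measurable_compose_Pair1[OF _ slab_L2_measurable(2)[OF slab], of t] by simp
      then show ?case using elim off by (auto simp: borel_version_def)
    qed
  qed
  have H10t: "AE t in lborel. t \<in> ?I \<longrightarrow> H10 \<Omega> (y t) (G t)"
    using G(3) by (simp add: AE_restrict_space_iff AE_completion_iff)
  have main: "ip lborel (\<lambda>x. fst (f x)) (tint (ramp q) (\<lambda>p. fst (F p)))
      + ip lborel (\<lambda>x. snd (f x)) (tint (qramp q) (\<lambda>p. snd (F p)))
      = (\<Sum>j\<in>UNIV. (\<integral>t. qramp q t * (u t $ j) \<partial>lebesgue_on ?I) * \<psi> j v)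
        + qramp q 0 * (\<integral>x. y0 x * v x \<partial>lebesgue_on \<Omega>)"
    if v: "H10 \<Omega> v Gv" and f: "borel_version \<Omega> (\<lambda>x. (v x, Gv x)) f" and q: "q \<in> {0..T}" for v Gv f q
  proof -
    note f1 = borel_version_fst_snd(1)[OF f B(1), simplified] and f2 = borel_version_fst_snd(2)[OF f B(1), simplified]
    have Lf: "L2 lborel (\<lambda>x. fst (f x))" "L2 lborel (\<lambda>x. snd (f x))"
      using borel_version_L2[OF B(1) f1] borel_version_L2[OF B(1) f2] v by (auto simp: H10_def)
    have ramp_b: "\<bar>ramp q t\<bar> \<le> \<bar>q\<bar>" if "t \<in> {0<..<T}" for t using that by (intro ramp_bound) auto
    have qramp_b: "\<bar>qramp q t\<bar> \<le> q\<^sup>2 / 2" if "t \<in> {0<..<T}" for t using that by (intro qramp_bound) auto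
    note t1 = tint_ip[OF slY T' ramp_measurable ramp_b abs_ge_zero Lf(1)]
    have q2: "0 \<le> q\<^sup>2 / 2" by simp
    note t2 = tint_ip[OF slG T' qramp_measurable qramp_b q2 Lf(2)]
    have i1: "(\<integral>t. ramp q t * (\<integral>x. y t x * v x \<partial>lebesgue_on \<Omega>) \<partial>lebesgue_on ?I)
      = (\<integral>t. ramp q t * ip lborel (\<lambda>x. fst (F (t, x))) (\<lambda>x. fst (f x)) \<partial>lborel)"
    proof (rule lebesgue_on_transfer(3)[OF B(3)])
      show "(\<lambda>t. ramp q t * ip lborel (\<lambda>x. fst (F (t, x))) (\<lambda>x. fst (f x))) \<in> borel_measurable borel"
        using borel_measurable_integrable[OF t1(1)] by simp
      show "ramp q t * ip lborel (\<lambda>x. fst (F (t, x))) (\<lambda>x. fst (f x)) = 0" if "t \<notin> ?I" for t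
      proof -
        have "F (t, x) = 0" for x using off that by auto
        then show ?thesis by simp
      qed
      show "AE t in lborel. t \<in> ?I \<longrightarrow> ramp q t * ip lborel (\<lambda>x. fst (F (t, x))) (\<lambda>x. fst (f x))
         = ramp q t * (\<integral>x. y t x * v x \<partial>lebesgue_on \<Omega>)"
        using bvt
      proof eventually_elim
        case (elim t)
        show ?case
        proof
          assume "t \<in> ?I"
          then have "borel_version \<Omega> (y t) (\<lambda>x. fst (F (t, x)))"
            using borel_version_fst_snd(1)[OF _ B(1)] elim by fastforce
          from borel_version_inner[OF B(1) this f1]
          show "ramp q t * ip lborel (\<lambda>x. fst (F (t, x))) (\<lambda>x. fst (f x)) = ramp q t * (\<integral>x. y t x * v x \<partial>lebesgue_on \<Omega>)"
            by simp
        qed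
      qed
    qed
    have i2: "(\<integral>t. qramp q t * (\<integral>x. G t x \<bullet> Gv x \<partial>lebesgue_on \<Omega>) \<partial>lebesgue_on ?I)
      = (\<integral>t. qramp q t * ip lborel (\<lambda>x. snd (F (t, x))) (\<lambda>x. snd (f x)) \<partial>lborel)"
    proof (rule lebesgue_on_transfer(3)[OF B(3)])
      show "(\<lambda>t. qramp q t * ip lborel (\<lambda>x. snd (F (t, x))) (\<lambda>x. snd (f x))) \<in> borel_measurable borel"
        using borel_measurable_integrable[OF t2(1)] by simp
      show "qramp q t * ip lborel (\<lambda>x. snd (F (t, x))) (\<lambda>x. snd (f x)) = 0" if "t \<notin> ?I" for t
      proof -
        have "F (t, x) = 0" for x using off that by auto
        then show ?thesis by simp
      qed
      show "AE t in lborel. t \<in> ?I \<longrightarrow> qramp q t * ip lborel (\<lambda>x. snd (F (t, x))) (\<lambda>x. snd (f x))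
         = qramp q t * (\<integral>x. G t x \<bullet> Gv x \<partial>lebesgue_on \<Omega>)"
        using bvt
      proof eventually_elim
        case (elim t)
        show ?case
        proof
          assume "t \<in> ?I"
          then have "borel_version \<Omega> (G t) (\<lambda>x. snd (F (t, x)))"
            using borel_version_fst_snd(2)[OF _ B(1)] elim by fastforce
          from borel_version_inner[OF B(1) this f2]
          show "qramp q t * ip lborel (\<lambda>x. snd (F (t, x))) (\<lambda>x. snd (f x)) = qramp q t * (\<integral>x. G t x \<bullet> Gv x \<partial>lebesgue_on \<Omega>)"
            by simp
        qed
      qed
    qed
    obtain g where gi: "\<And>c j K. c \<in> borel_measurable borel \<Longrightarrow> (\<And>t. t \<in> {0<..<T} \<Longrightarrow> \<bar>c t\<bar> \<le> K) \<Longrightarrow>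
       integrable (lebesgue_on {0<..<T}) (\<lambda>t. c t * (u t $ j))"
      by (rule L2_on_control[OF u T']) blast
    have i3: "(\<integral>t. qramp q t * (\<Sum>j\<in>UNIV. u t $ j * \<psi> j v) \<partial>lebesgue_on ?I)
       = (\<Sum>j\<in>UNIV. (\<integral>t. qramp q t * (u t $ j) \<partial>lebesgue_on ?I) * \<psi> j v)"
    proof -
      have "(\<integral>t. qramp q t * (\<Sum>j\<in>UNIV. u t $ j * \<psi> j v) \<partial>lebesgue_on ?I)
        = (\<integral>t. (\<Sum>j\<in>UNIV. (qramp q t * (u t $ j)) * \<psi> j v) \<partial>lebesgue_on ?I)"
        by (simp add: sum_distrib_left mult.assoc)
      also have "\<dots> = (\<Sum>j\<in>UNIV. (\<integral>t. qramp q t * (u t $ j) \<partial>lebesgue_on ?I) * \<psi> j v)"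
        using gi[OF qramp_measurable qramp_b] by simp
      finally show ?thesis .
    qed
    \<comment> \<open>Here the restriction of \<open>q\<close> to \<open>{0..T}\<close> in
      \<open>wsol\<close> originates: for \<open>q \<le> T\<close> the spline vanishes at
      \<open>T\<close> and is an admissible test function.\<close>
    have "qramp q T = 0" using q by (simp add: qramp_def)
    moreover have "continuous_on UNIV (\<lambda>t. - ramp q t)" by (intro continuous_on_minus continuous_ramp)
    ultimately have "- (\<integral>t. - ramp q t * (\<integral>x. y t x * v x \<partial>lebesgue_on \<Omega>) \<partial>lebesgue_on ?I)
          + (\<integral>t. qramp q t * (\<integral>x. G t x \<bullet> Gv x \<partial>lebesgue_on \<Omega>) \<partial>lebesgue_on ?I)
          = (\<integral>t. qramp q t * (\<Sum>j\<in>UNIV. u t $ j * \<psi> j v) \<partial>lebesgue_on ?I)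
            + qramp q 0 * (\<integral>x. y0 x * v x \<partial>lebesgue_on \<Omega>)"
      by (intro weak[OF v] allI qramp_has_derivative)
    then show ?thesis
      using t1(2) t2(2) by (simp add: i1 i2 i3 ip_commute[of lborel "\<lambda>x. fst (f x)"] ip_commute[of lborel "\<lambda>x. snd (f x)"])
  qed
  have "wsol \<Omega> T \<psi> u (\<lambda>v. \<integral>x. y0 x * v x \<partial>lebesgue_on \<Omega>) F"
    unfolding wsol_def
  proof (intro conjI allI impI ballI)
    show "slab_L2 T F" by (rule slab)
    show "F (t, x) = 0" if "x \<notin> \<Omega>" for t x using off that by simp
    show "AE t in lborel. t \<in> ?I \<longrightarrow> (\<exists>v Gv. H10 \<Omega> v Gv \<and> borel_version \<Omega> (\<lambda>x. (v x, Gv x)) (\<lambda>x. F (t, x)))"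
      using bvt H10t by eventually_elim blast
  qed (rule main)
  moreover have "borel_version ?Q (\<lambda>(t, x). y t x) (\<lambda>p. fst (F p))" using Y' by (simp add: F_def)
  ultimately show ?thesis by (rule that)
qed

text \<open>The initial functionals combine linearly too. In a difference of two solutions with the
  same \<open>y0\<close> they cancel, which is the case treated by
  \<open>wsol_limit_zero\<close>.\<close>

lemma wsol_lincomb:
  fixes \<Omega> :: "'d::euclidean_space set" and \<psi> :: "'n::finite \<Rightarrow> (('d \<Rightarrow> real) \<Rightarrow> real)"
  assumes F: "wsol \<Omega> T \<psi> u m F" and G: "wsol \<Omega> T \<psi> w m' G" and \<Omega>: "open \<Omega>" and T: "0 < T"
    and u: "L2_on {0<..<T} u" and w: "L2_on {0<..<T} w"
  shows "wsol \<Omega> T \<psi> (\<lambda>t. a *\<^sub>R u t + b *\<^sub>R w t) (\<lambda>v. a * m v + b * m' v) (\<lambda>p. a *\<^sub>R F p + b *\<^sub>R G p)"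
  unfolding wsol_def
proof (intro conjI allI impI ballI)
  have B: "\<Omega> \<in> sets borel" using \<Omega> by simp
  have T': "0 \<le> T" using T by simp
  have sF: "slab_L2 T F" and sG: "slab_L2 T G" using F G by (auto simp: wsol_def)
  show "slab_L2 T (\<lambda>p. a *\<^sub>R F p + b *\<^sub>R G p)" by (rule slab_L2_combine[OF sF sG])
  show "a *\<^sub>R F (t, x) + b *\<^sub>R G (t, x) = 0" if "x \<notin> \<Omega>" for t x using F G that by (simp add: wsol_def)
  have "AE t in lborel. t \<in> {0<..<T} \<longrightarrow> (\<exists>v Gv. H10 \<Omega> v Gv \<and> borel_version \<Omega> (\<lambda>x. (v x, Gv x)) (\<lambda>x. F (t, x)))"
    "AE t in lborel. t \<in> {0<..<T} \<longrightarrow> (\<exists>v Gv. H10 \<Omega> v Gv \<and> borel_version \<Omega> (\<lambda>x. (v x, Gv x)) (\<lambda>x. G (t, x)))"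
    using F G by (auto simp: wsol_def)
  then show "AE t in lborel. t \<in> {0<..<T} \<longrightarrow>
     (\<exists>v Gv. H10 \<Omega> v Gv \<and> borel_version \<Omega> (\<lambda>x. (v x, Gv x)) (\<lambda>x. a *\<^sub>R F (t, x) + b *\<^sub>R G (t, x)))"
  proof eventually_elim
    case (elim t)
    show ?case
    proof
      assume t: "t \<in> {0<..<T}"
      obtain v Gv where v: "H10 \<Omega> v Gv" "borel_version \<Omega> (\<lambda>x. (v x, Gv x)) (\<lambda>x. F (t, x))" using elim(1) t by blast
      obtain z Gz where z: "H10 \<Omega> z Gz" "borel_version \<Omega> (\<lambda>x. (z x, Gz x)) (\<lambda>x. G (t, x))" using elim(2) t by blast
      have "borel_version \<Omega> (\<lambda>x. (a * v x + b * z x, a *\<^sub>R Gv x + b *\<^sub>R Gz x)) (\<lambda>x. a *\<^sub>R F (t, x) + b *\<^sub>R G (t, x))"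
      proof -
        have "AE x in lborel. x \<in> \<Omega> \<longrightarrow> F (t, x) = (v x, Gv x)" "AE x in lborel. x \<in> \<Omega> \<longrightarrow> G (t, x) = (z x, Gz x)"
          using v(2) z(2) by (auto simp: borel_version_def)
        then have "AE x in lborel. x \<in> \<Omega> \<longrightarrow>
           a *\<^sub>R F (t, x) + b *\<^sub>R G (t, x) = (a * v x + b * z x, a *\<^sub>R Gv x + b *\<^sub>R Gz x)"
          by eventually_elim auto
        then show ?thesis using v(2) z(2) by (auto simp: borel_version_def)
      qed
      then show "\<exists>v Gv. H10 \<Omega> v Gv \<and> borel_version \<Omega> (\<lambda>x. (v x, Gv x)) (\<lambda>x. a *\<^sub>R F (t, x) + b *\<^sub>R G (t, x))"
        using H10_lincomb[OF v(1) z(1), of a b] by blast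
    qed
  qed
  fix v Gv f q assume v: "H10 \<Omega> v Gv" and f: "borel_version \<Omega> (\<lambda>x. (v x, Gv x)) f" and q: "q \<in> {0..T}"
  note f1 = borel_version_fst_snd(1)[OF f B, simplified] and f2 = borel_version_fst_snd(2)[OF f B, simplified]
  have Lf: "L2 lborel (\<lambda>x. fst (f x))" "L2 lborel (\<lambda>x. snd (f x))"
    using borel_version_L2[OF B f1] borel_version_L2[OF B f2] v by (auto simp: H10_def)
  have ramp_b: "\<bar>ramp q t\<bar> \<le> \<bar>q\<bar>" if "t \<in> {0<..<T}" for t using that by (intro ramp_bound) auto
  have qramp_b: "\<bar>qramp q t\<bar> \<le> q\<^sup>2 / 2" if "t \<in> {0<..<T}" for t using that by (intro qramp_bound) auto
  have q2: "0 \<le> q\<^sup>2 / 2" by simp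
  have gu: "integrable (lebesgue_on {0<..<T}) (\<lambda>t. qramp q t * (u t $ j))" for j
    by (rule L2_on_control[OF u T']) (use qramp_b qramp_measurable in blast)
  have gw: "integrable (lebesgue_on {0<..<T}) (\<lambda>t. qramp q t * (w t $ j))" for j
    by (rule L2_on_control[OF w T']) (use qramp_b qramp_measurable in blast)
  have eF: "ip lborel (\<lambda>x. fst (f x)) (tint (ramp q) (\<lambda>p. fst (F p)))
      + ip lborel (\<lambda>x. snd (f x)) (tint (qramp q) (\<lambda>p. snd (F p)))
      = (\<Sum>j\<in>UNIV. (\<integral>t. qramp q t * (u t $ j) \<partial>lebesgue_on {0<..<T}) * \<psi> j v) + qramp q 0 * m v"
    using F v f q unfolding wsol_def by blast
  have eG: "ip lborel (\<lambda>x. fst (f x)) (tint (ramp q) (\<lambda>p. fst (G p)))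
      + ip lborel (\<lambda>x. snd (f x)) (tint (qramp q) (\<lambda>p. snd (G p)))
      = (\<Sum>j\<in>UNIV. (\<integral>t. qramp q t * (w t $ j) \<partial>lebesgue_on {0<..<T}) * \<psi> j v) + qramp q 0 * m' v"
    using G v f q unfolding wsol_def by blast
  have U: "(\<integral>t. qramp q t * ((a *\<^sub>R u t + b *\<^sub>R w t) $ j) \<partial>lebesgue_on {0<..<T})
     = a * (\<integral>t. qramp q t * (u t $ j) \<partial>lebesgue_on {0<..<T}) + b * (\<integral>t. qramp q t * (w t $ j) \<partial>lebesgue_on {0<..<T})" for j
  proof -
    have "(\<lambda>t. qramp q t * ((a *\<^sub>R u t + b *\<^sub>R w t) $ j)) = (\<lambda>t. a * (qramp q t * (u t $ j)) + b * (qramp q t * (w t $ j)))"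
      by (auto simp: algebra_simps)
    then show ?thesis using gu gw by simp
  qed
  have "ip lborel (\<lambda>x. fst (f x)) (tint (ramp q) (\<lambda>p. fst (a *\<^sub>R F p + b *\<^sub>R G p)))
     = a * ip lborel (\<lambda>x. fst (f x)) (tint (ramp q) (\<lambda>p. fst (F p))) + b * ip lborel (\<lambda>x. fst (f x)) (tint (ramp q) (\<lambda>p. fst (G p)))"
    using ip_tint_lincomb_fun[OF slab_L2_fst[OF sF] slab_L2_fst[OF sG] T' Lf(1) ramp_measurable ramp_b abs_ge_zero] by simp
  moreover have "ip lborel (\<lambda>x. snd (f x)) (tint (qramp q) (\<lambda>p. snd (a *\<^sub>R F p + b *\<^sub>R G p)))
     = a * ip lborel (\<lambda>x. snd (f x)) (tint (qramp q) (\<lambda>p. snd (F p))) + b * ip lborel (\<lambda>x. snd (f x)) (tint (qramp q) (\<lambda>p. snd (G p)))"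
    using ip_tint_lincomb_fun[OF slab_L2_snd[OF sF] slab_L2_snd[OF sG] T' Lf(2) qramp_measurable qramp_b q2] by simp
  ultimately have "ip lborel (\<lambda>x. fst (f x)) (tint (ramp q) (\<lambda>p. fst (a *\<^sub>R F p + b *\<^sub>R G p)))
      + ip lborel (\<lambda>x. snd (f x)) (tint (qramp q) (\<lambda>p. snd (a *\<^sub>R F p + b *\<^sub>R G p)))
    = a * ((\<Sum>j\<in>UNIV. (\<integral>t. qramp q t * (u t $ j) \<partial>lebesgue_on {0<..<T}) * \<psi> j v) + qramp q 0 * m v)
    + b * ((\<Sum>j\<in>UNIV. (\<integral>t. qramp q t * (w t $ j) \<partial>lebesgue_on {0<..<T}) * \<psi> j v) + qramp q 0 * m' v)"
    unfolding eF[symmetric] eG[symmetric] by (simp add: algebra_simps)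
  also have "\<dots> = (\<Sum>j\<in>UNIV. (\<integral>t. qramp q t * ((a *\<^sub>R u t + b *\<^sub>R w t) $ j) \<partial>lebesgue_on {0<..<T}) * \<psi> j v)
      + qramp q 0 * (a * m v + b * m' v)"
    unfolding U by (simp add: sum.distrib sum_distrib_left algebra_simps)
  finally show "ip lborel (\<lambda>x. fst (f x)) (tint (ramp q) (\<lambda>p. fst (a *\<^sub>R F p + b *\<^sub>R G p)))
      + ip lborel (\<lambda>x. snd (f x)) (tint (qramp q) (\<lambda>p. snd (a *\<^sub>R F p + b *\<^sub>R G p)))
    = (\<Sum>j\<in>UNIV. (\<integral>t. qramp q t * ((a *\<^sub>R u t + b *\<^sub>R w t) $ j) \<partial>lebesgue_on {0<..<T}) * \<psi> j v)
      + qramp q 0 * (a * m v + b * m' v)" .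
qed

text \<open>\<open>H1_norm\<close> is the \<open>L2\<close> norm of the pair \<open>(v, Gv)\<close>,
  so \<open>\<psi>\<close> acts as a bounded functional on a space of pairs. The representer is a
  pair as well: this is the familiar form of an element of the dual space as a function minus the
  divergence of a field.\<close>

lemma Hm1_Riesz:
  fixes \<Omega> :: "'d::euclidean_space set"
  assumes psi: "Hm1 \<Omega> \<psi>" and \<Omega>: "open \<Omega>"
  obtains r where "L2 lborel r"
    "\<And>v Gv f. H10 \<Omega> v Gv \<Longrightarrow> borel_version \<Omega> (\<lambda>x. (v x, Gv x)) f \<Longrightarrow> \<psi> v = ip lborel f r"
proof -
  let ?M = "lebesgue_on \<Omega>"
  have B: "\<Omega> \<in> sets borel" using \<Omega> by simp
  define V where "V = {f. \<exists>v Gv. H10 \<Omega> v Gv \<and> f = (\<lambda>x. (v x, Gv x))}"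
  obtain C where C: "\<And>v G. H10 \<Omega> v G \<Longrightarrow> \<bar>\<psi> v\<bar> \<le> C * H1_norm \<Omega> v G"
    using psi unfolding Hm1_def by blast
  have lin: "\<psi> (\<lambda>x. v x + w x) = \<psi> v + \<psi> w" "\<psi> (\<lambda>x. c * v x) = c * \<psi> v"
    if "H10 \<Omega> v Gv" "H10 \<Omega> w Gw" for v w Gv Gw c
    using psi that unfolding Hm1_def by blast+
  have L: "L2 ?M v" "L2 ?M Gv" if "H10 \<Omega> v Gv" for v Gv
    using that by (auto simp: H10_def L2_on_iff_L2)
  have VL: "L2 ?M f" if "f \<in> V" for f using that L by (auto simp: V_def intro: L2_Pair)
  obtain r0 where r0: "L2 ?M r0" "\<And>f. f \<in> V \<Longrightarrow> \<psi> (\<lambda>x. fst (f x)) = ip ?M r0 f"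
  proof (rule L2_Riesz[where V = V and \<psi> = "\<lambda>f. \<psi> (\<lambda>x. fst (f x))" and M = ?M and C = C])
    show "L2 ?M f" if "f \<in> V" for f using VL[OF that] .
    show "(\<lambda>x. f x + g x) \<in> V" if f: "f \<in> V" and g: "g \<in> V" for f g
    proof -
      obtain v Gv w Gw where "H10 \<Omega> v Gv" "f = (\<lambda>x. (v x, Gv x))" "H10 \<Omega> w Gw" "g = (\<lambda>x. (w x, Gw x))"
        using f g by (auto simp: V_def)
      then show ?thesis using H10_lincomb[of \<Omega> v Gv w Gw 1 1] by (auto simp: V_def)
    qed
    show "(\<lambda>x. c *\<^sub>R f x) \<in> V" if f: "f \<in> V" for f c
    proof -
      obtain v Gv where "H10 \<Omega> v Gv" "f = (\<lambda>x. (v x, Gv x))" using f by (auto simp: V_def)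
      then show ?thesis using H10_lincomb[of \<Omega> v Gv v Gv c 0] by (auto simp: V_def)
    qed
    show "\<psi> (\<lambda>x. fst (f x + g x)) = \<psi> (\<lambda>x. fst (f x)) + \<psi> (\<lambda>x. fst (g x))" if f: "f \<in> V" and g: "g \<in> V" for f g
      using f g lin(1) by (auto simp: V_def)
    show "\<psi> (\<lambda>x. fst (c *\<^sub>R f x)) = c * \<psi> (\<lambda>x. fst (f x))" if f: "f \<in> V" for f c
      using f lin(2) by (auto simp: V_def)
    show "\<bar>\<psi> (\<lambda>x. fst (f x))\<bar> \<le> C * sqrt (nsq ?M f)" if f: "f \<in> V" for f
    proof -
      obtain v Gv where v: "H10 \<Omega> v Gv" "f = (\<lambda>x. (v x, Gv x))" using f by (auto simp: V_def)
      have "nsq ?M f = nsq ?M v + nsq ?M Gv" unfolding v(2) by (rule ip_Pair; intro L[OF v(1)])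
      then have "H1_norm \<Omega> v Gv = sqrt (nsq ?M f)" by (simp add: H1_norm_def ip_self)
      then show ?thesis using C[OF v(1)] v(2) by simp
    qed
  qed blast
  obtain r where r: "borel_version \<Omega> r0 r"
    using borel_version_exists[OF B] r0(1) by (auto simp: L2_def)
  show ?thesis
  proof (rule that)
    show "L2 lborel r" using borel_version_L2[OF B r] r0(1) by (simp add: L2_on_iff_L2)
    show "\<psi> v = ip lborel f r" if v: "H10 \<Omega> v Gv" and f: "borel_version \<Omega> (\<lambda>x. (v x, Gv x)) f" for v Gv f
    proof -
      have "\<psi> v = ip ?M r0 (\<lambda>x. (v x, Gv x))" using r0(2)[of "\<lambda>x. (v x, Gv x)"] v by (auto simp: V_def)
      also have "\<dots> = ip lborel r f" unfolding ip_def[of ?M] by (rule borel_version_inner[OF B r f])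
      finally show ?thesis by (simp add: ip_commute)
    qed
  qed
qed

text \<open>The common source of uniqueness and of closedness of the solution map. As the controls
  \<open>e k\<close> tend to zero, \<open>energy_bound\<close> sends the integrals of the squared
  norms of \<open>tint (ramp q)\<close> of the states to zero; these pass to the limit
  \<open>Y\<close>, where a continuous nonnegative function of \<open>q\<close> with zero integral
  vanishes.\<close>

lemma wsol_limit_zero:
  fixes \<Omega> :: "'d::euclidean_space set" and \<psi> :: "'n::finite \<Rightarrow> (('d \<Rightarrow> real) \<Rightarrow> real)"
    and e :: "nat \<Rightarrow> real \<Rightarrow> real^'n" and F :: "nat \<Rightarrow> real \<times> 'd \<Rightarrow> real \<times> 'd"
  assumes \<Omega>: "open \<Omega>" and T: "0 < T" and psi: "\<And>j. Hm1 \<Omega> (\<psi> j)"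
    and e: "\<And>k. L2_on {0<..<T} (e k)"
    and elim: "(\<lambda>k. \<integral>t. (norm (e k t))\<^sup>2 \<partial>lebesgue_on {0<..<T}) \<longlonglongrightarrow> 0"
    and F: "\<And>k. wsol \<Omega> T \<psi> (e k) (\<lambda>v. 0) (F k)"
    and Y: "slab_L2 T Y"
    and YF: "(\<lambda>k. nsq lborel (\<lambda>p. fst (F k p) - Y p)) \<longlonglongrightarrow> 0"
  shows "AE p in lborel. Y p = 0"
proof -
  let ?I = "{0<..<T}"
  have B: "\<Omega> \<in> sets borel" using \<Omega> by simp
  have T': "0 \<le> T" using T by simp
  have "\<exists>r. L2 lborel r \<and> (\<forall>v Gv f. H10 \<Omega> v Gv \<longrightarrow> borel_version \<Omega> (\<lambda>x. (v x, Gv x)) f \<longrightarrow> \<psi> j v = ip lborel f r)" for j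
    by (rule Hm1_Riesz[OF psi \<Omega>, of j]) blast
  then obtain r where r: "\<And>j. L2 lborel (r j)"
    "\<And>j v Gv f. H10 \<Omega> v Gv \<Longrightarrow> borel_version \<Omega> (\<lambda>x. (v x, Gv x)) f \<Longrightarrow> \<psi> j v = ip lborel f (r j)"
    by metis
  define K where "K = ((1 + T) * (\<Sum>j\<in>UNIV. sqrt (nsq lborel (r j))))\<^sup>2 * (2 + exp T)"
  \<comment> \<open>A common bound for \<open>\<beta>\<close> and \<open>\<beta>'\<close>: the
    kernels \<open>qramp q\<close> and \<open>ramp q\<close> are at most
    \<open>T\<^sup>2 / 2\<close> and \<open>T\<close>, and the other factor bounds the
    \<open>L1\<close> norm of each component of \<open>e k\<close>.\<close>
  define b where "b k = (T\<^sup>2 / 2 + T) * (sqrt T * sqrt (\<integral>t. (norm (e k t))\<^sup>2 \<partial>lebesgue_on ?I))" for k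
  have slF: "slab_L2 T (F k)" for k using F[of k] by (simp add: wsol_def)
  define y where "y k = (\<lambda>p. fst (F k p))" for k
  have sly: "slab_L2 T (y k)" for k unfolding y_def by (rule slab_L2_fst[OF slF])
  define \<alpha> where "\<alpha> k q = nsq lborel (tint (ramp q) (y k))" for k q
  define a where "a q = nsq lborel (tint (ramp q) Y)" for q
  have bound: "integral {0..T} (\<alpha> k) \<le> K * (b k)\<^sup>2" for k
  proof -
    obtain g where g: "\<And>j. integrable lborel (g j)" "\<And>j t. t \<notin> ?I \<Longrightarrow> g j t = 0"
      "\<And>c j. c \<in> borel_measurable borel \<Longrightarrow> (\<integral>t. c t * (e k t $ j) \<partial>lebesgue_on ?I) = (\<integral>t. c t * g j t \<partial>lborel)"
      "\<And>j. (\<integral>t. \<bar>g j t\<bar> \<partial>lborel) \<le> sqrt T * sqrt (\<integral>t. (norm (e k t))\<^sup>2 \<partial>lebesgue_on ?I)"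
      by (rule L2_on_control[OF e T', of k]) blast
    define E where "E = sqrt T * sqrt (\<integral>t. (norm (e k t))\<^sup>2 \<partial>lebesgue_on ?I)"
    have E0: "0 \<le> E" using T' by (simp add: E_def)
    have cb: "\<bar>\<integral>t. c t * g j t \<partial>lborel\<bar> \<le> K' * E"
      if c: "c \<in> borel_measurable borel" "\<And>t. t \<in> ?I \<Longrightarrow> \<bar>c t\<bar> \<le> K'" and K': "0 \<le> K'" for c K' j
    proof -
      have le: "norm (c t * g j t) \<le> K' * \<bar>g j t\<bar>" for t
        using c(2)[of t] g(2)[of t j] by (cases "t \<in> ?I") (auto simp: abs_mult intro!: mult_right_mono)
      have "\<bar>\<integral>t. c t * g j t \<partial>lborel\<bar> \<le> (\<integral>t. norm (c t * g j t) \<partial>lborel)"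
        using integral_norm_bound[of lborel "\<lambda>t. c t * g j t"] by simp
      also have "\<dots> \<le> (\<integral>t. K' * \<bar>g j t\<bar> \<partial>lborel)"
      proof (rule integral_mono)
        show i: "integrable lborel (\<lambda>t. K' * \<bar>g j t\<bar>)" using g(1) by simp
        show "integrable lborel (\<lambda>t. norm (c t * g j t))"
        proof (intro integrable_norm Bochner_Integration.integrable_bound[OF i])
          show "(\<lambda>t. c t * g j t) \<in> borel_measurable lborel"
            using c(1) borel_measurable_integrable[OF g(1)[of j]] by simp
        qed (use le K' in auto)
      qed (rule le)
      also have "\<dots> \<le> K' * E" using mult_left_mono[OF g(4)[of j] K'] by (simp add: E_def)
      finally show ?thesis .
    qed
    define \<beta> where "\<beta> j q = (\<integral>t. qramp q t * g j t \<partial>lborel)" for j q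
    define \<beta>' where "\<beta>' j q = (\<integral>t. ramp q t * g j t \<partial>lborel)" for j q
    have beta_eq: "(\<integral>t. qramp q t * (e k t $ j) \<partial>lebesgue_on ?I) = \<beta> j q" for j q
      unfolding \<beta>_def by (rule g(3)) simp
    have b_eq: "b k = (T\<^sup>2 / 2 + T) * E" by (simp add: b_def E_def)
    have "integral {0..T} (\<lambda>q. nsq lborel (tint (ramp q) (\<lambda>p. fst (F k p))))
      \<le> ((1 + T) * (\<Sum>j\<in>UNIV. sqrt (nsq lborel (r j))))\<^sup>2 * (2 + exp T) * (b k)\<^sup>2"
    proof (rule energy_bound[OF slF T' r(1), where \<beta> = \<beta> and \<beta>' = \<beta>'])
      show "(\<beta> j has_real_derivative \<beta>' j q) (at q)" for j q
        unfolding \<beta>_def[abs_def] \<beta>'_def using g(2) by (intro DERIV_qramp_integral g(1)) auto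
      show "0 \<le> b k" unfolding b_eq using E0 T' by simp
      show "\<bar>\<beta> j q\<bar> \<le> b k" if q: "q \<in> {0..T}" for j q
      proof -
        have "\<bar>\<beta> j q\<bar> \<le> (T\<^sup>2 / 2) * E" unfolding \<beta>_def
        proof (rule cb)
          fix t assume "t \<in> ?I"
          then have "\<bar>qramp q t\<bar> \<le> q\<^sup>2 / 2" by (intro qramp_bound) auto
          also have "\<dots> \<le> T\<^sup>2 / 2" using q by (intro divide_right_mono power_mono) auto
          finally show "\<bar>qramp q t\<bar> \<le> T\<^sup>2 / 2" .
        qed auto
        also have "\<dots> \<le> b k" unfolding b_eq using T' E0 by (intro mult_right_mono) auto
        finally show ?thesis .
      qed
      show "\<bar>\<beta>' j q\<bar> \<le> b k" if q: "q \<in> {0..T}" for j q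
      proof -
        have "\<bar>\<beta>' j q\<bar> \<le> T * E" unfolding \<beta>'_def
        proof (rule cb)
          fix t assume "t \<in> ?I"
          then have "\<bar>ramp q t\<bar> \<le> \<bar>q\<bar>" by (intro ramp_bound) auto
          then show "\<bar>ramp q t\<bar> \<le> T" using q by simp
        qed (use T' in auto)
        also have "\<dots> \<le> b k" unfolding b_eq using T' E0 by (intro mult_right_mono) auto
        finally show ?thesis .
      qed
      have "AE s in lborel. s \<in> ?I \<longrightarrow> (\<exists>v Gv. H10 \<Omega> v Gv \<and> borel_version \<Omega> (\<lambda>x. (v x, Gv x)) (\<lambda>x. F k (s, x)))"
        using F[of k] by (simp add: wsol_def)
      then show "AE s in lborel. \<forall>q\<in>{0..T}.
          ip lborel (\<lambda>x. fst (F k (s, x))) (tint (ramp q) (\<lambda>p. fst (F k p)))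
        + ip lborel (\<lambda>x. snd (F k (s, x))) (tint (qramp q) (\<lambda>p. snd (F k p)))
        = (\<Sum>j\<in>UNIV. \<beta> j q * ip lborel (\<lambda>x. F k (s, x)) (r j))"
      proof eventually_elim
        case (elim s)
        show ?case
        proof (cases "s \<in> ?I")
          case True
          \<comment> \<open>For almost every \<open>s\<close> the slice of the solution lies in
            \<open>H10\<close> and may serve as the spatial test function in its own weak
            form.\<close>
          then obtain v Gv where v: "H10 \<Omega> v Gv" "borel_version \<Omega> (\<lambda>x. (v x, Gv x)) (\<lambda>x. F k (s, x))"
            using elim by blast
          have psi_eq: "\<psi> j v = ip lborel (\<lambda>x. F k (s, x)) (r j)" for j by (rule r(2)[OF v])
          show ?thesis
          proof
            fix q assume "q \<in> {0..T}"
            then show "ip lborel (\<lambda>x. fst (F k (s, x))) (tint (ramp q) (\<lambda>p. fst (F k p)))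
        + ip lborel (\<lambda>x. snd (F k (s, x))) (tint (qramp q) (\<lambda>p. snd (F k p)))
        = (\<Sum>j\<in>UNIV. \<beta> j q * ip lborel (\<lambda>x. F k (s, x)) (r j))"
              using F[of k] v unfolding wsol_def beta_eq psi_eq[symmetric] by fastforce
          qed
        next
          case False
          then have "F k (s, x) = 0" for x using slF[of k] by (simp add: slab_L2_def)
          then show ?thesis by simp
        qed
      qed
    qed
    then show ?thesis by (simp add: \<alpha>_def[abs_def] y_def K_def)
  qed
  have "(\<lambda>k. K * (b k)\<^sup>2) \<longlonglongrightarrow> K * ((T\<^sup>2 / 2 + T) * (sqrt T * sqrt 0))\<^sup>2"
    unfolding b_def by (intro tendsto_intros elim)
  then have Kb: "(\<lambda>k. K * (b k)\<^sup>2) \<longlonglongrightarrow> 0" by simp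
  define d where "d k = nsq lborel (\<lambda>p. y k p - Y p)" for k
  have d: "d \<longlonglongrightarrow> 0" using YF by (simp add: d_def[abs_def] y_def)
  have cont: "continuous_on {0..T} (\<alpha> k)" "continuous_on {0..T} a" for k
    using isCont_tint_ramp_sq[OF sly T'] isCont_tint_ramp_sq[OF Y T']
    by (auto simp: \<alpha>_def[abs_def] a_def[abs_def] intro: continuous_at_imp_continuous_on)
  have a_le: "a q \<le> 2 * \<alpha> k q + 2 * (T * T\<^sup>2 * d k)" if q: "q \<in> {0..T}" for q k
  proof -
    have ramp_b: "\<bar>ramp q t\<bar> \<le> \<bar>q\<bar>" if "t \<in> {0<..<T}" for t using that by (intro ramp_bound) auto
    have slD: "slab_L2 T (\<lambda>p. 1 *\<^sub>R y k p + (-1) *\<^sub>R Y p)" by (rule slab_L2_combine[OF sly Y])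
    then have slD: "slab_L2 T (\<lambda>p. y k p - Y p)" by simp
    note L = tint_ramp_L2(1)[OF sly T', of q k] tint_ramp_L2(1)[OF Y T', of q] tint_ramp_L2(1)[OF slD T', of q]
    have "a q = nsq lborel (\<lambda>x. tint (ramp q) (y k) x + (-1) *\<^sub>R tint (ramp q) (\<lambda>p. y k p - Y p) x)"
    proof -
      have ae: "AE x in lborel. tint (ramp q) Y x = tint (ramp q) (y k) x + (-1) *\<^sub>R tint (ramp q) (\<lambda>p. y k p - Y p) x"
      proof -
        have "AE x in lborel. tint (ramp q) (\<lambda>p. y k p - Y p) x = tint (ramp q) (y k) x - tint (ramp q) Y x"
          by (rule tint_diff_fun[OF sly Y T' ramp_measurable ramp_b abs_ge_zero])
        then show ?thesis by eventually_elim auto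
      qed
      show ?thesis unfolding a_def
        by (rule ip_cong_AE[OF ae ae]) (intro L2_add L2_scaleR L)+
    qed
    also have "\<dots> \<le> 2 * \<alpha> k q + 2 * nsq lborel (\<lambda>x. (-1) *\<^sub>R tint (ramp q) (\<lambda>p. y k p - Y p) x)"
      unfolding \<alpha>_def by (rule ip_add_self_le; intro L2_scaleR L)
    also have "\<dots> = 2 * \<alpha> k q + 2 * nsq lborel (tint (ramp q) (\<lambda>p. y k p - Y p))"
      by (simp only: ip_scaleR_left ip_scaleR_right)
    also have "\<dots> \<le> 2 * \<alpha> k q + 2 * (T * q\<^sup>2 * d k)"
      using tint_ramp_L2(2)[OF slD T', of q] by (simp add: d_def)
    also have "\<dots> \<le> 2 * \<alpha> k q + 2 * (T * T\<^sup>2 * d k)"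
      using q T' by (intro add_left_mono mult_left_mono mult_right_mono power_mono) (auto simp: d_def)
    finally show ?thesis .
  qed
  have "integral {0..T} a \<le> 2 * (K * (b k)\<^sup>2) + 2 * (T * T\<^sup>2 * d k) * T" for k
  proof -
    have "integral {0..T} a \<le> integral {0..T} (\<lambda>q. 2 * \<alpha> k q + 2 * (T * T\<^sup>2 * d k))"
      by (rule integral_le) (use a_le cont in \<open>auto intro!: integrable_continuous_real continuous_intros\<close>)
    also have "\<dots> = 2 * integral {0..T} (\<alpha> k) + 2 * (T * T\<^sup>2 * d k) * T"
      using T' cont(1)[of k]
      by (subst Henstock_Kurzweil_Integration.integral_add) (auto intro!: integrable_continuous_real continuous_intros)
    finally show ?thesis using bound[of k] by linarith
  qed
  moreover have "(\<lambda>k. 2 * (K * (b k)\<^sup>2) + 2 * (T * T\<^sup>2 * d k) * T) \<longlonglongrightarrow> 2 * 0 + 2 * (T * T\<^sup>2 * 0) * T"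
    by (intro tendsto_intros Kb d)
  ultimately have "integral {0..T} a \<le> 0"
    by (intro LIMSEQ_le_const[where X = "\<lambda>k. 2 * (K * (b k)\<^sup>2) + 2 * (T * T\<^sup>2 * d k) * T"]) auto
  moreover have "0 \<le> integral {0..T} a"
    using cont(2) by (intro Henstock_Kurzweil_Integration.integral_nonneg integrable_continuous_real) (auto simp: a_def)
  ultimately have "integral {0..T} a = 0" by simp
  then have "\<forall>q\<in>{0..T}. a q = 0"
    using integral_eq_0_iff[OF cont(2) T] by (auto simp: a_def)
  then show ?thesis
    by (intro slab_zero[OF Y T']) (auto simp: a_def)
qed

section \<open>The reduced objective\<close>

text \<open>The state at the midpoint minus the mean of the two states solves the problem with zero
  control and zero initial functional; \<open>wsol_limit_zero\<close> with constant sequences shows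
  that it vanishes. Thus the affinity of \<open>S\<close> is a form of uniqueness.\<close>

lemma S_midpoint:
  fixes \<Omega> :: "'d::euclidean_space set" and \<psi> :: "'n::finite \<Rightarrow> (('d \<Rightarrow> real) \<Rightarrow> real)"
    and S :: "(real \<Rightarrow> real^'n) \<Rightarrow> (real \<Rightarrow> 'd \<Rightarrow> real)"
  assumes \<Omega>: "open \<Omega>" and T: "0 < T" and psi: "\<And>j. Hm1 \<Omega> (\<psi> j)"
    and S: "\<And>v. L2_on {0<..<T} v \<Longrightarrow> heat_weak_sol \<Omega> T \<psi> y0 v (S v)"
    and v: "L2_on {0<..<T} v" and w: "L2_on {0<..<T} w"
  shows "AE p in lebesgue_on ({0<..<T} \<times> \<Omega>).
     S (\<lambda>t. (1/2) *\<^sub>R v t + (1/2) *\<^sub>R w t) (fst p) (snd p) = (S v (fst p) (snd p) + S w (fst p) (snd p)) / 2"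
proof -
  let ?I = "{0<..<T}" and ?Q = "{0<..<T} \<times> \<Omega>"
  have B: "?Q \<in> sets borel" using \<Omega> by (auto intro!: borel_open open_Times)
  let ?m = "\<lambda>t. (1/2) *\<^sub>R v t + (1/2) *\<^sub>R w t"
  have m: "L2_on ?I ?m" using v w by (auto simp: L2_on_iff_L2 intro!: L2_add L2_scaleR)
  let ?l = "\<lambda>v. \<integral>x. y0 x * v x \<partial>lebesgue_on \<Omega>"
  obtain Fv where Fv: "wsol \<Omega> T \<psi> v ?l Fv" "borel_version ?Q (\<lambda>(t, x). S v t x) (\<lambda>p. fst (Fv p))"
    by (rule heat_weak_sol_imp_wsol[OF S[OF v] \<Omega> T v])
  obtain Fw where Fw: "wsol \<Omega> T \<psi> w ?l Fw" "borel_version ?Q (\<lambda>(t, x). S w t x) (\<lambda>p. fst (Fw p))"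
    by (rule heat_weak_sol_imp_wsol[OF S[OF w] \<Omega> T w])
  obtain Fm where Fm: "wsol \<Omega> T \<psi> ?m ?l Fm" "borel_version ?Q (\<lambda>(t, x). S ?m t x) (\<lambda>p. fst (Fm p))"
    by (rule heat_weak_sol_imp_wsol[OF S[OF m] \<Omega> T m])
  define D where "D p = 1 *\<^sub>R Fm p + (-1) *\<^sub>R ((1/2) *\<^sub>R Fv p + (1/2) *\<^sub>R Fw p)" for p
  have "wsol \<Omega> T \<psi> ?m (\<lambda>v. (1/2) * ?l v + (1/2) * ?l v) (\<lambda>p. (1/2) *\<^sub>R Fv p + (1/2) *\<^sub>R Fw p)"
    by (rule wsol_lincomb[OF Fv(1) Fw(1) \<Omega> T v w])
  from wsol_lincomb[OF Fm(1) this \<Omega> T m m, of 1 "-1"]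
  have D: "wsol \<Omega> T \<psi> (\<lambda>t. 0) (\<lambda>v. 0) D" by (simp add: D_def[abs_def])
  have "AE p in lborel. fst (D p) = 0"
  proof (rule wsol_limit_zero[OF \<Omega> T psi, where e = "\<lambda>k t. 0" and F = "\<lambda>k. D"])
    show "slab_L2 T (\<lambda>p. fst (D p))" using D by (auto simp: wsol_def intro: slab_L2_fst)
  qed (use D in \<open>auto simp: L2_on_iff_L2\<close>)
  moreover have "AE p in lborel. p \<in> ?Q \<longrightarrow> fst (Fv p) = S v (fst p) (snd p)"
    "AE p in lborel. p \<in> ?Q \<longrightarrow> fst (Fw p) = S w (fst p) (snd p)"
    "AE p in lborel. p \<in> ?Q \<longrightarrow> fst (Fm p) = S ?m (fst p) (snd p)"
    using Fv(2) Fw(2) Fm(2) by (auto simp: borel_version_def case_prod_beta)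
  ultimately have "AE p in lborel. p \<in> ?Q \<longrightarrow>
     S ?m (fst p) (snd p) = (S v (fst p) (snd p) + S w (fst p) (snd p)) / 2"
    by eventually_elim (auto simp: D_def field_simps)
  from AE_completion[OF this] show ?thesis
    using B by (subst AE_restrict_space_iff) auto
qed

text \<open>The limit \<open>y\<close> is a mere \<open>L2\<close> function without gradient and
  cannot be inserted into the weak form. The energy estimate is applied to the differences with the
  solution for \<open>v\<close>, whose controls tend to zero, and \<open>y\<close> enters only
  through the limit of their first components.\<close>

lemma S_closed:
  fixes \<Omega> :: "'d::euclidean_space set" and \<psi> :: "'n::finite \<Rightarrow> (('d \<Rightarrow> real) \<Rightarrow> real)"
    and S :: "(real \<Rightarrow> real^'n) \<Rightarrow> (real \<Rightarrow> 'd \<Rightarrow> real)"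
  assumes \<Omega>: "open \<Omega>" and T: "0 < T" and psi: "\<And>j. Hm1 \<Omega> (\<psi> j)"
    and S: "\<And>v. L2_on {0<..<T} v \<Longrightarrow> heat_weak_sol \<Omega> T \<psi> y0 v (S v)"
    and u: "\<And>k. L2_on {0<..<T} (u k)" and v: "L2_on {0<..<T} v"
    and uv: "(\<lambda>k. nsq (lebesgue_on {0<..<T}) (\<lambda>t. u k t - v t)) \<longlonglongrightarrow> 0"
    and y: "L2 (lebesgue_on ({0<..<T} \<times> \<Omega>)) y"
    and Suy: "(\<lambda>k. nsq (lebesgue_on ({0<..<T} \<times> \<Omega>)) (\<lambda>p. S (u k) (fst p) (snd p) - y p)) \<longlonglongrightarrow> 0"
  shows "AE p in lebesgue_on ({0<..<T} \<times> \<Omega>). y p = S v (fst p) (snd p)"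
proof -
  let ?I = "{0<..<T}" and ?Q = "{0<..<T} \<times> \<Omega>"
  have B: "?Q \<in> sets borel" using \<Omega> by (auto intro!: borel_open open_Times)
  let ?l = "\<lambda>v. \<integral>x. y0 x * v x \<partial>lebesgue_on \<Omega>"
  obtain Fv where Fv: "wsol \<Omega> T \<psi> v ?l Fv" "borel_version ?Q (\<lambda>(t, x). S v t x) (\<lambda>p. fst (Fv p))"
    by (rule heat_weak_sol_imp_wsol[OF S[OF v] \<Omega> T v])
  define W where "W k F \<longleftrightarrow> wsol \<Omega> T \<psi> (u k) ?l F \<and> borel_version ?Q (\<lambda>(t, x). S (u k) t x) (\<lambda>p. fst (F p))" for k F
  have "\<exists>F. W k F" for k
    unfolding W_def by (rule heat_weak_sol_imp_wsol[OF S[OF u] \<Omega> T u, of k]) blast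
  then obtain F where "\<And>k. W k (F k)" by metis
  then have F: "\<And>k. wsol \<Omega> T \<psi> (u k) ?l (F k)"
    "\<And>k. borel_version ?Q (\<lambda>(t, x). S (u k) t x) (\<lambda>p. fst (F k p))" by (auto simp only: W_def)
  obtain y' where y': "borel_version ?Q y y'" using borel_version_exists[OF B] y by (auto simp: L2_def)
  have Ly': "L2 lborel y'" using borel_version_L2[OF B y'] y by (simp add: L2_on_iff_L2)
  have sy': "slab_L2 T y'" using Ly' y' by (auto simp: slab_L2_def borel_version_def)
  have sFv: "slab_L2 T (\<lambda>p. fst (Fv p))" using Fv(1) by (auto simp: wsol_def intro: slab_L2_fst)
  define Y where "Y p = 1 *\<^sub>R y' p + (-1) *\<^sub>R fst (Fv p)" for p
  define D where "D k p = 1 *\<^sub>R F k p + (-1) *\<^sub>R Fv p" for k p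
  have D: "wsol \<Omega> T \<psi> (\<lambda>t. u k t - v t) (\<lambda>v. 0) (D k)" for k
    using wsol_lincomb[where a = 1 and b = "-1", OF F(1)[of k] Fv(1) \<Omega> T u v] by (simp add: D_def[abs_def])
  have "AE p in lborel. Y p = 0"
  proof (rule wsol_limit_zero[OF \<Omega> T psi _ _ D])
    show "L2_on ?I (\<lambda>t. u k t - v t)" for k using u v by (auto simp: L2_on_iff_L2)
    show "(\<lambda>k. \<integral>t. (norm (u k t - v t))\<^sup>2 \<partial>lebesgue_on ?I) \<longlonglongrightarrow> 0" using uv by (simp add: ip_self)
    show "slab_L2 T Y" unfolding Y_def by (rule slab_L2_combine[OF sy' sFv])
    have "nsq lborel (\<lambda>p. fst (D k p) - Y p)
      = nsq (lebesgue_on ?Q) (\<lambda>p. S (u k) (fst p) (snd p) - y p)" for k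
    proof -
      have bv: "borel_version ?Q (\<lambda>p. S (u k) (fst p) (snd p) - y p) (\<lambda>p. fst (F k p) - y' p)"
      proof -
        have "AE p in lborel. p \<in> ?Q \<longrightarrow> fst (F k p) = S (u k) (fst p) (snd p)" "AE p in lborel. p \<in> ?Q \<longrightarrow> y' p = y p"
          using F(2)[of k] y' by (auto simp: borel_version_def case_prod_beta)
        then have "AE p in lborel. p \<in> ?Q \<longrightarrow> fst (F k p) - y' p = S (u k) (fst p) (snd p) - y p"
          by eventually_elim auto
        then show ?thesis using F(2)[of k] y' by (auto simp: borel_version_def)
      qed
      have "(\<lambda>p. fst (D k p) - Y p) = (\<lambda>p. fst (F k p) - y' p)" by (auto simp: D_def Y_def)
      then show ?thesis using borel_version_inner[OF B bv bv] by (simp add: ip_def)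
    qed
    then show "(\<lambda>k. nsq lborel (\<lambda>p. fst (D k p) - Y p)) \<longlonglongrightarrow> 0" using Suy by simp
  qed
  moreover have "AE p in lborel. p \<in> ?Q \<longrightarrow> fst (Fv p) = S v (fst p) (snd p)"
    "AE p in lborel. p \<in> ?Q \<longrightarrow> y' p = y p"
    using Fv(2) y' by (auto simp: borel_version_def case_prod_beta)
  ultimately have "AE p in lborel. p \<in> ?Q \<longrightarrow> y p = S v (fst p) (snd p)"
    by eventually_elim (auto simp: Y_def)
  from AE_completion[OF this] show ?thesis
    using B by (subst AE_restrict_space_iff) auto
qed

lemma heat_weak_sol_L2:
  assumes "heat_weak_sol \<Omega> T \<psi> y0 u y"
  shows "L2 (lebesgue_on ({0<..<T} \<times> \<Omega>)) (\<lambda>p. y (fst p) (snd p))"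
  using assms unfolding heat_weak_sol_def L2_on_iff_L2 case_prod_beta' by blast

lemma L2_const_interval: "L2 (lebesgue_on {0<..<T::real}) (\<lambda>t. c)"
proof (cases "0 \<le> T")
  case True
  have "integrable (lebesgue_on {0<..<T}) (\<lambda>t. (norm c)\<^sup>2)"
    by (rule finite_measure.integrable_const) (auto intro!: finite_measure_lebesgue_on)
  then show ?thesis by (simp add: L2_def)
qed (auto simp: L2_def integrable_restrict_space)

lemma parallelogram_midpoint:
  assumes f: "L2 M f" and g: "L2 M g" and c: "L2 M c"
  shows "nsq M (\<lambda>x. ((1/2) *\<^sub>R f x + (1/2) *\<^sub>R g x) - c x)
    = (nsq M (\<lambda>x. f x - c x) + nsq M (\<lambda>x. g x - c x)) / 2
      - nsq M (\<lambda>x. f x - g x) / 4"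
proof -
  have fc: "L2 M (\<lambda>x. f x - c x)" and gc: "L2 M (\<lambda>x. g x - c x)" using assms by auto
  have e1: "((1/2) *\<^sub>R f x + (1/2) *\<^sub>R g x) - c x = (1/2) *\<^sub>R ((f x - c x) + (g x - c x))" for x
    by (simp add: algebra_simps flip: scaleR_2)
  have e2: "f x - g x = (f x - c x) - (g x - c x)" for x by simp
  show ?thesis
    unfolding e1 e2 ip_scaleR_left ip_scaleR_right ip_add_self[OF fc gc] ip_diff_self[OF fc gc] by (simp add: field_simps)
qed

text \<open>An exact identity because \<open>S\<close> is affine up to null sets. The deficit
  \<open>1/4\<close> of \<open>parallelogram_midpoint\<close>, weighted by \<open>1/2\<close> and
  \<open>\<alpha>/2\<close>, gives the constants \<open>1/8\<close> and
  \<open>\<alpha>/8\<close>.\<close>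

lemma obj_midpoint:
  fixes \<Omega> :: "'d::euclidean_space set" and \<psi> :: "'n::finite \<Rightarrow> (('d \<Rightarrow> real) \<Rightarrow> real)"
    and S :: "(real \<Rightarrow> real^'n) \<Rightarrow> (real \<Rightarrow> 'd \<Rightarrow> real)"
  assumes \<Omega>: "open \<Omega>" and T: "0 < T" and psi: "\<And>j. Hm1 \<Omega> (\<psi> j)"
    and S: "\<And>v. L2_on {0<..<T} v \<Longrightarrow> heat_weak_sol \<Omega> T \<psi> y0 v (S v)"
    and yd: "L2_on ({0<..<T} \<times> \<Omega>) (\<lambda>(t,x). yd t x)"
    and v: "L2_on {0<..<T} v" and w: "L2_on {0<..<T} w"
  shows "obj \<Omega> T \<alpha> S yd (\<lambda>t. (1/2) *\<^sub>R v t + (1/2) *\<^sub>R w t)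
    = (obj \<Omega> T \<alpha> S yd v + obj \<Omega> T \<alpha> S yd w) / 2
      - nsq (lebesgue_on ({0<..<T} \<times> \<Omega>)) (\<lambda>p. S v (fst p) (snd p) - S w (fst p) (snd p)) / 8
      - \<alpha> / 8 * nsq (lebesgue_on {0<..<T}) (\<lambda>t. v t - w t)"
proof -
  let ?M = "lebesgue_on {0<..<T}" and ?Q = "lebesgue_on ({0<..<T} \<times> \<Omega>)"
  let ?m = "\<lambda>t. (1/2) *\<^sub>R v t + (1/2) *\<^sub>R w t"
  have m: "L2_on {0<..<T} ?m" using v w by (auto simp: L2_on_iff_L2 intro!: L2_add L2_scaleR)
  have ob: "obj \<Omega> T \<alpha> S yd z = 1/2 * nsq ?Q (\<lambda>p. S z (fst p) (snd p) - yd (fst p) (snd p))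
     + \<alpha>/2 * nsq ?M (\<lambda>t. z t - (\<chi> j. 1/2))" for z
    by (simp add: obj_def ip_self)
  have yL: "L2 ?Q (\<lambda>p. yd (fst p) (snd p))" using yd by (simp add: L2_on_iff_L2 case_prod_beta')
  note Sv = heat_weak_sol_L2[OF S[OF v]] and Sw = heat_weak_sol_L2[OF S[OF w]] and Sm = heat_weak_sol_L2[OF S[OF m]]
  have mid: "AE p in ?Q. S ?m (fst p) (snd p) - yd (fst p) (snd p)
      = ((1/2) *\<^sub>R S v (fst p) (snd p) + (1/2) *\<^sub>R S w (fst p) (snd p)) - yd (fst p) (snd p)"
  proof -
    have "AE p in ?Q. S ?m (fst p) (snd p) = (S v (fst p) (snd p) + S w (fst p) (snd p)) / 2"
      by (rule S_midpoint[OF \<Omega> T psi S v w])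
    then show ?thesis by eventually_elim simp
  qed
  have "nsq ?Q (\<lambda>p. S ?m (fst p) (snd p) - yd (fst p) (snd p))
    = nsq ?Q (\<lambda>p. ((1/2) *\<^sub>R S v (fst p) (snd p) + (1/2) *\<^sub>R S w (fst p) (snd p)) - yd (fst p) (snd p))"
    by (rule ip_cong_AE[OF mid mid]) (intro L2_diff L2_add L2_scaleR Sv Sw Sm yL)+
  also note parallelogram_midpoint[OF Sv Sw yL]
  finally have 1: "nsq ?Q (\<lambda>p. S ?m (fst p) (snd p) - yd (fst p) (snd p))
    = (nsq ?Q (\<lambda>p. S v (fst p) (snd p) - yd (fst p) (snd p))
      + nsq ?Q (\<lambda>p. S w (fst p) (snd p) - yd (fst p) (snd p))) / 2
      - nsq ?Q (\<lambda>p. S v (fst p) (snd p) - S w (fst p) (snd p)) / 4" .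
  have 2: "nsq ?M (\<lambda>t. ?m t - (\<chi> j. 1/2))
    = (nsq ?M (\<lambda>t. v t - (\<chi> j. 1/2)) + nsq ?M (\<lambda>t. w t - (\<chi> j. 1/2))) / 2
      - nsq ?M (\<lambda>t. v t - w t) / 4"
    using v w by (intro parallelogram_midpoint L2_const_interval) (auto simp: L2_on_iff_L2)
  show ?thesis unfolding ob 1 2 by (simp add: field_simps)
qed

text \<open>The midpoint identity makes the controls and the states Cauchy sequences, so no weak compactness is needed.\<close>

lemma minimizing_sequence_converges:
  fixes \<Omega> :: "'d::euclidean_space set" and \<psi> :: "'n::finite \<Rightarrow> (('d \<Rightarrow> real) \<Rightarrow> real)"
    and S :: "(real \<Rightarrow> real^'n) \<Rightarrow> (real \<Rightarrow> 'd \<Rightarrow> real)" and u :: "nat \<Rightarrow> real \<Rightarrow> real^'n"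
  assumes \<Omega>: "open \<Omega>" and T: "0 < T" and psi: "\<And>j. Hm1 \<Omega> (\<psi> j)"
    and S: "\<And>v. L2_on {0<..<T} v \<Longrightarrow> heat_weak_sol \<Omega> T \<psi> y0 v (S v)"
    and yd: "L2_on ({0<..<T} \<times> \<Omega>) (\<lambda>(t,x). yd t x)" and alpha: "0 < \<alpha>"
    and u: "\<And>k. L2_on {0<..<T} (u k)"
    and mid: "\<And>k m. k \<le> m \<Longrightarrow> obj \<Omega> T \<alpha> S yd (u k) \<le> obj \<Omega> T \<alpha> S yd (\<lambda>t. (1/2) *\<^sub>R u k t + (1/2) *\<^sub>R u m t)"
    and bdd: "\<And>k. obj \<Omega> T \<alpha> S yd (u k) \<le> c"
  obtains ubar where "L2_on {0<..<T} ubar"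
    "(\<lambda>k. nsq (lebesgue_on {0<..<T}) (\<lambda>t. u k t - ubar t)) \<longlonglongrightarrow> 0"
    "(\<lambda>k. obj \<Omega> T \<alpha> S yd (u k)) \<longlonglongrightarrow> obj \<Omega> T \<alpha> S yd ubar"
proof -
  let ?M = "lebesgue_on {0<..<T}" and ?Q = "lebesgue_on ({0<..<T} \<times> \<Omega>)"
  define J where "J k = obj \<Omega> T \<alpha> S yd (u k)" for k
  define Y where "Y k p = S (u k) (fst p) (snd p)" for k p
  define du where "du k m = nsq ?M (\<lambda>t. u k t - u m t)" for k m
  define dY where "dY k m = nsq ?Q (\<lambda>p. Y k p - Y m p)" for k m
  have uL: "L2 ?M (u k)" for k using u by (simp add: L2_on_iff_L2)
  have YL: "L2 ?Q (Y k)" for k unfolding Y_def[abs_def] by (rule heat_weak_sol_L2[OF S[OF u]])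
  have pos: "0 \<le> du k m" "0 \<le> dY k m" for k m by (auto simp: du_def dY_def)
  \<comment> \<open>Both distances are bounded by the gain in value: \<open>mid\<close> bounds the
    value at the midpoint below by \<open>J k\<close>, and doubling the midpoint identity turns
    eighths into quarters.\<close>
  have key: "dY k m / 4 + \<alpha> / 4 * du k m \<le> J m - J k" if "k \<le> m" for k m
  proof -
    have "obj \<Omega> T \<alpha> S yd (\<lambda>t. (1/2) *\<^sub>R u k t + (1/2) *\<^sub>R u m t) = (J k + J m) / 2 - dY k m / 8 - \<alpha> / 8 * du k m"
      unfolding J_def dY_def du_def Y_def by (rule obj_midpoint[OF \<Omega> T psi S yd u u])
    then have "J k \<le> (J k + J m) / 2 - dY k m / 8 - \<alpha> / 8 * du k m" using mid[OF that] by (simp add: J_def)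
    then show ?thesis by (simp add: field_simps)
  qed
  have inc: "incseq J"
  proof (rule incseq_SucI)
    fix k
    have "0 \<le> dY k (Suc k) / 4 + \<alpha> / 4 * du k (Suc k)" using pos alpha by simp
    then show "J k \<le> J (Suc k)" using key[of k "Suc k"] by simp
  qed
  have "norm (J n) \<le> \<bar>J 0\<bar> + \<bar>c\<bar>" for n
    using incseqD[OF inc, of 0 n] bdd[of n] unfolding J_def[symmetric] real_norm_def by linarith
  then have "Bseq J" by (rule BseqI')
  then have "convergent J" by (rule Bseq_mono_convergent) (use incseqD[OF inc] in blast)
  then have CJ: "Cauchy J" by (rule convergent_Cauchy)
  have sym: "du k m = du m k" "dY k m = dY m k" for k m
    unfolding du_def dY_def ip_self by (simp_all only: norm_minus_commute)
  have dd: "dY k m / 4 + \<alpha> / 4 * du k m \<le> \<bar>J m - J k\<bar>" for k m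
    using key[of k m] key[of m k] sym[of k m] by (cases "k \<le> m") auto
  have C1: "\<exists>N. \<forall>m\<ge>N. \<forall>n\<ge>N. nsq ?M (\<lambda>x. u m x - u n x) < e" if "0 < e" for e
  proof -
    obtain N where N: "\<And>m n. m \<ge> N \<Longrightarrow> n \<ge> N \<Longrightarrow> \<bar>J m - J n\<bar> < \<alpha> / 4 * e"
      using CJ \<open>0 < e\<close> alpha unfolding Cauchy_def dist_real_def by (metis mult_pos_pos divide_pos_pos zero_less_numeral)
    have "du m n < e" if "m \<ge> N" "n \<ge> N" for m n
    proof -
      have "\<alpha> / 4 * du m n < \<alpha> / 4 * e" using dd[of m n] N[OF that(2,1)] pos(2)[of m n] by linarith
      then show ?thesis using alpha by simp
    qed
    then show ?thesis unfolding du_def by blast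
  qed
  have C2: "\<exists>N. \<forall>m\<ge>N. \<forall>n\<ge>N. nsq ?Q (\<lambda>x. Y m x - Y n x) < e" if "0 < e" for e
  proof -
    obtain N where N: "\<And>m n. m \<ge> N \<Longrightarrow> n \<ge> N \<Longrightarrow> \<bar>J m - J n\<bar> < e / 4"
      using CJ \<open>0 < e\<close> unfolding Cauchy_def dist_real_def by (metis divide_pos_pos zero_less_numeral)
    have "dY m n < e" if "m \<ge> N" "n \<ge> N" for m n
    proof -
      have "0 \<le> \<alpha> / 4 * du m n" using alpha pos by simp
      then show ?thesis using dd[of m n] N[OF that(2,1)] by linarith
    qed
    then show ?thesis unfolding dY_def by blast
  qed
  obtain ubar where ub: "L2 ?M ubar" "(\<lambda>n. nsq ?M (\<lambda>x. u n x - ubar x)) \<longlonglongrightarrow> 0"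
    by (rule L2_complete[OF uL C1])
  obtain y where y: "L2 ?Q y" "(\<lambda>n. nsq ?Q (\<lambda>x. Y n x - y x)) \<longlonglongrightarrow> 0"
    by (rule L2_complete[OF YL C2])
  have ub': "L2_on {0<..<T} ubar" using ub(1) by (simp add: L2_on_iff_L2)
  have yS: "AE p in ?Q. y p = S ubar (fst p) (snd p)"
    by (rule S_closed[OF \<Omega> T psi S u ub' ub(2) y(1)]) (use y(2) in \<open>auto simp: Y_def\<close>)
  have SubL: "L2 ?Q (\<lambda>p. S ubar (fst p) (snd p))" by (rule heat_weak_sol_L2[OF S[OF ub']])
  have yL: "L2 ?Q (\<lambda>p. yd (fst p) (snd p))" using yd by (simp add: L2_on_iff_L2 case_prod_beta')
  have l1: "(\<lambda>k. nsq ?Q (\<lambda>p. Y k p - yd (fst p) (snd p)))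
    \<longlonglongrightarrow> nsq ?Q (\<lambda>p. y p - yd (fst p) (snd p))"
    by (rule L2_dist_tendsto_imp(2)[OF L2_diff[OF YL yL] L2_diff[OF y(1) yL] L2_zero]) (use y(2) in simp)
  have l2: "(\<lambda>k. nsq ?M (\<lambda>t. u k t - (\<chi> j. 1/2)))
    \<longlonglongrightarrow> nsq ?M (\<lambda>t. ubar t - (\<chi> j. 1/2))"
    by (rule L2_dist_tendsto_imp(2)[OF L2_diff[OF uL L2_const_interval] L2_diff[OF ub(1) L2_const_interval] L2_zero])
       (use ub(2) in simp)
  have ae: "AE p in ?Q. y p - yd (fst p) (snd p) = S ubar (fst p) (snd p) - yd (fst p) (snd p)"
    using yS by eventually_elim simp
  have e1: "nsq ?Q (\<lambda>p. y p - yd (fst p) (snd p))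
    = nsq ?Q (\<lambda>p. S ubar (fst p) (snd p) - yd (fst p) (snd p))"
    by (rule ip_cong_AE[OF ae ae]) (use y SubL yL in auto)
  have ob: "obj \<Omega> T \<alpha> S yd z = 1/2 * nsq ?Q (\<lambda>p. S z (fst p) (snd p) - yd (fst p) (snd p))
     + \<alpha>/2 * nsq ?M (\<lambda>t. z t - (\<chi> j. 1/2))" for z
    by (simp add: obj_def ip_self)
  have "(\<lambda>k. obj \<Omega> T \<alpha> S yd (u k)) \<longlonglongrightarrow> obj \<Omega> T \<alpha> S yd ubar"
    unfolding ob using l1 l2 unfolding e1 Y_def by (intro tendsto_intros)
  with ub' ub(2) show ?thesis by (rule that)
qed

section \<open>Controls with values in the unit box\<close>

lemma ip_sum_right:
  assumes f: "L2 M f" and g: "\<And>i. i \<in> A \<Longrightarrow> L2 M (g i)"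
  shows "L2 M (\<lambda>x. \<Sum>i\<in>A. c i *\<^sub>R g i x)"
    and "ip M f (\<lambda>x. \<Sum>i\<in>A. c i *\<^sub>R g i x) = (\<Sum>i\<in>A. c i * ip M f (g i))"
proof -
  have "L2 M (\<lambda>x. \<Sum>i\<in>A. c i *\<^sub>R g i x) \<and> ip M f (\<lambda>x. \<Sum>i\<in>A. c i *\<^sub>R g i x) = (\<Sum>i\<in>A. c i * ip M f (g i))"
    using g
  proof (induction A rule: infinite_finite_induct)
    case (insert i A)
    then show ?case using f by (auto simp: ip_add_right ip_scaleR_right L2_scaleR L2_add)
  qed auto
  then show "L2 M (\<lambda>x. \<Sum>i\<in>A. c i *\<^sub>R g i x)"
    "ip M f (\<lambda>x. \<Sum>i\<in>A. c i *\<^sub>R g i x) = (\<Sum>i\<in>A. c i * ip M f (g i))" by auto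
qed

abbreviation LI :: "real \<Rightarrow> real measure" where "LI T \<equiv> lebesgue_on {0<..<T}"

lemma finite_measure_LI: "finite_measure (LI T)"
  by (rule finite_measure_lebesgue_on) auto

lemma integrable_const_LI [simp]: "integrable (LI T) (\<lambda>t. c)"
  by (rule finite_measure.integrable_const[OF finite_measure_LI])

lemma measure_LI: "0 \<le> T \<Longrightarrow> measure (LI T) (space (LI T)) = T"
  by (simp add: measure_restrict_space)

lemma component_measurable:
  fixes v :: "'a \<Rightarrow> real^'n::finite"
  assumes "v \<in> borel_measurable M" shows "(\<lambda>t. v t $ j) \<in> borel_measurable M"
  by (rule measurable_compose[OF assms]) (intro borel_measurable_continuous_onI continuous_intros)

lemma vec_measurable:
  fixes v :: "'a \<Rightarrow> real^'n::finite"
  assumes "\<And>j. (\<lambda>t. v t $ j) \<in> borel_measurable M" shows "v \<in> borel_measurable M"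
proof -
  have "v = (\<lambda>t. \<Sum>j\<in>UNIV. v t $ j *\<^sub>R axis j 1)"
    by (simp add: vec_eq_iff axis_def fun_eq_iff if_distrib cong: if_cong)
  moreover have "(\<lambda>t. \<Sum>j\<in>UNIV. v t $ j *\<^sub>R axis j (1::real)) \<in> borel_measurable M"
    using assms by (intro borel_measurable_sum borel_measurable_scaleR) auto
  ultimately show ?thesis by simp
qed

lemma norm_le_card:
  fixes x :: "real^'n::finite"
  assumes "\<And>j. \<bar>x $ j\<bar> \<le> K" shows "norm x \<le> real CARD('n) * K"
proof -
  have "norm x \<le> (\<Sum>j\<in>UNIV. \<bar>x $ j\<bar>)" by (rule norm_le_l1_cart)
  also have "\<dots> \<le> (\<Sum>j\<in>(UNIV::'n set). K)" by (rule sum_mono) (rule assms)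
  finally show ?thesis by simp
qed

lemma L2_bounded:
  fixes f :: "real \<Rightarrow> 'e::euclidean_space"
  assumes [measurable]: "f \<in> borel_measurable (LI T)" and b: "AE t in LI T. norm (f t) \<le> K"
  shows "L2 (LI T) f" and "0 \<le> T \<Longrightarrow> nsq (LI T) f \<le> K\<^sup>2 * T"
proof -
  have ae: "AE t in LI T. (norm (f t))\<^sup>2 \<le> K\<^sup>2" using b by eventually_elim (auto intro: power_mono)
  have i: "integrable (LI T) (\<lambda>t. (norm (f t))\<^sup>2)"
    by (rule finite_measure.integrable_const_bound[OF finite_measure_LI, of _ "K\<^sup>2"]) (use ae in auto)
  then show "L2 (LI T) f" by (simp add: L2_def)
  assume T: "0 \<le> T"
  have "nsq (LI T) f \<le> (\<integral>t. K\<^sup>2 \<partial>LI T)" unfolding ip_self by (rule integral_mono_AE[OF i _ ae]) simp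
  also have "\<dots> = K\<^sup>2 * T" using measure_LI[OF T] by simp
  finally show "nsq (LI T) f \<le> K\<^sup>2 * T" .
qed

lemma box01_diff_bound:
  fixes v w :: "real \<Rightarrow> real^'n::finite"
  assumes "box01 T v" "box01 T w"
  shows "AE t in LI T. norm (v t - w t) \<le> real CARD('n)" and "AE t in LI T. \<forall>j. \<bar>(v t - w t) $ j\<bar> \<le> 1"
proof -
  have "AE t in LI T. \<forall>j. 0 \<le> v t $ j \<and> v t $ j \<le> 1" "AE t in LI T. \<forall>j. 0 \<le> w t $ j \<and> w t $ j \<le> 1"
    using assms by (auto simp: box01_def)
  then show *: "AE t in LI T. \<forall>j. \<bar>(v t - w t) $ j\<bar> \<le> 1"
    by eventually_elim (auto simp: abs_le_iff, smt (verit), smt (verit))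
  then show "AE t in LI T. norm (v t - w t) \<le> real CARD('n)"
    by eventually_elim (use norm_le_card[of "_ :: real^'n" 1] in auto)
qed

lemma box01_L2:
  fixes v :: "real \<Rightarrow> real^'n::finite"
  assumes v: "box01 T v" shows "L2 (LI T) v"
proof -
  have "box01 T (\<lambda>t. 0 :: real^'n)" by (simp add: box01_def)
  from box01_diff_bound(1)[OF v this] show ?thesis using v by (intro L2_bounded) (auto simp: box01_def)
qed

lemma L1_le_L2:
  fixes f :: "real \<Rightarrow> 'e::euclidean_space"
  assumes f: "L2 (LI T) f" and T: "0 \<le> T"
  shows "integrable (LI T) (\<lambda>t. norm (f t))" and "(\<integral>t. norm (f t) \<partial>LI T) \<le> sqrt T * sqrt (nsq (LI T) f)"
proof -
  have one: "L2 (LI T) (\<lambda>t. 1 :: real)" by (simp add: L2_def)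
  have n: "L2 (LI T) (\<lambda>t. norm (f t))" using f by (rule L2_norm)
  show "integrable (LI T) (\<lambda>t. norm (f t))" using L2_inner_integrable[OF one n] by simp
  have "(\<integral>t. norm (f t) \<partial>LI T) = ip (LI T) (\<lambda>t. 1) (\<lambda>t. norm (f t))" by (simp add: ip_def)
  also have "\<dots> \<le> sqrt (ip (LI T) (\<lambda>t. 1 :: real) (\<lambda>t. 1)) * sqrt (nsq (LI T) (\<lambda>t. norm (f t)))"
    using ip_Cauchy_Schwarz[OF one n] by simp
  also have "\<dots> = sqrt T * sqrt (nsq (LI T) f)"
    using measure_LI[OF T] by (simp add: ip_def power2_norm_eq_inner flip: power2_eq_square)
  finally show "(\<integral>t. norm (f t) \<partial>LI T) \<le> sqrt T * sqrt (nsq (LI T) f)" .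
qed

text \<open>Both bounds of the box have the form \<open>c \<le> s * v t $ j\<close> with
  \<open>\<bar>s\<bar> \<le> 1\<close>. The amount by which \<open>v\<close> violates such a bound
  is at most \<open>norm (w m t - v t)\<close> for every \<open>m\<close>, so its integral is
  zero.\<close>

lemma box01_L1_closed:
  fixes w :: "nat \<Rightarrow> real \<Rightarrow> real^'n::finite"
  assumes w: "\<And>m. box01 T (w m)" and v[measurable]: "v \<in> borel_measurable (LI T)"
    and i: "\<And>m. integrable (LI T) (\<lambda>t. norm (w m t - v t))"
    and lim: "(\<lambda>m. \<integral>t. norm (w m t - v t) \<partial>LI T) \<longlonglongrightarrow> 0"
  shows "box01 T v"
proof -
  have gen: "AE t in LI T. c \<le> s * v t $ j"
    if s: "\<bar>s\<bar> \<le> 1" and ae: "\<And>m. AE t in LI T. c \<le> s * w m t $ j" for s c j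
  proof -
    define g where "g t = max 0 (c - s * v t $ j)" for t
    have [measurable]: "g \<in> borel_measurable (LI T)" unfolding g_def using component_measurable[OF v, of j] by measurable
    have g_le: "AE t in LI T. g t \<le> norm (w m t - v t)" for m
      using ae[of m]
    proof eventually_elim
      case (elim t)
      have "s * w m t $ j - s * v t $ j \<le> \<bar>s\<bar> * \<bar>(w m t - v t) $ j\<bar>"
        by (simp add: abs_mult[symmetric] right_diff_distrib)
      also have "\<dots> \<le> 1 * norm (w m t - v t)" by (intro mult_mono s component_le_norm_cart) auto
      finally show ?case using elim by (simp add: g_def)
    qed
    have gi: "integrable (LI T) g"
      by (rule Bochner_Integration.integrable_bound[OF i[of 0]]) (use g_le[of 0] in \<open>auto simp: g_def\<close>)
    have "(\<integral>t. g t \<partial>LI T) \<le> (\<integral>t. norm (w m t - v t) \<partial>LI T)" for m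
      by (rule integral_mono_AE[OF gi i g_le])
    then have "(\<integral>t. g t \<partial>LI T) \<le> 0" by (intro LIMSEQ_le_const[OF lim]) auto
    moreover have "0 \<le> (\<integral>t. g t \<partial>LI T)" by (simp add: g_def)
    ultimately have "(\<integral>t. g t \<partial>LI T) = 0" by simp
    then have "AE t in LI T. g t = 0"
      by (subst (asm) integral_nonneg_eq_0_iff_AE[OF gi]) (auto simp: g_def)
    then show ?thesis by eventually_elim (auto simp: g_def max_def split: if_splits)
  qed
  have wb: "AE t in LI T. 0 \<le> w m t $ j \<and> w m t $ j \<le> 1" for m j
    using w[of m] unfolding box01_def by (auto elim: eventually_mono)
  have "AE t in LI T. 0 \<le> 1 * v t $ j" "AE t in LI T. -1 \<le> (-1) * v t $ j" for j
    by (rule gen; use wb in \<open>auto elim: eventually_mono\<close>)+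
  then have "AE t in LI T. 0 \<le> v t $ j \<and> v t $ j \<le> 1" for j
    by (auto elim: eventually_elim2)
  then have "AE t in LI T. \<forall>j\<in>UNIV. 0 \<le> v t $ j \<and> v t $ j \<le> 1"
    by (subst AE_finite_all) auto
  then show ?thesis using v by (simp add: box01_def)
qed

text \<open>For \<open>0 < e\<close> and \<open>0 \<le> x\<close> one has
  \<open>x \<le> e + e powr (1 - p) * x powr p\<close>. Integrated over the interval, the first term
  gives \<open>e * T\<close> and the second tends to zero for fixed \<open>e\<close>. No conjugate
  exponent appears, so \<open>p = 1\<close> is no special case.\<close>

lemma Lp_lim_imp_L1:
  fixes w :: "nat \<Rightarrow> real \<Rightarrow> real^'n::finite"
  assumes lim: "Lp_lim p T w v" and p: "1 \<le> p" and T: "0 < T"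
  shows "integrable (LI T) (\<lambda>t. norm (w m t - v t))" and "(\<lambda>m. \<integral>t. norm (w m t - v t) \<partial>LI T) \<longlonglongrightarrow> 0"
proof -
  have [measurable]: "v \<in> borel_measurable (LI T)" "w m \<in> borel_measurable (LI T)" for m
    using lim by (auto simp: Lp_lim_def)
  have ip: "integrable (LI T) (\<lambda>t. norm (w m t - v t) powr p)" for m using lim by (auto simp: Lp_lim_def)
  have le: "x \<le> e + e powr (1 - p) * x powr p" if "0 < e" "0 \<le> x" for e x :: real
  proof (cases "x \<le> e")
    case True then show ?thesis by (smt (verit) mult_nonneg_nonneg powr_ge_zero)
  next
    case False
    then have "x = x powr (1 - p) * x powr p" using that by (simp flip: powr_add)
    also have "\<dots> \<le> e powr (1 - p) * x powr p"
      using False that p by (intro mult_right_mono powr_mono2') auto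
    finally show ?thesis using that by simp
  qed
  have dom: "integrable (LI T) (\<lambda>t. e + e powr (1 - p) * norm (w m t - v t) powr p)" for e m
    using ip by simp
  show i: "integrable (LI T) (\<lambda>t. norm (w m t - v t))" for m
    by (rule Bochner_Integration.integrable_bound[OF dom[of 1 m]]) (use le[of 1] in \<open>auto intro!: AE_I2\<close>)
  define L where "L m = (\<integral>t. norm (w m t - v t) \<partial>LI T)" for m
  define P where "P m = (\<integral>t. norm (w m t - v t) powr p \<partial>LI T)" for m
  have P: "P \<longlonglongrightarrow> 0" using lim by (simp add: Lp_lim_def P_def[abs_def])
  have LP: "L m \<le> e * T + e powr (1 - p) * P m" if "0 < e" for e m
  proof -
    have "L m \<le> (\<integral>t. e + e powr (1 - p) * norm (w m t - v t) powr p \<partial>LI T)"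
      unfolding L_def using i dom le[OF that] by (intro integral_mono) auto
    also have "\<dots> = e * T + e powr (1 - p) * P m"
      unfolding P_def using ip measure_LI[of T] T by simp
    finally show ?thesis .
  qed
  have "L \<longlonglongrightarrow> 0"
  proof (rule LIMSEQ_I)
    fix r :: real assume r: "0 < r"
    define e where "e = r / (2 * T)"
    have e: "0 < e" "e * T = r / 2" using r T by (auto simp: e_def)
    have "(\<lambda>m. e powr (1 - p) * P m) \<longlonglongrightarrow> e powr (1 - p) * 0" by (intro tendsto_intros P)
    then have "\<forall>\<^sub>F m in sequentially. e powr (1 - p) * P m < r / 2" using r by (intro order_tendstoD) auto
    then obtain N where N: "\<And>m. N \<le> m \<Longrightarrow> e powr (1 - p) * P m < r / 2" by (auto simp: eventually_sequentially)
    have "norm (L m - 0) < r" if "N \<le> m" for m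
      using LP[OF e(1), of m] N[OF that] e(2) by (simp add: L_def)
    then show "\<exists>no. \<forall>n\<ge>no. norm (L n - 0) < r" by blast
  qed
  then show "(\<lambda>m. \<integral>t. norm (w m t - v t) \<partial>LI T) \<longlonglongrightarrow> 0" by (simp add: L_def[abs_def])
qed

lemma L1_imp_L2_box01:
  fixes w :: "nat \<Rightarrow> real \<Rightarrow> real^'n::finite"
  assumes w: "\<And>m. box01 T (w m)" and v: "box01 T v"
    and lim: "(\<lambda>m. \<integral>t. norm (w m t - v t) \<partial>LI T) \<longlonglongrightarrow> 0" and T: "0 < T"
  shows "(\<lambda>m. nsq (LI T) (\<lambda>t. w m t - v t)) \<longlonglongrightarrow> 0"
proof (rule tendsto_sandwich[OF _ _ tendsto_const])
  have L: "L2 (LI T) (\<lambda>t. w m t - v t)" for m using box01_L2[OF w] box01_L2[OF v] by auto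
  have "nsq (LI T) (\<lambda>t. w m t - v t) \<le> (\<integral>t. real CARD('n) * norm (w m t - v t) \<partial>LI T)" for m
    unfolding ip_self
  proof (rule integral_mono_AE)
    show "integrable (LI T) (\<lambda>t. (norm (w m t - v t))\<^sup>2)" using L by (simp add: L2_def)
    show "integrable (LI T) (\<lambda>t. real CARD('n) * norm (w m t - v t))" using L1_le_L2(1)[OF L] T by simp
    show "AE t in LI T. (norm (w m t - v t))\<^sup>2 \<le> real CARD('n) * norm (w m t - v t)"
      using box01_diff_bound(1)[OF w v, of m] by eventually_elim (simp add: power2_eq_square mult_right_mono)
  qed
  then show "\<forall>\<^sub>F m in sequentially. nsq (LI T) (\<lambda>t. w m t - v t)
      \<le> real CARD('n) * (\<integral>t. norm (w m t - v t) \<partial>LI T)" by simp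
  show "(\<lambda>m. real CARD('n) * (\<integral>t. norm (w m t - v t) \<partial>LI T)) \<longlonglongrightarrow> 0"
    using tendsto_mult_left[OF lim, of "real CARD('n)"] by simp
qed simp

lemma L2_imp_L1:
  fixes w :: "nat \<Rightarrow> real \<Rightarrow> 'e::euclidean_space"
  assumes w: "\<And>m. L2 (LI T) (w m)" and v: "L2 (LI T) v" and T: "0 < T"
    and lim: "(\<lambda>m. nsq (LI T) (\<lambda>t. w m t - v t)) \<longlonglongrightarrow> 0"
  shows "(\<lambda>m. \<integral>t. norm (w m t - v t) \<partial>LI T) \<longlonglongrightarrow> 0"
proof (rule tendsto_sandwich[OF _ _ tendsto_const])
  show "\<forall>\<^sub>F m in sequentially. (\<integral>t. norm (w m t - v t) \<partial>LI T) \<le> sqrt T * sqrt (nsq (LI T) (\<lambda>t. w m t - v t))"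
    using T by (intro always_eventually allI L1_le_L2(2) L2_diff w v) auto
  show "(\<lambda>m. sqrt T * sqrt (nsq (LI T) (\<lambda>t. w m t - v t))) \<longlonglongrightarrow> 0"
    using tendsto_mult_left[OF tendsto_real_sqrt[OF lim], of "sqrt T"] by simp
qed simp

text \<open>Differences of functions in the box are bounded by \<open>CARD('n)\<close>, so on the
  box convergence in any \<open>L^p\<close> amounts to convergence in \<open>L2\<close>. This lets
  the remaining argument work in \<open>L2\<close> for every \<open>p\<close>.\<close>

lemma Lp_closure_box01:
  fixes A :: "(real \<Rightarrow> real^'n::finite) set"
  assumes A: "\<And>w. w \<in> A \<Longrightarrow> box01 T w" and v: "v \<in> Lp_closure p T A" and p: "1 \<le> p" and T: "0 < T"
  obtains w where "\<forall>m::nat. w m \<in> A" "box01 T v" "(\<lambda>m. nsq (LI T) (\<lambda>t. w m t - v t)) \<longlonglongrightarrow> 0"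
proof -
  obtain w where w: "\<And>m. w m \<in> A" "Lp_lim p T w v" using v by (auto simp: Lp_closure_def)
  note l = Lp_lim_imp_L1[OF w(2) p T]
  have wb: "box01 T (w m)" for m using A w(1) by blast
  have "v \<in> borel_measurable (LI T)" using w(2) by (simp add: Lp_lim_def)
  then have vb: "box01 T v" by (rule box01_L1_closed[OF wb _ l])
  from that[OF _ vb L1_imp_L2_box01[OF wb vb l(2) T]] w(1) show ?thesis by blast
qed

text \<open>On the box \<open>x powr p \<le> K * x\<close> for
  \<open>x = norm (w m t - v t)\<close>, so convergence in \<open>L1\<close> suffices, and this
  follows from convergence in \<open>L2\<close> on a bounded interval.\<close>

lemma Lp_closure_box01I:
  fixes A :: "(real \<Rightarrow> real^'n::finite) set"
  assumes w: "\<And>m::nat. w m \<in> A" and A: "\<And>w. w \<in> A \<Longrightarrow> box01 T w" and v: "box01 T v"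
    and lim: "(\<lambda>m. nsq (LI T) (\<lambda>t. w m t - v t)) \<longlonglongrightarrow> 0" and p: "1 \<le> p" and T: "0 < T"
  shows "v \<in> Lp_closure p T A"
proof -
  have wb: "box01 T (w m)" for m using A w by blast
  have [measurable]: "v \<in> borel_measurable (LI T)" "w m \<in> borel_measurable (LI T)" for m
    using v wb by (auto simp: box01_def)
  have L: "L2 (LI T) (w m)" "L2 (LI T) v" for m using box01_L2 wb v by auto
  define K where "K = real CARD('n) powr (p - 1)"
  have le: "AE t in LI T. norm (w m t - v t) powr p \<le> K * norm (w m t - v t)" for m
    using box01_diff_bound(1)[OF wb v, of m]
  proof eventually_elim
    case (elim t)
    define x where "x = norm (w m t - v t)"
    show ?case
    proof (cases "x = 0")
      case False
      then have "0 < x" by (simp add: x_def)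
      then have "x powr p = x powr (p - 1) * x" by (simp add: powr_diff)
      also have "\<dots> \<le> K * x"
        unfolding K_def using elim p \<open>0 < x\<close> by (intro mult_right_mono powr_mono2) (auto simp: x_def)
      finally show ?thesis by (simp add: x_def)
    qed (simp add: x_def)
  qed
  have i1: "integrable (LI T) (\<lambda>t. K * norm (w m t - v t))" for m
    using L1_le_L2(1)[OF L2_diff[OF L]] T by simp
  have ip: "integrable (LI T) (\<lambda>t. norm (w m t - v t) powr p)" for m
    by (rule Bochner_Integration.integrable_bound[OF i1[of m]]) (use le[of m] in \<open>auto elim!: eventually_mono\<close>)
  have "(\<lambda>m. \<integral>t. norm (w m t - v t) powr p \<partial>LI T) \<longlonglongrightarrow> 0"
  proof (rule tendsto_sandwich[OF _ _ tendsto_const])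
    show "\<forall>\<^sub>F m in sequentially. (\<integral>t. norm (w m t - v t) powr p \<partial>LI T) \<le> K * (\<integral>t. norm (w m t - v t) \<partial>LI T)"
      using integral_mono_AE[OF ip i1 le] by simp
    show "(\<lambda>m. K * (\<integral>t. norm (w m t - v t) \<partial>LI T)) \<longlonglongrightarrow> 0"
      using tendsto_mult_left[OF L2_imp_L1[OF L T lim], of K] by simp
  qed simp
  then have "Lp_lim p T w v" using ip by (simp add: Lp_lim_def)
  then show ?thesis using w by (auto simp: Lp_closure_def)
qed

section \<open>Convex combinations of controls\<close>

lemma conv_fun_superset: "A \<subseteq> conv_fun A"
proof
  fix f assume "f \<in> A"
  then show "f \<in> conv_fun A"
    unfolding conv_fun_def by (auto intro!: exI[of _ 1] exI[of _ "\<lambda>_. 1::real"] exI[of _ "\<lambda>_. f"])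
qed

lemma conv_fun_combine:
  assumes f: "f \<in> conv_fun A" and g: "g \<in> conv_fun A" and s: "0 \<le> s" "s \<le> 1"
  shows "(\<lambda>x. (1 - s) *\<^sub>R f x + s *\<^sub>R g x) \<in> conv_fun A"
proof -
  obtain m c v where f': "\<And>i::nat. i < m \<Longrightarrow> 0 \<le> c i \<and> v i \<in> A" "(\<Sum>i<m. c i) = 1" "f = (\<lambda>x. \<Sum>i<m. c i *\<^sub>R v i x)"
    using f by (auto simp: conv_fun_def)
  obtain m' c' v' where g': "\<And>i::nat. i < m' \<Longrightarrow> 0 \<le> c' i \<and> v' i \<in> A" "(\<Sum>i<m'. c' i) = 1" "g = (\<lambda>x. \<Sum>i<m'. c' i *\<^sub>R v' i x)"
    using g by (auto simp: conv_fun_def)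
  define C where "C i = (if i < m then (1 - s) * c i else s * c' (i - m))" for i
  define V where "V i = (if i < m then v i else v' (i - m))" for i
  have split: "(\<Sum>i<m + m'. h i) = (\<Sum>i<m. h i) + (\<Sum>i<m'. h (m + i))" for h :: "nat \<Rightarrow> 'z::comm_monoid_add"
    by (induction m') (auto simp: add.assoc)
  have "(\<Sum>i<m + m'. C i) = 1"
    unfolding split by (simp add: C_def f' g' flip: sum_distrib_left)
  moreover have "(\<lambda>x. (1 - s) *\<^sub>R f x + s *\<^sub>R g x) = (\<lambda>x. \<Sum>i<m + m'. C i *\<^sub>R V i x)"
    unfolding split by (simp add: C_def V_def f'(3) g'(3) scaleR_sum_right)
  moreover have "\<forall>i<m + m'. 0 \<le> C i \<and> V i \<in> A"
    using f'(1) g'(1) s by (auto simp: C_def V_def)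
  ultimately show ?thesis unfolding conv_fun_def by blast
qed

lemma conv_fun_box01:
  fixes D :: "(real \<Rightarrow> real^'n::finite) set"
  assumes D: "\<And>w. w \<in> D \<Longrightarrow> box01 T w" and f: "f \<in> conv_fun D"
  shows "box01 T f"
proof -
  obtain m c v where f': "\<And>i::nat. i < m \<Longrightarrow> 0 \<le> c i" "\<And>i. i < m \<Longrightarrow> v i \<in> D" "(\<Sum>i<m. c i) = 1" "f = (\<lambda>x. \<Sum>i<m. c i *\<^sub>R v i x)"
    using f by (auto simp: conv_fun_def)
  have vb: "box01 T (v i)" if "i < m" for i using D f'(2) that by blast
  have "f \<in> borel_measurable (LI T)"
    unfolding f'(4) using vb by (intro borel_measurable_sum borel_measurable_scaleR) (auto simp: box01_def)
  moreover have "AE t in LI T. \<forall>i\<in>{..<m}. \<forall>j. 0 \<le> v i t $ j \<and> v i t $ j \<le> 1"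
    using vb by (subst AE_finite_all) (auto simp: box01_def)
  then have "AE t in LI T. \<forall>j. 0 \<le> f t $ j \<and> f t $ j \<le> 1"
  proof eventually_elim
    case (elim t)
    show ?case
    proof
      fix j
      have e: "f t $ j = (\<Sum>i<m. c i * v i t $ j)" by (simp add: f'(4))
      have "0 \<le> (\<Sum>i<m. c i * v i t $ j)" using elim f'(1) by (intro sum_nonneg mult_nonneg_nonneg) auto
      moreover have "(\<Sum>i<m. c i * v i t $ j) \<le> (\<Sum>i<m. c i)"
        using elim f'(1) by (intro sum_mono) (auto intro!: mult_left_le)
      ultimately show "0 \<le> f t $ j \<and> f t $ j \<le> 1" using e f'(3) by simp
    qed
  qed
  ultimately show ?thesis by (simp add: box01_def)
qed

section \<open>Cutting planes\<close>

text \<open>The intervals are required to be nonempty, so that averages divide by a positive length;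
  for the partitions of the algorithm \<open>interval_partitionI\<close> derives this from
  quasi-uniformity.\<close>

definition interval_partition :: "real \<Rightarrow> nat \<Rightarrow> (nat \<Rightarrow> real set) \<Rightarrow> bool" where
  "interval_partition T N I \<longleftrightarrow> 0 < T \<and> (\<forall>i<N. \<exists>l r. l < r \<and> I i = {l<..<r}) \<and> disjoint_family_on I {..<N} \<and>
     (\<Union>i<N. closure (I i)) = {0..T}"

lemma interval_partition_subset:
  assumes "interval_partition T N I" "i < N" shows "I i \<subseteq> {0<..<T}"
proof -
  have "I i \<subseteq> {0..T}" using assms closure_subset[of "I i"] unfolding interval_partition_def by blast
  moreover have "open (I i)" using assms by (auto simp: interval_partition_def)
  ultimately show ?thesis using interior_maximal[of "I i" "{0..T}"] by (simp add: interior_atLeastAtMost_real)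
qed

lemma interval_partition_sets:
  assumes "interval_partition T N I" "i < N" shows "I i \<in> sets borel" "I i \<in> sets lebesgue"
  using assms by (auto simp: interval_partition_def)

lemma interval_partition_measure_pos:
  assumes "interval_partition T N I" "i < N" shows "0 < measure lebesgue (I i)"
  using assms by (auto simp: interval_partition_def)

lemma interval_partition_nonempty: "interval_partition T N I \<Longrightarrow> 0 < N"
  by (auto simp: interval_partition_def intro: gr0I)

text \<open>The open intervals miss at most their finitely many endpoints.\<close>

lemma interval_partition_AE_cover:
  assumes P: "interval_partition T N I" shows "AE t in LI T. \<exists>i<N. t \<in> I i"
proof -
  define Z where "Z = (\<Union>i<N. closure (I i) - I i)"
  have ex: "\<forall>i<N. \<exists>l r. l < r \<and> I i = {l<..<r}" using P unfolding interval_partition_def by (elim conjE)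
  have "finite (closure (I i) - I i)" if iN: "i < N" for i
  proof -
    obtain l r where lr: "l < r" "I i = {l<..<r}" using ex[rule_format, OF iN] by metis
    have "closure (I i) - I i \<subseteq> {l, r}" using lr by auto
    then show ?thesis by (rule finite_subset) simp
  qed
  then have "finite Z" unfolding Z_def by auto
  then have "negligible Z" by (rule negligible_finite)
  then have "AE t in lebesgue. t \<notin> Z" by (auto simp: negligible_iff_null_sets AE_not_in)
  then have "AE t in lebesgue. t \<in> {0<..<T} \<longrightarrow> (\<exists>i<N. t \<in> I i)"
  proof eventually_elim
    case (elim t)
    show ?case
    proof
      assume "t \<in> {0<..<T}"
      then have "t \<in> (\<Union>i<N. closure (I i))" using P by (auto simp: interval_partition_def)
      then show "\<exists>i<N. t \<in> I i" using elim by (auto simp: Z_def)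
    qed
  qed
  then show ?thesis by (subst AE_restrict_space_iff) auto
qed

definition stepf :: "nat \<Rightarrow> (nat \<Rightarrow> real set) \<Rightarrow> ('n::finite \<times> nat \<Rightarrow> real) \<Rightarrow> real \<Rightarrow> real^'n" where
  "stepf N I c t = (\<chi> j. \<Sum>i<N. c (j, i) * indicator (I i) t)"

lemma stepf_eq:
  assumes P: "interval_partition T N I" and i: "i < N" "t \<in> I i" shows "stepf N I c t $ j = c (j, i)"
proof -
  have "t \<notin> I i'" if "i' < N" "i' \<noteq> i" for i'
    using P i that unfolding interval_partition_def disjoint_family_on_def by blast
  then have "(\<Sum>i'<N. c (j, i') * indicator (I i') t) = (\<Sum>i'<N. if i' = i then c (j, i) else 0)"
    using i by (intro sum.cong) (auto simp: indicator_def)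
  then show ?thesis using i by (simp add: stepf_def)
qed

lemma stepf_measurable:
  assumes P: "interval_partition T N I" shows "stepf N I c \<in> borel_measurable (LI T)"
proof (rule vec_measurable)
  fix j
  have "(\<lambda>t. \<Sum>i<N. c (j, i) * indicator (I i) t) \<in> borel_measurable (LI T)"
  proof (rule borel_measurable_sum)
    fix i assume "i \<in> {..<N}"
    then have "I i \<in> sets (LI T)"
      using interval_partition_sets[OF P, of i] interval_partition_subset[OF P, of i] by (auto simp: sets_restrict_space_iff)
    then show "(\<lambda>t. c (j, i) * indicator (I i) t) \<in> borel_measurable (LI T)" by measurable
  qed
  then show "(\<lambda>t. stepf N I c t $ j) \<in> borel_measurable (LI T)" by (simp add: stepf_def)
qed

lemma stepf_L2:
  fixes c :: "'n::finite \<times> nat \<Rightarrow> real"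
  assumes P: "interval_partition T N I" shows "L2 (LI T) (stepf N I c)"
proof -
  define K where "K = (\<Sum>j\<in>UNIV. \<Sum>i<N. \<bar>c (j, i)\<bar>)"
  have "norm (stepf N I c t) \<le> K" for t
  proof -
    have "norm (stepf N I c t) \<le> (\<Sum>j\<in>UNIV. \<bar>stepf N I c t $ j\<bar>)" by (rule norm_le_l1_cart)
    also have "\<dots> \<le> K" unfolding K_def
    proof (rule sum_mono)
      fix j
      have "\<bar>stepf N I c t $ j\<bar> \<le> (\<Sum>i<N. \<bar>c (j, i) * indicator (I i) t\<bar>)" unfolding stepf_def vec_lambda_beta by (rule sum_abs)
      also have "\<dots> \<le> (\<Sum>i<N. \<bar>c (j, i)\<bar>)" by (intro sum_mono) (auto simp: indicator_def)
      finally show "\<bar>stepf N I c t $ j\<bar> \<le> (\<Sum>i<N. \<bar>c (j, i)\<bar>)" .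
    qed
    finally show ?thesis .
  qed
  then show ?thesis by (intro L2_bounded(1)[OF stepf_measurable[OF P], where K = K]) auto
qed

text \<open>A cut is an inner product in \<open>L2\<close> with a step function, whose height on an
  interval is the coefficient divided by the length. Hence cuts are continuous in \<open>L2\<close>,
  and cuts on different partitions become comparable.\<close>

lemma dotN_Pi_avg:
  fixes v :: "real \<Rightarrow> real^'n::finite"
  assumes P: "interval_partition T N I" and v: "L2 (LI T) v"
  shows "dotN N a (Pi_avg N I v) = ip (LI T) (stepf N I (\<lambda>ji. a ji / measure lebesgue (I (snd ji)))) v"
proof -
  have T: "0 \<le> T" using P by (simp add: interval_partition_def)
  have vi: "integrable (LI T) (\<lambda>t. v t $ j)" for j
    by (rule Bochner_Integration.integrable_bound[OF L1_le_L2(1)[OF v T]])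
       (use v component_measurable in \<open>auto simp: L2_def intro!: AE_I2 component_le_norm_cart\<close>)
  have S: "I i \<in> sets (LI T)" if "i < N" for i
    using interval_partition_sets[OF P that] interval_partition_subset[OF P that] by (auto simp: sets_restrict_space_iff)
  have int: "integrable (LI T) (\<lambda>t. indicator (I i) t * v t $ j)" if "i < N" for i j
    using integrable_mult_indicator[OF S[OF that] vi, of j] by simp
  have eq: "(\<integral>t. v t $ j \<partial>lebesgue_on (I i)) = (\<integral>t. indicator (I i) t * v t $ j \<partial>LI T)" if "i < N" for i j
  proof -
    have "(\<integral>t. indicator (I i) t * v t $ j \<partial>LI T) = (\<integral>t. indicator {0<..<T} t *\<^sub>R (indicator (I i) t * v t $ j) \<partial>lebesgue)"
      by (subst integral_restrict_space) auto
    also have "\<dots> = (\<integral>t. indicator (I i) t *\<^sub>R (v t $ j) \<partial>lebesgue)"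
      using interval_partition_subset[OF P that] by (intro Bochner_Integration.integral_cong) (auto simp: indicator_def)
    also have "\<dots> = (\<integral>t. v t $ j \<partial>lebesgue_on (I i))"
      using interval_partition_sets[OF P that] by (subst integral_restrict_space) auto
    finally show ?thesis by simp
  qed
  define K where "K j i = a (j, i) / measure lebesgue (I i)" for j i
  have "ip (LI T) (stepf N I (\<lambda>ji. a ji / measure lebesgue (I (snd ji)))) v
    = (\<integral>t. (\<Sum>j\<in>UNIV. \<Sum>i<N. K j i * (indicator (I i) t * v t $ j)) \<partial>LI T)"
    unfolding ip_def stepf_def inner_vec_def
    by (simp only: vec_lambda_beta inner_real_def snd_conv sum_distrib_right mult.assoc K_def)
  also have "\<dots> = (\<Sum>j\<in>UNIV. \<Sum>i<N. K j i * (\<integral>t. indicator (I i) t * v t $ j \<partial>LI T))"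
  proof -
    have "(\<integral>t. (\<Sum>j\<in>UNIV. \<Sum>i<N. K j i * (indicator (I i) t * v t $ j)) \<partial>LI T)
      = (\<Sum>j\<in>UNIV. \<integral>t. (\<Sum>i<N. K j i * (indicator (I i) t * v t $ j)) \<partial>LI T)"
      by (rule Bochner_Integration.integral_sum) (intro Bochner_Integration.integrable_sum integrable_mult_right int, simp)
    also have "\<dots> = (\<Sum>j\<in>UNIV. \<Sum>i<N. \<integral>t. K j i * (indicator (I i) t * v t $ j) \<partial>LI T)"
      by (intro sum.cong refl Bochner_Integration.integral_sum integrable_mult_right int) simp
    finally show ?thesis unfolding integral_mult_right_zero .
  qed
  also have "\<dots> = (\<Sum>j\<in>UNIV. \<Sum>i<N. a (j, i) * (1 / measure lebesgue (I i) * (\<integral>t. v t $ j \<partial>lebesgue_on (I i))))"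
    by (intro sum.cong refl) (simp add: eq K_def)
  also have "\<dots> = dotN N a (Pi_avg N I v)"
    unfolding dotN_def Pi_avg_def sum.cartesian_product by (intro sum.cong) auto
  finally show ?thesis by simp
qed

text \<open>A linear inequality passes to convex combinations, so membership in \<open>H_set\<close>
  need only be checked on \<open>D\<close>.\<close>

lemma C_set_le:
  fixes D :: "(real \<Rightarrow> real^'n::finite) set"
  assumes D: "\<And>w. w \<in> D \<Longrightarrow> dotN N a (Pi_avg N I w) \<le> b" and w: "w \<in> C_set N I D"
  shows "dotN N a w \<le> b"
proof -
  obtain m c v where v: "\<And>i::nat. i < m \<Longrightarrow> 0 \<le> c i" "\<And>i. i < m \<Longrightarrow> v i \<in> Pi_avg N I ` D" "(\<Sum>i<m. c i) = 1"
    "w = (\<lambda>x. \<Sum>i<m. c i *\<^sub>R v i x)"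
    using w unfolding C_set_def conv_fun_def mem_Collect_eq by blast
  have "dotN N a w = (\<Sum>ji\<in>UNIV \<times> {..<N}. \<Sum>i<m. c i * (a ji * v i ji))"
    by (simp add: dotN_def v(4) sum_distrib_left mult_ac)
  also have "\<dots> = (\<Sum>i<m. c i * dotN N a (v i))"
    unfolding dotN_def by (subst sum.swap) (simp add: sum_distrib_left)
  also have "\<dots> \<le> (\<Sum>i<m. c i * b)"
  proof (intro sum_mono mult_left_mono)
    fix i assume i: "i \<in> {..<m}"
    then show "0 \<le> c i" using v(1) by simp
    obtain z where "z \<in> D" "v i = Pi_avg N I z" using v(2)[of i] i by auto
    then show "dotN N a (v i) \<le> b" using D by simp
  qed
  also have "\<dots> = b" using v(3) by (simp flip: sum_distrib_right)
  finally show ?thesis .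
qed

text \<open>A measurable function is an almost everywhere limit of continuous ones. Clipping each
  component to \<open>[-1, 1]\<close> keeps them continuous, leaves the limit unchanged because
  \<open>g\<close> already lies in that range, and supplies the constant bound for dominated
  convergence.\<close>

lemma continuous_L1_approx:
  fixes g :: "real \<Rightarrow> real^'n::finite"
  assumes g: "g \<in> borel_measurable (LI T)" and gb: "AE t in LI T. \<forall>j. \<bar>g t $ j\<bar> \<le> 1" and e: "0 < e"
  obtains c where "continuous_on UNIV c" "\<forall>t j. \<bar>c t $ j\<bar> \<le> 1"
    "integrable (LI T) (\<lambda>t. norm (g t - c t))" "(\<integral>t. norm (g t - c t) \<partial>LI T) < e"
proof -
  have "(\<lambda>t. if t \<in> {0<..<T} then g t else 0) \<in> borel_measurable lebesgue"
    by (subst borel_measurable_if) (simp_all add: g)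
  then have "(\<lambda>t. if t \<in> {0<..<T} then g t else 0) measurable_on UNIV"
    by (rule lebesgue_measurable_imp_measurable_on) auto
  then obtain Z f where Z: "negligible Z" and f: "\<And>n::nat. continuous_on UNIV (f n)"
    "\<And>t. t \<notin> Z \<Longrightarrow> (\<lambda>n. f n t) \<longlonglongrightarrow> (if t \<in> {0<..<T} then g t else 0)"
    by (auto simp: measurable_on_def)
  define cl :: "real^'n \<Rightarrow> real^'n" where "cl x = (\<chi> j. max (-1) (min 1 (x $ j)))" for x
  have cl_cont: "continuous_on A cl" for A
    unfolding cl_def[abs_def] by (intro continuous_intros)
  define c where "c n t = cl (f n t)" for n t
  have c: "continuous_on UNIV (c n)" for n
    unfolding c_def[abs_def] using continuous_on_compose2[OF cl_cont[of UNIV] f(1)[of n]] by simp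
  have cb: "\<bar>c n t $ j\<bar> \<le> 1" for n t j by (auto simp: c_def cl_def)
  have cm [measurable]: "c n \<in> borel_measurable (LI T)" for n by (rule continuous_measurable_lebesgue_on[OF c])
  note [measurable] = g
  have "AE t in lebesgue. t \<notin> Z" using Z by (auto simp: negligible_iff_null_sets AE_not_in)
  then have "AE t in lebesgue. t \<in> {0<..<T} \<longrightarrow> (\<lambda>n. f n t) \<longlonglongrightarrow> g t"
    by eventually_elim (use f(2) in fastforce)
  then have "AE t in LI T. (\<lambda>n. f n t) \<longlonglongrightarrow> g t" by (subst AE_restrict_space_iff) auto
  with gb have lim: "AE t in LI T. (\<lambda>n. norm (g t - c n t)) \<longlonglongrightarrow> 0"
  proof eventually_elim
    case (elim t)
    have "cl (g t) = g t" using elim(1) by (auto simp: cl_def vec_eq_iff abs_le_iff max_def min_def; smt (verit))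
    moreover have "(\<lambda>n. cl (f n t)) \<longlonglongrightarrow> cl (g t)"
      using continuous_on_tendsto_compose[OF cl_cont[of UNIV] elim(2)] by simp
    ultimately have "(\<lambda>n. norm (g t - c n t)) \<longlonglongrightarrow> norm (g t - g t)" unfolding c_def by (intro tendsto_intros) simp
    then show ?case by simp
  qed
  have bd: "AE t in LI T. norm (norm (g t - c n t)) \<le> real CARD('n) * 2" for n
    using gb
  proof eventually_elim
    case (elim t)
    have "\<bar>(g t - c n t) $ j\<bar> \<le> 2" for j
      using elim[THEN spec, of j] cb[of n t j] by simp
    then show ?case using norm_le_card[of "g t - c n t" 2] by simp
  qed
  have "(\<lambda>n. \<integral>t. norm (g t - c n t) \<partial>LI T) \<longlonglongrightarrow> (\<integral>t. 0 \<partial>LI T)"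
    by (rule integral_dominated_convergence[OF _ _ _ lim bd]) auto
  then have "\<forall>\<^sub>F n in sequentially. (\<integral>t. norm (g t - c n t) \<partial>LI T) < e"
    using e by (intro order_tendstoD) auto
  then obtain n where n: "(\<integral>t. norm (g t - c n t) \<partial>LI T) < e" by (auto simp: eventually_sequentially)
  have "integrable (LI T) (\<lambda>t. norm (g t - c n t))"
    by (rule finite_measure.integrable_const_bound[OF finite_measure_LI bd]) measurable
  with c cb n show ?thesis by (intro that[of "c n"]) auto
qed

lemma ip_abs_le:
  fixes f g :: "real \<Rightarrow> 'e::euclidean_space"
  assumes f: "L2 (LI T) f" and g: "L2 (LI T) g" and b: "AE t in LI T. norm (g t) \<le> K" and T: "0 \<le> T"
  shows "\<bar>ip (LI T) f g\<bar> \<le> K * (\<integral>t. norm (f t) \<partial>LI T)"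
proof -
  have "\<bar>ip (LI T) f g\<bar> \<le> (\<integral>t. norm (f t \<bullet> g t) \<partial>LI T)"
    unfolding ip_def using integral_norm_bound[of "LI T" "\<lambda>t. f t \<bullet> g t"] by simp
  also have "\<dots> \<le> (\<integral>t. K * norm (f t) \<partial>LI T)"
  proof (rule integral_mono_AE)
    show "integrable (LI T) (\<lambda>t. norm (f t \<bullet> g t))" by (intro integrable_norm L2_inner_integrable f g)
    show "integrable (LI T) (\<lambda>t. K * norm (f t))" using L1_le_L2(1)[OF f T] by simp
    show "AE t in LI T. norm (f t \<bullet> g t) \<le> K * norm (f t)"
      using b
    proof eventually_elim
      case (elim t)
      have "\<bar>f t \<bullet> g t\<bar> \<le> norm (f t) * norm (g t)" by (rule Cauchy_Schwarz_ineq2)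
      also have "\<dots> \<le> norm (f t) * K" using elim by (intro mult_left_mono) auto
      finally show ?case by (simp add: mult.commute)
    qed
  qed
  finally show ?thesis by simp
qed

text \<open>The variational inequality of a projection, with slack: a nearly closest point of the
  convex hull replaces the projection, and half of the squared distance \<open>d\<close> survives as
  the gap.\<close>

lemma conv_fun_near_minimizer:
  fixes D :: "(real \<Rightarrow> real^'n::finite) set"
  assumes D: "\<And>w. w \<in> D \<Longrightarrow> box01 T w" "D \<noteq> {}" and ub: "box01 T ubar" and T: "0 < T" and p: "1 \<le> p"
    and not: "ubar \<notin> Lp_closure p T (conv_fun D)"
  obtains d g where "0 < d" "L2 (LI T) g" "AE t in LI T. \<forall>j. \<bar>g t $ j\<bar> \<le> 1"
    "\<forall>w\<in>D. d \<le> ip (LI T) g (\<lambda>t. ubar t - w t)"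
proof -
  define n where "n = real CARD('n)"
  have A: "box01 T w" if "w \<in> conv_fun D" for w by (rule conv_fun_box01[OF D(1) that])
  have DA: "D \<subseteq> conv_fun D" by (rule conv_fun_superset)
  have uL: "L2 (LI T) ubar" by (rule box01_L2[OF ub])
  have AL: "L2 (LI T) w" if "w \<in> conv_fun D" for w by (rule box01_L2[OF A[OF that]])
  define q where "q w = nsq (LI T) (\<lambda>t. w t - ubar t)" for w
  define d where "d = Inf (q ` conv_fun D)"
  have ne: "q ` conv_fun D \<noteq> {}" using D(2) DA by auto
  have bb: "bdd_below (q ` conv_fun D)" by (rule bdd_belowI2[of _ 0]) (simp add: q_def)
  have dle: "d \<le> q w" if "w \<in> conv_fun D" for w unfolding d_def using that by (intro cInf_lower bb) auto
  have near: "\<exists>w\<in>conv_fun D. q w < d + e" if "0 < e" for e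
  proof -
    have "\<exists>x\<in>q ` conv_fun D. x < d + e" unfolding d_def using ne bb that by (subst cInf_less_iff[symmetric]) auto
    then show ?thesis by auto
  qed
  have d0: "0 \<le> d" unfolding d_def by (rule cInf_greatest[OF ne]) (auto simp: q_def)
  have "d \<noteq> 0"
  proof
    assume "d = 0"
    then have "\<exists>w\<in>conv_fun D. q w < 1 / real (Suc m)" for m using near[of "1 / real (Suc m)"] by simp
    then obtain w where w: "\<And>m. w m \<in> conv_fun D" "\<And>m. q (w m) < 1 / real (Suc m)" by metis
    have "(\<lambda>m. q (w m)) \<longlonglongrightarrow> 0"
    proof (rule tendsto_sandwich[OF _ _ tendsto_const LIMSEQ_Suc[OF lim_1_over_n]])
      show "\<forall>\<^sub>F m in sequentially. 0 \<le> q (w m)" by (simp add: q_def)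
      show "\<forall>\<^sub>F m in sequentially. q (w m) \<le> 1 / real (Suc m)" using w(2) by (intro always_eventually) (auto intro: less_imp_le)
    qed
    then have "ubar \<in> Lp_closure p T (conv_fun D)"
      unfolding q_def by (intro Lp_closure_box01I[OF w(1) A ub _ p T])
    with not show False by simp
  qed
  then have dp: "0 < d" using d0 by simp
  define C where "C = n\<^sup>2 * T"
  have C0: "0 \<le> C" using T by (simp add: C_def)
  \<comment> \<open>\<open>C\<close> bounds the squared distance of two points of the box. If
    \<open>z\<close> is optimal up to \<open>e\<^sup>2\<close>, moving from \<open>z\<close> by the
    fraction \<open>e\<close> towards \<open>w\<close> shows that twice the inner product of
    \<open>g\<close> and \<open>w - z\<close> is at most \<open>e * (1 + C)\<close>, hence at most
    \<open>d\<close>. The minimum with \<open>1\<close> keeps the moved point in the convex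
    hull.\<close>
  define e where "e = min 1 (d / (1 + C))"
  have e: "0 < e" "e \<le> 1" using dp C0 by (auto simp: e_def)
  have "e \<le> d / (1 + C)" by (simp add: e_def)
  then have "e * (1 + C) \<le> d" using C0 by (subst (asm) pos_le_divide_eq) auto
  note e = e this
  obtain z where z: "z \<in> conv_fun D" "q z < d + e\<^sup>2" using near[of "e\<^sup>2"] e by auto
  define g where "g t = ubar t - z t" for t
  have gL: "L2 (LI T) g" unfolding g_def using uL AL[OF z(1)] by auto
  have gg: "nsq (LI T) g = q z" unfolding q_def ip_self g_def by (simp only: norm_minus_commute)
  show ?thesis
  proof (rule that[of "d / 2" g])
    show "0 < d / 2" using dp by simp
    show "L2 (LI T) g" by (rule gL)
    show "AE t in LI T. \<forall>j. \<bar>g t $ j\<bar> \<le> 1" unfolding g_def by (rule box01_diff_bound(2)[OF ub A[OF z(1)]])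
    show "\<forall>w\<in>D. d / 2 \<le> ip (LI T) g (\<lambda>t. ubar t - w t)"
    proof
      fix w assume w: "w \<in> D"
      have wA: "w \<in> conv_fun D" using DA w by auto
      note wL = AL[OF wA] and zL = AL[OF z(1)]
      have kL: "L2 (LI T) (\<lambda>t. w t - z t)" using wL zL by auto
      have kb: "nsq (LI T) (\<lambda>t. w t - z t) \<le> C"
      proof -
        have m: "(\<lambda>t. w t - z t) \<in> borel_measurable (LI T)" using kL by (simp add: L2_def)
        show ?thesis
          using L2_bounded(2)[OF m box01_diff_bound(1)[OF A[OF wA] A[OF z(1)]]] T unfolding C_def n_def by simp
      qed
      have "d \<le> q (\<lambda>t. (1 - e) *\<^sub>R z t + e *\<^sub>R w t)"
        using e by (intro dle conv_fun_combine z(1) wA) auto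
      also have "\<dots> = nsq (LI T) (\<lambda>t. g t - e *\<^sub>R (w t - z t))"
      proof -
        have "(1 - e) *\<^sub>R z t + e *\<^sub>R w t - ubar t = - (g t - e *\<^sub>R (w t - z t))" for t by (simp add: g_def algebra_simps)
        then show ?thesis unfolding q_def ip_self by (simp only: norm_minus_cancel)
      qed
      also have "\<dots> = nsq (LI T) g - 2 * e * ip (LI T) g (\<lambda>t. w t - z t) + e\<^sup>2 * nsq (LI T) (\<lambda>t. w t - z t)"
        by (subst ip_diff_self[OF gL L2_scaleR[OF kL]]) (simp add: ip_scaleR_left ip_scaleR_right power2_eq_square)
      also have "\<dots> \<le> (d + e\<^sup>2) - 2 * e * ip (LI T) g (\<lambda>t. w t - z t) + e\<^sup>2 * C"
        using z(2) kb gg by (intro add_mono diff_right_mono mult_left_mono) auto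
      finally have "e * (2 * ip (LI T) g (\<lambda>t. w t - z t)) \<le> e * (e * (1 + C))"
        by (simp add: power2_eq_square algebra_simps)
      then have gk: "2 * ip (LI T) g (\<lambda>t. w t - z t) \<le> d" using e by (auto dest: mult_left_le_imp_le)
      have "ip (LI T) g (\<lambda>t. ubar t - w t) = nsq (LI T) g - ip (LI T) g (\<lambda>t. w t - z t)"
      proof -
        have "(\<lambda>t. ubar t - w t) = (\<lambda>t. g t - (w t - z t))" by (auto simp: g_def)
        then show ?thesis using ip_diff_right[OF gL kL gL] by simp
      qed
      then show "d / 2 \<le> ip (LI T) g (\<lambda>t. ubar t - w t)" using gk gg dle[OF z(1)] by simp
    qed
  qed
qed

text \<open>If \<open>ubar\<close> had positive distance to \<open>conv D\<close>, it would be separated from \<open>D\<close> by \<open>g = ubar - z\<close> with a nearly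
  closest \<open>z\<close>. As \<open>|g| \<le> 1\<close> componentwise, \<open>g\<close> is \<open>L\<^sup>1\<close>-close to a bounded continuous \<open>c\<close>; sampling \<open>c\<close> on a fine partition
  and scaling by the mesh size \<open>h\<close> gives an admissible inequality that \<open>u k\<close> violates by at least a constant over \<open>h\<close>.
  But \<open>u m\<close> satisfies the chosen cut for \<open>m > k\<close>, so the maximal violation at \<open>u k\<close> is at most a constant times
  \<open>|u k - ubar|\<^sub>1 / \<tau>\<close>, which is \<open>o(1 / h)\<close> by quasi-uniformity.\<close>

lemma cutting_plane_limit:
  fixes D :: "(real \<Rightarrow> real^'n::finite) set" and u :: "nat \<Rightarrow> real \<Rightarrow> real^'n"
    and a :: "nat \<Rightarrow> 'n \<times> nat \<Rightarrow> real"
  assumes T: "0 < T" and p: "1 \<le> p" and D: "\<And>w. w \<in> D \<Longrightarrow> box01 T w" "D \<noteq> {}"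
    and P: "\<And>k. interval_partition T (N k) (I k)" and u: "\<And>k. box01 T (u k)"
    and feas: "\<And>k m. 1 \<le> m \<Longrightarrow> m \<le> k \<Longrightarrow> dotN (N m) (a m) (Pi_avg (N m) (I m) (u k)) \<le> b m"
    and H: "\<And>k. (a (Suc k), b (Suc k)) \<in> H_set (N (Suc k)) (I (Suc k)) D"
    and cut: "\<And>k a' b'. (a', b') \<in> H_set (N (Suc k)) (I (Suc k)) D \<Longrightarrow>
       dotN (N (Suc k)) a' (Pi_avg (N (Suc k)) (I (Suc k)) (u k)) - b'
       \<le> dotN (N (Suc k)) (a (Suc k)) (Pi_avg (N (Suc k)) (I (Suc k)) (u k)) - b (Suc k)"
    and mesh: "(\<lambda>k. Max ((\<lambda>i. measure lebesgue (I k i)) ` {..<N k})) \<longlonglongrightarrow> 0"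
    and kappa: "0 < \<kappa>"
    and quasi: "\<And>k. Max ((\<lambda>i. measure lebesgue (I k i)) ` {..<N k})
       \<le> \<kappa> * Min ((\<lambda>i. measure lebesgue (I k i)) ` {..<N k})"
    and ub: "box01 T ubar"
    and lim: "(\<lambda>k. nsq (LI T) (\<lambda>t. u k t - ubar t)) \<longlonglongrightarrow> 0"
  shows "ubar \<in> Lp_closure p T (conv_fun D)"
proof (rule ccontr)
  assume not: "ubar \<notin> Lp_closure p T (conv_fun D)"
  have T': "0 \<le> T" using T by simp
  define n where "n = real CARD('n)"
  have n: "1 \<le> n" unfolding n_def using zero_less_card_finite[where 'a = 'n] by linarith
  have uL: "L2 (LI T) (u k)" for k by (rule box01_L2[OF u])
  have ubL: "L2 (LI T) ubar" by (rule box01_L2[OF ub])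
  have diffb: "AE t in LI T. norm (v t - w t) \<le> n" if "box01 T v" "box01 T w" for v w :: "real \<Rightarrow> real^'n"
    unfolding n_def by (rule box01_diff_bound(1)[OF that])
  have boxb: "AE t in LI T. norm (w t) \<le> n" if "box01 T w" for w :: "real \<Rightarrow> real^'n"
  proof -
    have "box01 T (\<lambda>t. 0 :: real^'n)" by (simp add: box01_def)
    from diffb[OF that this] show ?thesis by simp
  qed
  obtain d g where d: "0 < d" and gL: "L2 (LI T) g" and gb: "AE t in LI T. \<forall>j. \<bar>g t $ j\<bar> \<le> 1"
    and gd: "\<forall>w\<in>D. d \<le> ip (LI T) g (\<lambda>t. ubar t - w t)"
    by (rule conv_fun_near_minimizer[OF D ub T p not])
  have gm: "g \<in> borel_measurable (LI T)" using gL by (simp add: L2_def)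
  have dn: "0 < d / (2 * n)" using d n by simp
  \<comment> \<open>As \<open>norm (ubar t - w t) \<le> n\<close>, the accuracy
    \<open>d / (2 * n)\<close> costs at most half of the gap, and \<open>c\<close> still separates
    with gap \<open>d2\<close>.\<close>
  obtain c where c: "continuous_on UNIV c" "\<forall>t j. \<bar>c t $ j\<bar> \<le> 1"
    "integrable (LI T) (\<lambda>t. norm (g t - c t))" "(\<integral>t. norm (g t - c t) \<partial>LI T) < d / (2 * n)"
    by (rule continuous_L1_approx[OF gm gb dn])
  have cn: "norm (c t) \<le> n" for t unfolding n_def using norm_le_card[of "c t" 1] c(2) by simp
  have cL: "L2 (LI T) c"
    by (rule L2_bounded(1)[OF continuous_measurable_lebesgue_on[OF c(1)], where K = n]) (simp add: cn)
  define d2 where "d2 = d / 2"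
  have d2: "0 < d2" using d by (simp add: d2_def)
  have cd: "ip (LI T) c w \<le> ip (LI T) c ubar - d2" if w: "w \<in> D" for w
  proof -
    have wL: "L2 (LI T) w" by (rule box01_L2[OF D(1)[OF w]])
    have "\<bar>ip (LI T) (\<lambda>t. g t - c t) (\<lambda>t. ubar t - w t)\<bar> \<le> n * (\<integral>t. norm (g t - c t) \<partial>LI T)"
      by (rule ip_abs_le[OF _ _ diffb[OF ub D(1)[OF w]] T']) (intro L2_diff gL cL ubL wL)+
    also have "\<dots> \<le> n * (d / (2 * n))" using c(4) n by (intro mult_left_mono) auto
    also have "\<dots> = d2" using n by (simp add: d2_def)
    finally have "\<bar>ip (LI T) (\<lambda>t. g t - c t) (\<lambda>t. ubar t - w t)\<bar> \<le> d2" .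
    moreover have "ip (LI T) (\<lambda>t. g t - c t) (\<lambda>t. ubar t - w t)
      = ip (LI T) g (\<lambda>t. ubar t - w t) - ip (LI T) c (\<lambda>t. ubar t - w t)"
      by (intro ip_diff_left gL cL L2_diff ubL wL)
    moreover have "ip (LI T) c (\<lambda>t. ubar t - w t) = ip (LI T) c ubar - ip (LI T) c w"
      by (intro ip_diff_right cL ubL wL)
    ultimately show ?thesis using gd[rule_format, OF w] d2_def by linarith
  qed
  define L where "L k = (\<integral>t. norm (u k t - ubar t) \<partial>LI T)" for k
  have L: "L \<longlonglongrightarrow> 0" unfolding L_def[abs_def] by (rule L2_imp_L1[OF uL ubL T lim])
  \<comment> \<open>Tolerance for sampling \<open>c\<close>. The scaled step function then differs
    from \<open>c\<close> by at most \<open>n * \<eta>\<close> in norm, hence by at most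
    \<open>E\<close> when paired with a function in the box; the constant makes
    \<open>2 * E = d2 / 4\<close>.\<close>
  define \<eta> where "\<eta> = d2 / (8 * n\<^sup>2 * T)"
  have eta: "0 < \<eta>" using d2 n T by (simp add: \<eta>_def)
  define E where "E = n * (n * \<eta> * T)"
  have E: "2 * E = d2 / 4" using n T by (simp add: E_def \<eta>_def power2_eq_square)
  have "uniformly_continuous_on {0..T} c"
    by (intro compact_uniformly_continuous continuous_on_subset[OF c(1)]) auto
  then obtain \<delta> where delta: "0 < \<delta>"
    "\<And>x y. x \<in> {0..T} \<Longrightarrow> y \<in> {0..T} \<Longrightarrow> dist y x < \<delta> \<Longrightarrow> dist (c y) (c x) < \<eta>"
    using eta unfolding uniformly_continuous_on_def by metis
  define h where "h k = Max ((\<lambda>i. measure lebesgue (I k i)) ` {..<N k})" for k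
  define \<tau> where "\<tau> k = Min ((\<lambda>i. measure lebesgue (I k i)) ` {..<N k})" for k
  have "(\<lambda>k. (n + n * \<kappa>) * L k) \<longlonglongrightarrow> (n + n * \<kappa>) * 0" by (intro tendsto_intros L)
  then have "\<forall>\<^sub>F k in sequentially. (n + n * \<kappa>) * L k < d2 / 2" using d2 by (intro order_tendstoD) auto
  moreover have "\<forall>\<^sub>F k in sequentially. h (Suc k) < \<delta>"
    using LIMSEQ_Suc[OF mesh] delta(1) unfolding h_def by (intro order_tendstoD) auto
  ultimately have "\<forall>\<^sub>F k in sequentially. (n + n * \<kappa>) * L k < d2 / 2 \<and> h (Suc k) < \<delta>" by eventually_elim simp
  \<comment> \<open>The final balance will be
    \<open>d2 \<le> 2 * E + n * L k + n * \<kappa> * L k\<close>. The first term is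
    \<open>d2 / 4\<close>, so a contradiction arises once the other two together stay below
    \<open>d2 / 2\<close>.\<close>
  then obtain k where k: "(n + n * \<kappa>) * L k < d2 / 2" "h (Suc k) < \<delta>" by (auto simp: eventually_sequentially)
  define N' where "N' = N (Suc k)"
  define J where "J = I (Suc k)"
  define hK where "hK = h (Suc k)"
  define tK where "tK = \<tau> (Suc k)"
  have PJ: "interval_partition T N' J" using P[of "Suc k"] by (simp add: N'_def J_def)
  have N'0: "0 < N'" by (rule interval_partition_nonempty[OF PJ])
  have fin: "finite ((\<lambda>i. measure lebesgue (J i)) ` {..<N'})" "(\<lambda>i. measure lebesgue (J i)) ` {..<N'} \<noteq> {}" using N'0 by auto
  have le_h: "measure lebesgue (J i) \<le> hK" if "i < N'" for i
    unfolding hK_def h_def J_def[symmetric] N'_def[symmetric] using that fin by (intro Max_ge) auto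
  have ge_t: "tK \<le> measure lebesgue (J i)" if "i < N'" for i
    unfolding tK_def \<tau>_def J_def[symmetric] N'_def[symmetric] using that fin by (intro Min_le) auto
  have tK: "0 < tK"
    unfolding tK_def \<tau>_def J_def[symmetric] N'_def[symmetric] using fin interval_partition_measure_pos[OF PJ] by (subst Min_gr_iff) auto
  have hK: "0 < hK" using tK ge_t[OF N'0] le_h[OF N'0] by linarith
  have ht: "hK \<le> \<kappa> * tK" using quasi[of "Suc k"] by (simp add: hK_def h_def tK_def \<tau>_def)
  have "\<exists>x. x \<in> J i" if i: "i < N'" for i
    using interval_partition_measure_pos[OF PJ i] by (cases "J i = {}") auto
  then obtain x where x: "\<And>i. i < N' \<Longrightarrow> x i \<in> J i" by metis
  \<comment> \<open>The factor \<open>measure lebesgue (J i)\<close> cancels the averaging, so the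
    step function of \<open>a'\<close> has the value \<open>c (x i) / hK\<close> on
    \<open>J i\<close>. Division by the largest length \<open>hK\<close> brings the coefficients
    into \<open>[-1, 1]\<close>.\<close>
  define a' where "a' ji = (if snd ji < N' then measure lebesgue (J (snd ji)) * c (x (snd ji)) $ fst ji / hK else 0)" for ji :: "'n \<times> nat"
  define s' :: "real \<Rightarrow> real^'n" where "s' = stepf N' J (\<lambda>ji. a' ji / measure lebesgue (J (snd ji)))"
  have s'L: "L2 (LI T) s'" unfolding s'_def by (rule stepf_L2[OF PJ])
  have close: "AE t in LI T. norm (hK *\<^sub>R s' t - c t) \<le> n * \<eta>"
    using interval_partition_AE_cover[OF PJ]
  proof eventually_elim
    case (elim t)
    then obtain i where i: "i < N'" "t \<in> J i" by blast
    obtain l r where lr: "l < r" "J i = {l<..<r}" using PJ i(1) unfolding interval_partition_def by meson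
    have "\<bar>x i - t\<bar> < r - l" using x[OF i(1)] i(2) lr by auto
    also have "r - l \<le> hK" using le_h[OF i(1)] lr by simp
    also have "\<dots> < \<delta>" using k(2) by (simp add: hK_def)
    finally have "dist (x i) t < \<delta>" by (simp add: dist_real_def)
    moreover have "x i \<in> {0..T}" "t \<in> {0..T}" using interval_partition_subset[OF PJ i(1)] x[OF i(1)] i(2) by force+
    ultimately have close: "norm (c (x i) - c t) < \<eta>" using delta(2)[of t "x i"] by (simp add: dist_norm)
    have "\<bar>(hK *\<^sub>R s' t - c t) $ j\<bar> \<le> \<eta>" for j
    proof -
      have "s' t $ j = a' (j, i) / measure lebesgue (J i)" unfolding s'_def by (simp add: stepf_eq[OF PJ i])
      also have "\<dots> = c (x i) $ j / hK" using i(1) interval_partition_measure_pos[OF PJ i(1)] by (simp add: a'_def)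
      finally have "(hK *\<^sub>R s' t - c t) $ j = (c (x i) - c t) $ j" using hK by simp
      then show ?thesis using component_le_norm_cart[of "c (x i) - c t" j] close by simp
    qed
    then show ?case unfolding n_def by (rule norm_le_card)
  qed
  have err: "\<bar>hK * ip (LI T) s' w - ip (LI T) c w\<bar> \<le> E" if w: "box01 T w" for w
  proof -
    have wL: "L2 (LI T) w" by (rule box01_L2[OF w])
    have fL: "L2 (LI T) (\<lambda>t. hK *\<^sub>R s' t - c t)" by (intro L2_diff L2_scaleR s'L cL)
    have "hK * ip (LI T) s' w - ip (LI T) c w = ip (LI T) (\<lambda>t. hK *\<^sub>R s' t - c t) w"
      using ip_diff_left[OF L2_scaleR[OF s'L] cL wL, of hK] by (simp add: ip_scaleR_left)
    also have "\<bar>\<dots>\<bar> \<le> n * (\<integral>t. norm (hK *\<^sub>R s' t - c t) \<partial>LI T)"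
      by (rule ip_abs_le[OF fL wL boxb[OF w] T'])
    also have "\<dots> \<le> n * (\<integral>t. n * \<eta> \<partial>LI T)"
      using n L1_le_L2(1)[OF fL T'] close by (intro mult_left_mono integral_mono_AE) auto
    also have "\<dots> = E" using measure_LI[OF T'] by (simp add: E_def)
    finally show ?thesis .
  qed
  define b' where "b' = (ip (LI T) c ubar - d2 + E) / hK"
  have dot': "dotN N' a' (Pi_avg N' J w) = ip (LI T) s' w" if "box01 T w" for w
    unfolding s'_def by (rule dotN_Pi_avg[OF PJ box01_L2[OF that]])
  have "(a', b') \<in> H_set N' J D"
  proof -
    have "-1 \<le> a' (j, i) \<and> a' (j, i) \<le> 1" if i: "i < N'" for j i
    proof -
      have "\<bar>measure lebesgue (J i) * c (x i) $ j\<bar> \<le> hK * 1"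
        unfolding abs_mult using le_h[OF i] c(2) hK by (intro mult_mono) auto
      then have "\<bar>a' (j, i)\<bar> \<le> 1" using hK i by (simp add: a'_def abs_mult)
      then show ?thesis by (simp add: abs_le_iff)
    qed
    moreover have "a' (j, i) = 0" if "N' \<le> i" for j i using that by (simp add: a'_def)
    moreover have "dotN N' a' w \<le> b'" if "w \<in> C_set N' J D" for w
    proof (rule C_set_le[OF _ that])
      fix z assume z: "z \<in> D"
      have "hK * ip (LI T) s' z \<le> ip (LI T) c ubar - d2 + E"
        using err[OF D(1)[OF z]] cd[OF z] by linarith
      then show "dotN N' a' (Pi_avg N' J z) \<le> b'"
        unfolding dot'[OF D(1)[OF z]] b'_def using hK by (simp add: pos_le_divide_eq mult.commute)
    qed
    ultimately show ?thesis by (simp add: H_set_def)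
  qed
  then have "dotN N' a' (Pi_avg N' J (u k)) - b' \<le> dotN N' (a (Suc k)) (Pi_avg N' J (u k)) - b (Suc k)"
    unfolding N'_def J_def by (rule cut)
  define s where "s = stepf N' J (\<lambda>ji. a (Suc k) ji / measure lebesgue (J (snd ji)))"
  have sL: "L2 (LI T) s" unfolding s_def by (rule stepf_L2[OF PJ])
  have dot: "dotN N' (a (Suc k)) (Pi_avg N' J w) = ip (LI T) s w" if "box01 T w" for w
    unfolding s_def by (rule dotN_Pi_avg[OF PJ box01_L2[OF that]])
  have main: "ip (LI T) s' (u k) - b' \<le> ip (LI T) s (u k) - b (Suc k)"
    using \<open>dotN N' a' (Pi_avg N' J (u k)) - b' \<le> _\<close> unfolding dot[OF u] dot'[OF u] .
  \<comment> \<open>Cut \<open>Suc k\<close> is made from \<open>u k\<close> and binds the iterates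
    from \<open>u (Suc k)\<close> on, but not \<open>u k\<close> itself. Passing to the limit,
    \<open>ubar\<close> satisfies it, so \<open>u k\<close> can violate it only by as much as it
    differs from \<open>ubar\<close>.\<close>
  have "ip (LI T) s ubar \<le> b (Suc k)"
  proof (rule LIMSEQ_le_const2)
    show "(\<lambda>m. ip (LI T) s (u m)) \<longlonglongrightarrow> ip (LI T) s ubar"
      using L2_dist_tendsto_imp(1)[OF uL ubL sL lim] by (simp add: ip_commute)
    show "\<exists>M. \<forall>m\<ge>M. ip (LI T) s (u m) \<le> b (Suc k)"
      using feas[of "Suc k"] dot[OF u] unfolding N'_def J_def by (metis Suc_le_mono le0 One_nat_def)
  qed
  then have "ip (LI T) s (u k) - b (Suc k) \<le> ip (LI T) (\<lambda>t. u k t - ubar t) s"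
    using ip_diff_left[OF uL ubL sL, of k] by (simp add: ip_commute)
  also have "\<dots> \<le> \<bar>ip (LI T) (\<lambda>t. u k t - ubar t) s\<bar>" by simp
  also have "\<dots> \<le> (n * (1 / tK)) * L k"
    unfolding L_def
  proof (rule ip_abs_le[OF L2_diff[OF uL ubL] sL _ T'])
    show "AE t in LI T. norm (s t) \<le> n * (1 / tK)"
      using interval_partition_AE_cover[OF PJ]
    proof eventually_elim
      case (elim t)
      then obtain i where i: "i < N'" "t \<in> J i" by blast
      have "\<bar>s t $ j\<bar> \<le> 1 / tK" for j
      proof -
        have "\<bar>a (Suc k) (j, i)\<bar> \<le> 1" using H[of k] i(1) unfolding H_set_def N'_def by (auto simp: abs_le_iff)
        then have "\<bar>a (Suc k) (j, i)\<bar> / measure lebesgue (J i) \<le> 1 / tK"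
          using ge_t[OF i(1)] tK by (intro frac_le) auto
        then show ?thesis
          unfolding s_def stepf_eq[OF PJ i] using interval_partition_measure_pos[OF PJ i(1)] by simp
      qed
      then show ?case unfolding n_def by (rule norm_le_card)
    qed
  qed
  finally have up: "ip (LI T) s (u k) - b (Suc k) \<le> (n * (1 / tK)) * L k" .
  have Lpos: "0 \<le> L k" by (simp add: L_def)
  \<comment> \<open>The factor \<open>1 / tK\<close> stems from coefficients in
    \<open>[-1, 1]\<close> divided by the shortest length. Multiplied by \<open>hK\<close> it is at
    most \<open>\<kappa>\<close>, whatever the partition.\<close>
  have "hK * (ip (LI T) s' (u k) - b') \<le> hK * ((n * (1 / tK)) * L k)"
    using main up hK by (intro mult_left_mono) auto
  also have "\<dots> \<le> (\<kappa> * tK) * ((n * (1 / tK)) * L k)"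
    using ht n tK Lpos by (intro mult_right_mono) auto
  also have "\<dots> = n * \<kappa> * L k" using tK by simp
  finally have 1: "hK * (ip (LI T) s' (u k) - b') \<le> n * \<kappa> * L k" .
  have "hK * b' = ip (LI T) c ubar - d2 + E" using hK by (simp add: b'_def)
  then have 2: "hK * ip (LI T) s' (u k) - (ip (LI T) c ubar - d2 + E) \<le> n * \<kappa> * L k"
    using 1 by (simp add: right_diff_distrib)
  have "\<bar>ip (LI T) (\<lambda>t. u k t - ubar t) c\<bar> \<le> n * L k"
    unfolding L_def by (rule ip_abs_le[OF L2_diff[OF uL ubL] cL _ T']) (simp add: cn)
  moreover have "ip (LI T) (\<lambda>t. u k t - ubar t) c = ip (LI T) c (u k) - ip (LI T) c ubar"
    using ip_diff_left[OF uL ubL cL, of k] by (simp add: ip_commute)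
  moreover have "\<bar>hK * ip (LI T) s' (u k) - ip (LI T) c (u k)\<bar> \<le> E" by (rule err[OF u])
  ultimately have "d2 \<le> 2 * E + n * L k + n * \<kappa> * L k" using 2 by linarith
  then show False using k(1) E d2 by (simp add: distrib_right)
qed

section \<open>Convergence of the algorithm\<close>

lemma admissible_D_box01:
  assumes "admissible_D p T D" "w \<in> D" shows "box01 T w"
proof -
  have m: "w \<in> borel_measurable (LI T)" and "AE t in LI T. \<forall>j. w t $ j \<in> {0, 1}"
    using assms unfolding admissible_D_def BV_def by blast+
  from this(2) have "AE t in LI T. \<forall>j. 0 \<le> w t $ j \<and> w t $ j \<le> 1"
  proof eventually_elim
    case (elim t)
    show ?case
    proof
      fix j
      have "w t $ j = 0 \<or> w t $ j = 1" using elim by blast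
      then show "0 \<le> w t $ j \<and> w t $ j \<le> 1" by auto
    qed
  qed
  with m show ?thesis by (simp add: box01_def)
qed

lemma box01_midpoint:
  fixes v w :: "real \<Rightarrow> real^'n::finite"
  assumes "box01 T v" "box01 T w"
  shows "box01 T (\<lambda>t. (1/2) *\<^sub>R v t + (1/2) *\<^sub>R w t)"
proof (rule conv_fun_box01[of "{v, w}"])
  have "v \<in> conv_fun {v, w}" "w \<in> conv_fun {v, w}" using conv_fun_superset[of "{v, w}"] by auto
  from conv_fun_combine[OF this, of "1/2"]
  show "(\<lambda>t. (1/2) *\<^sub>R v t + (1/2) *\<^sub>R w t) \<in> conv_fun {v, w}" by simp
qed (use assms in auto)

lemma feas_k_iff:
  fixes v :: "real \<Rightarrow> real^'n::finite"
  assumes P: "\<And>k. interval_partition T (N k) (I k)"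
  shows "feas_k T N I a b k v \<longleftrightarrow> box01 T v \<and> (\<forall>m\<in>{1..k}.
     ip (LI T) (stepf (N m) (I m) (\<lambda>ji. a m ji / measure lebesgue (I m (snd ji)))) v \<le> b m)"
proof (cases "box01 T v")
  case True
  show ?thesis unfolding feas_k_def by (simp only: dotN_Pi_avg[OF P box01_L2[OF True]])
qed (simp add: feas_k_def)

lemma feas_k_midpoint:
  fixes v w :: "real \<Rightarrow> real^'n::finite"
  assumes P: "\<And>k. interval_partition T (N k) (I k)" and v: "feas_k T N I a b k v" and w: "feas_k T N I a b k w"
  shows "feas_k T N I a b k (\<lambda>t. (1/2) *\<^sub>R v t + (1/2) *\<^sub>R w t)"
proof -
  have b: "box01 T v" "box01 T w" using v w by (auto simp: feas_k_def)
  note L = box01_L2[OF b(1)] box01_L2[OF b(2)]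
  have eq: "ip (LI T) (stepf (N m) (I m) c) (\<lambda>t. (1/2) *\<^sub>R v t + (1/2) *\<^sub>R w t)
     = (ip (LI T) (stepf (N m) (I m) c) v + ip (LI T) (stepf (N m) (I m) c) w) / 2" for m and c :: "'n \<times> nat \<Rightarrow> real"
    by (subst ip_add_right[OF L2_scaleR[OF L(1)] L2_scaleR[OF L(2)] stepf_L2[OF P]]) (simp add: ip_scaleR_right)
  show ?thesis
    unfolding feas_k_iff[OF P] eq
  proof (intro conjI ballI box01_midpoint b)
    fix m assume m: "m \<in> {1..k}"
    let ?s = "stepf (N m) (I m) (\<lambda>ji. a m ji / measure lebesgue (I m (snd ji))) :: real \<Rightarrow> real^'n"
    have "ip (LI T) ?s v \<le> b m" "ip (LI T) ?s w \<le> b m"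
      using v w m unfolding feas_k_iff[OF P] by blast+
    moreover have "(x + y) / 2 \<le> z" if "x \<le> z" "y \<le> z" for x y z :: real using that by simp
    ultimately show "(ip (LI T) ?s v + ip (LI T) ?s w) / 2 \<le> b m" by blast
  qed
qed

text \<open>Each relaxed problem contains the feasible set of (PC): a cut from \<open>H_set\<close>
  holds on \<open>D\<close>, extends to convex combinations by linearity and to the closure by
  continuity in \<open>L2\<close>.\<close>

lemma closure_conv_feasible:
  fixes D :: "(real \<Rightarrow> real^'n::finite) set"
  assumes P: "\<And>k. interval_partition T (N k) (I k)" and D: "\<And>w. w \<in> D \<Longrightarrow> box01 T w"
    and H: "\<And>k. (a (Suc k), b (Suc k)) \<in> H_set (N (Suc k)) (I (Suc k)) D"
    and v: "v \<in> Lp_closure p T (conv_fun D)" and p: "1 \<le> p" and T: "0 < T"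
  shows "feas_k T N I a b k v"
proof -
  obtain w where w: "\<forall>m::nat. w m \<in> conv_fun D" and vb: "box01 T v"
    and lim: "(\<lambda>m. nsq (LI T) (\<lambda>t. w m t - v t)) \<longlonglongrightarrow> 0"
    by (rule Lp_closure_box01[OF conv_fun_box01[OF D] v p T])
  have wL: "L2 (LI T) (w m)" for m by (rule box01_L2[OF conv_fun_box01[OF D w[rule_format]]])
  have "ip (LI T) (stepf (N m) (I m) (\<lambda>ji. a m ji / measure lebesgue (I m (snd ji)))) v \<le> b m" if m: "1 \<le> m" for m
  proof -
    define s :: "real \<Rightarrow> real^'n" where "s = stepf (N m) (I m) (\<lambda>ji. a m ji / measure lebesgue (I m (snd ji)))"
    have sL: "L2 (LI T) s" unfolding s_def by (rule stepf_L2[OF P])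
    obtain m' where m': "m = Suc m'" using m by (cases m) auto
    have sD: "ip (LI T) s z \<le> b m" if z: "z \<in> D" for z
    proof -
      have "Pi_avg (N m) (I m) z \<in> C_set (N m) (I m) D"
        unfolding C_set_def by (rule subsetD[OF conv_fun_superset imageI[OF z]])
      moreover have "\<forall>x\<in>C_set (N m) (I m) D. dotN (N m) (a m) x \<le> b m"
        using H[of m'] unfolding H_set_def m' by blast
      ultimately have "dotN (N m) (a m) (Pi_avg (N m) (I m) z) \<le> b m" by blast
      then show ?thesis unfolding s_def using dotN_Pi_avg[OF P box01_L2[OF D[OF z]], of m "a m"] by simp
    qed
    have "ip (LI T) s f \<le> b m" if f: "f \<in> conv_fun D" for f
    proof -
      obtain l c z where z: "\<And>i::nat. i < l \<Longrightarrow> 0 \<le> c i \<and> z i \<in> D" "(\<Sum>i<l. c i) = 1" "f = (\<lambda>x. \<Sum>i<l. c i *\<^sub>R z i x)"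
        using f unfolding conv_fun_def mem_Collect_eq by blast
      have "ip (LI T) s f = (\<Sum>i<l. c i * ip (LI T) s (z i))"
        unfolding z(3) by (rule ip_sum_right(2)[OF sL]) (use z(1) D box01_L2 in auto)
      also have "\<dots> \<le> (\<Sum>i<l. c i * b m)" using z(1) sD by (intro sum_mono mult_left_mono) auto
      also have "\<dots> = b m" using z(2) by (simp flip: sum_distrib_right)
      finally show ?thesis .
    qed
    then have "ip (LI T) s (w i) \<le> b m" for i using w by blast
    moreover have "(\<lambda>i. ip (LI T) s (w i)) \<longlonglongrightarrow> ip (LI T) s v"
      using L2_dist_tendsto_imp(1)[OF wL box01_L2[OF vb] sL lim] by (simp add: ip_commute)
    ultimately show ?thesis unfolding s_def[symmetric] by (intro LIMSEQ_le_const2) auto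
  qed
  then show ?thesis using vb by (simp add: feas_k_iff[OF P])
qed

text \<open>One empty interval would make the minimal length zero; quasi-uniformity would then make
  the maximal length zero and all intervals empty, so that they could not cover
  \<open>{0..T}\<close>.\<close>

lemma interval_partitionI:
  assumes T: "0 < T" and op: "\<forall>i<N. \<exists>l r. I i = {l<..<r::real}" and disj: "disjoint_family_on I {..<N}"
    and cover: "(\<Union>i<N. closure (I i)) = {0..T}"
    and quasi: "Max ((\<lambda>i. measure lebesgue (I i)) ` {..<N}) \<le> \<kappa> * Min ((\<lambda>i. measure lebesgue (I i)) ` {..<N})"
  shows "interval_partition T N I"
proof -
  have "l < r" if i: "i < N" and I: "I i = {l<..<r}" for i l r
  proof (rule ccontr)
    assume "\<not> l < r"
    then have 0: "measure lebesgue (I i) = 0" using I by simp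
    let ?A = "(\<lambda>i. measure lebesgue (I i)) ` {..<N}"
    have "Min ?A \<le> 0" using i 0 by (intro Min_le_iff[THEN iffD2]) force+
    moreover have "0 \<le> Min ?A" using i by (intro Min.boundedI) auto
    ultimately have "Max ?A \<le> 0" using quasi by simp
    have "I j = {}" if j: "j < N" for j
    proof -
      obtain l' r' where lr: "I j = {l'<..<r'}" using op j by blast
      have "measure lebesgue (I j) \<le> Max ?A" using j by (intro Max_ge) auto
      then have "measure lebesgue (I j) \<le> 0" using \<open>Max ?A \<le> 0\<close> by simp
      then have "\<not> l' < r'" using lr by auto
      then show ?thesis using lr by simp
    qed
    then have "(\<Union>i<N. closure (I i)) = {}" by simp
    then show False using cover T by simp
  qed
  then have "\<forall>i<N. \<exists>l r. l < r \<and> I i = {l<..<r}" using op by blast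
  then show ?thesis using T disj cover by (simp add: interval_partition_def)
qed

theorem theorem3p2:
  fixes \<Omega> :: "'d::euclidean_space set"
    and T \<alpha> p \<kappa> :: real
    and \<psi> :: "'n::finite \<Rightarrow> (('d \<Rightarrow> real) \<Rightarrow> real)"
    and y0 :: "'d \<Rightarrow> real" and yd :: "real \<Rightarrow> 'd \<Rightarrow> real"
    and S :: "(real \<Rightarrow> real^'n) \<Rightarrow> (real \<Rightarrow> 'd \<Rightarrow> real)"
    and D :: "(real \<Rightarrow> real^'n) set"
    and u :: "nat \<Rightarrow> real \<Rightarrow> real^'n"
    and N :: "nat \<Rightarrow> nat" and I :: "nat \<Rightarrow> nat \<Rightarrow> real set"
    and a :: "nat \<Rightarrow> 'n \<times> nat \<Rightarrow> real" and b :: "nat \<Rightarrow> real"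
  assumes T: "T > 0"
    and dom: "lipschitz_domain \<Omega>"
    and psi: "\<forall>j. Hm1 \<Omega> (\<psi> j)"
    and y0: "L2_on \<Omega> y0"
    and yd: "L2_on ({0<..<T} \<times> \<Omega>) (\<lambda>(t,x). yd t x)"
    and alpha: "\<alpha> > 0"
    and S: "\<forall>v. L2_on {0<..<T} v \<longrightarrow> heat_weak_sol \<Omega> T \<psi> y0 v (S v)"
    and p: "1 \<le> p"
    and D: "admissible_D p T D"
    \<comment> \<open>Step 1 (initialisation)\<close>
    and N0: "N 0 = 1" and I0: "I 0 0 = {0<..<T}"
    \<comment> \<open>Step 2: u k is the optimal solution of (PC_k)\<close>
    and opt: "\<forall>k. feas_k T N I a b k (u k) \<and>
                 (\<forall>v. feas_k T N I a b k v \<longrightarrow> obj \<Omega> T \<alpha> S yd (u k) \<le> obj \<Omega> T \<alpha> S yd v)"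
    \<comment> \<open>Step 3: the algorithm never stops\<close>
    and nostop: "\<forall>k. u k \<notin> Lp_closure p T (conv_fun D)"
    \<comment> \<open>Step 6: the new partition separates u k\<close>
    and sep: "\<forall>k. Pi_avg (N (Suc k)) (I (Suc k)) (u k) \<notin> C_set (N (Suc k)) (I (Suc k)) D"
    \<comment> \<open>Step 7: a most violated inequality\<close>
    and cut: "\<forall>k. (a (Suc k), b (Suc k)) \<in> H_set (N (Suc k)) (I (Suc k)) D \<and>
                (\<forall>(a',b')\<in>H_set (N (Suc k)) (I (Suc k)) D.
                   dotN (N (Suc k)) a' (Pi_avg (N (Suc k)) (I (Suc k)) (u k)) - b'
                   \<le> dotN (N (Suc k)) (a (Suc k)) (Pi_avg (N (Suc k)) (I (Suc k)) (u k)) - b (Suc k))"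
    \<comment> \<open>(i)\<close>
    and part_open: "\<forall>k. \<forall>i<N k. \<exists>l r. I k i = {l<..<r}"
    and part_disj: "\<forall>k. disjoint_family_on (I k) {..<N k}"
    and part_cover: "\<forall>k. (\<Union>i<N k. closure (I k i)) = {0..T}"
    \<comment> \<open>(ii)\<close>
    and mesh: "(\<lambda>k. Max ((\<lambda>i. measure lebesgue (I k i)) ` {..<N k})) \<longlonglongrightarrow> 0"
    \<comment> \<open>(iii)\<close>
    and nested: "\<forall>k. \<forall>r<N (Suc k). \<exists>i<N k. I (Suc k) r \<subseteq> I k i"
    \<comment> \<open>quasi-uniformity\<close>
    and kappa: "\<kappa> > 0"
    and quasi: "\<forall>k. Max ((\<lambda>i. measure lebesgue (I k i)) ` {..<N k})
                    \<le> \<kappa> * Min ((\<lambda>i. measure lebesgue (I k i)) ` {..<N k})"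
  shows "\<exists>ubar. ubar \<in> Lp_closure p T (conv_fun D) \<and>
           (\<forall>v\<in>Lp_closure p T (conv_fun D). obj \<Omega> T \<alpha> S yd ubar \<le> obj \<Omega> T \<alpha> S yd v) \<and>
           (\<forall>v\<in>Lp_closure p T (conv_fun D).
               (\<forall>w\<in>Lp_closure p T (conv_fun D). obj \<Omega> T \<alpha> S yd v \<le> obj \<Omega> T \<alpha> S yd w) \<longrightarrow>
               (AE t in lebesgue_on {0<..<T}. v t = ubar t)) \<and>
           (\<lambda>k. \<integral>t. (norm (u k t - ubar t))\<^sup>2 \<partial>lebesgue_on {0<..<T}) \<longlonglongrightarrow> 0"
proof -
  let ?J = "obj \<Omega> T \<alpha> S yd"
  have \<Omega>: "open \<Omega>" using dom by (simp add: lipschitz_domain_def)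
  have psi': "Hm1 \<Omega> (\<psi> j)" for j using psi by blast
  have S': "heat_weak_sol \<Omega> T \<psi> y0 v (S v)" if "L2_on {0<..<T} v" for v using S that by blast
  have P: "interval_partition T (N k) (I k)" for k
    using T part_open part_disj part_cover quasi by (intro interval_partitionI[of T _ _ \<kappa>]) auto
  have DB: "box01 T w" if "w \<in> D" for w by (rule admissible_D_box01[OF D that])
  have H: "(a (Suc k), b (Suc k)) \<in> H_set (N (Suc k)) (I (Suc k)) D" for k using cut by blast
  have cut': "dotN (N (Suc k)) a' (Pi_avg (N (Suc k)) (I (Suc k)) (u k)) - b'
       \<le> dotN (N (Suc k)) (a (Suc k)) (Pi_avg (N (Suc k)) (I (Suc k)) (u k)) - b (Suc k)"
    if "(a', b') \<in> H_set (N (Suc k)) (I (Suc k)) D" for k a' b'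
    using cut that by fastforce
  have Dne: "D \<noteq> {}"
    \<comment> \<open>otherwise every \<open>b'\<close> is admissible and no inequality is most violated\<close>
  proof
    assume "D = {}"
    then have "C_set (N (Suc 0)) (I (Suc 0)) D = {}"
      by (auto simp: C_set_def conv_fun_def intro!: exI gr0I)
    then have "((\<lambda>_. 0), b') \<in> H_set (N (Suc 0)) (I (Suc 0)) D" for b' by (simp add: H_set_def)
    from cut'[OF this] have "- b' \<le> dotN (N (Suc 0)) (a (Suc 0)) (Pi_avg (N (Suc 0)) (I (Suc 0)) (u 0)) - b (Suc 0)" for b'
      by (simp add: dotN_def)
    from this[of "- (dotN (N (Suc 0)) (a (Suc 0)) (Pi_avg (N (Suc 0)) (I (Suc 0)) (u 0)) - b (Suc 0)) - 1"]
    show False by simp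
  qed
  have feas: "feas_k T N I a b k (u k)" and min: "feas_k T N I a b k v \<Longrightarrow> ?J (u k) \<le> ?J v" for k v
    using opt by auto
  have uB: "box01 T (u k)" for k using feas[of k] by (simp add: feas_k_def)
  have uL: "L2_on {0<..<T} (u k)" for k using box01_L2[OF uB] by (simp add: L2_on_iff_L2)
  have feas_mono: "feas_k T N I a b k (u m)" if "k \<le> m" for k m
    using feas[of m] that by (auto simp: feas_k_def)
  have CF: "feas_k T N I a b k v" if "v \<in> Lp_closure p T (conv_fun D)" for k v
    by (rule closure_conv_feasible[where D = D and N = N and I = I and a = a and b = b, OF P DB H that p T])
  obtain w0 where "w0 \<in> D" using Dne by blast
  then have w0c: "w0 \<in> conv_fun D" using conv_fun_superset by blast
  have w0: "w0 \<in> Lp_closure p T (conv_fun D)"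
    by (rule Lp_closure_box01I[OF w0c conv_fun_box01[OF DB] DB[OF \<open>w0 \<in> D\<close>] _ p T]) simp_all
  obtain ubar where ub: "L2_on {0<..<T} ubar"
    and lim: "(\<lambda>k. nsq (LI T) (\<lambda>t. u k t - ubar t)) \<longlonglongrightarrow> 0"
    and Jlim: "(\<lambda>k. ?J (u k)) \<longlonglongrightarrow> ?J ubar"
  proof (rule minimizing_sequence_converges[OF \<Omega> T psi' S' yd alpha uL])
    show "?J (u k) \<le> ?J (\<lambda>t. (1/2) *\<^sub>R u k t + (1/2) *\<^sub>R u m t)" if "k \<le> m" for k m
      by (rule min[OF feas_k_midpoint[OF P feas feas_mono[OF that]]])
    show "?J (u k) \<le> ?J w0" for k by (rule min[OF CF[OF w0]])
  qed
  have uL': "L2 (LI T) (u k)" for k by (rule box01_L2[OF uB])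
  have ubL: "L2 (LI T) ubar" using ub by (simp add: L2_on_iff_L2)
  have ubB: "box01 T ubar"
    using L1_le_L2(1)[OF L2_diff[OF uL' ubL]] T ubL
    by (intro box01_L1_closed[OF uB _ _ L2_imp_L1[OF uL' ubL T lim]]) (auto simp: L2_def)
  have ubC: "ubar \<in> Lp_closure p T (conv_fun D)"
  proof (rule cutting_plane_limit[OF T p DB Dne P uB _ H cut' mesh kappa _ ubB lim])
    show "dotN (N m) (a m) (Pi_avg (N m) (I m) (u k)) \<le> b m" if "1 \<le> m" "m \<le> k" for k m
      using feas[of k] that by (simp add: feas_k_def)
  qed (use quasi in auto)
  have opt_ub: "?J ubar \<le> ?J v" if "v \<in> Lp_closure p T (conv_fun D)" for v
    using min[OF CF[OF that]] by (intro LIMSEQ_le_const2[OF Jlim]) auto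
  \<comment> \<open>The midpoint is taken between \<open>v\<close> and \<open>u k\<close> instead of
    \<open>v\<close> and \<open>ubar\<close>: it is feasible for the relaxed problem, where
    \<open>feas_k_midpoint\<close> provides convexity. As \<open>k\<close> grows,
    \<open>\<alpha> / 8\<close> times the squared distance of \<open>v\<close> and
    \<open>ubar\<close> is bounded by \<open>(?J v - ?J ubar) / 2\<close>, which is zero.\<close>
  have uniq: "AE t in LI T. v t = ubar t"
    if v: "v \<in> Lp_closure p T (conv_fun D)" and vmin: "\<forall>w\<in>Lp_closure p T (conv_fun D). ?J v \<le> ?J w" for v
  proof -
    have vB: "box01 T v" using CF[OF v, of 0] by (simp add: feas_k_def)
    have vL: "L2 (LI T) v" by (rule box01_L2[OF vB])
    have Jv: "?J v = ?J ubar" using vmin ubC opt_ub[OF v] by fastforce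
    have L: "L2 (LI T) (\<lambda>t. v t - ubar t)" by (intro L2_diff vL ubL)
    have "\<alpha> / 8 * nsq (LI T) (\<lambda>t. v t - ubar t) \<le> 0"
    proof -
      have mid: "?J (\<lambda>t. (1/2) *\<^sub>R u k t + (1/2) *\<^sub>R v t) = (?J (u k) + ?J v) / 2
        - nsq (lebesgue_on ({0<..<T} \<times> \<Omega>)) (\<lambda>p. S (u k) (fst p) (snd p) - S v (fst p) (snd p)) / 8
        - \<alpha> / 8 * nsq (LI T) (\<lambda>t. u k t - v t)" for k
        by (rule obj_midpoint[OF \<Omega> T psi' S' yd uL]) (use vL in \<open>simp_all add: L2_on_iff_L2\<close>)
      have le: "\<alpha> / 8 * nsq (LI T) (\<lambda>t. u k t - v t) \<le> (?J v - ?J (u k)) / 2" for k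
      proof -
        have ar: "z \<le> (y - x) / 2" if "x \<le> m" "m = (x + y) / 2 - q / 8 - z" "0 \<le> q" for m q x y z :: real
          using that by (simp add: field_simps)
        show ?thesis by (rule ar[OF min[OF feas_k_midpoint[OF P feas CF[OF v]]] mid ip_nonneg])
      qed
      have "(\<lambda>k. nsq (LI T) (\<lambda>t. u k t - v t)) \<longlonglongrightarrow> nsq (LI T) (\<lambda>t. ubar t - v t)"
        by (rule L2_dist_tendsto_imp(2)[OF L2_diff[OF uL' vL] L2_diff[OF ubL vL] L2_zero]) (use lim in simp)
      then have "(\<lambda>k. \<alpha> / 8 * nsq (LI T) (\<lambda>t. u k t - v t)) \<longlonglongrightarrow> \<alpha> / 8 * nsq (LI T) (\<lambda>t. ubar t - v t)"
        by (intro tendsto_intros)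
      moreover have "(\<lambda>k. (?J v - ?J (u k)) / 2) \<longlonglongrightarrow> (?J v - ?J ubar) / 2" by (intro tendsto_intros Jlim) simp
      ultimately have "\<alpha> / 8 * nsq (LI T) (\<lambda>t. ubar t - v t) \<le> (?J v - ?J ubar) / 2"
        using le by (intro LIMSEQ_le) auto
      moreover have "nsq (LI T) (\<lambda>t. ubar t - v t) = nsq (LI T) (\<lambda>t. v t - ubar t)"
        unfolding ip_self by (simp only: norm_minus_commute)
      ultimately show ?thesis using Jv by simp
    qed
    then have "nsq (LI T) (\<lambda>t. v t - ubar t) \<le> 0" using alpha by (simp add: mult_le_0_iff)
    then have "(\<integral>t. (norm (v t - ubar t))\<^sup>2 \<partial>LI T) = 0"
      unfolding ip_self by (rule antisym) simp
    moreover have "integrable (LI T) (\<lambda>t. (norm (v t - ubar t))\<^sup>2)" using L by (simp add: L2_def)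
    ultimately have "AE t in LI T. (norm (v t - ubar t))\<^sup>2 = 0"
      by (subst (asm) integral_nonneg_eq_0_iff_AE) auto
    then show ?thesis by eventually_elim simp
  qed
  show ?thesis
    using ubC opt_ub uniq lim by (intro exI[of _ ubar]) (auto simp: ip_self)
qed

end
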